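(* For $n\ge 1$ let $p_n$ denote the $n$-th prime number (so $p_1=2$, $p_2=3$, $\dots$) and let $M_n=2^{p_n}-1$. Then the sequence $\{M_n\}_{n\ge1}$ is Benford distributed, i.e., $$\lim_{N\to\infty}\frac1N\#\{n\le N: D(M_n)=d\}=\log_{10}\left(1+\frac1d\right)\quad\text{for every } d\in\{1,2,\dots,9\},$$ where $D(x)$ denotes the leading digit of $x$ in base $10$.
   Context: For a positive real number $x$, the leading digit $D(x)\in\{1,2,\dots,9\}$ of $x$ in base $10$ is defined by: $D(x)=d$ if and only if $d\cdot 10^k\le x<(d+1)\cdot 10^k$ for some $k\in\mathbb{Z}$. A sequence $\{a_n\}_{n\ge1}$ of positive real numbers is called Benford distributed if $\lim_{N\to\infty}\frac1N\#\{n\le N: D(a_n)=d\}=\log_{10}(1+1/d)$ for $d=1,2,\dots,9$. The numbers $M_n$ are not required to be prime; only the exponents $p_n$ are prime. *)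

theory Defs
  imports Complex_Main "HOL-Library.Infinite_Set" "HOL-Computational_Algebra.Primes"
begin

definition leading_digit :: "real \<Rightarrow> nat" where
  "leading_digit x = (THE d. d \<in> {1..9} \<and>
     (\<exists>k::int. real d * 10 powi k \<le> x \<and> x < (real d + 1) * 10 powi k))"

lemma leading_digit_unique:
  fixes x :: real and d e :: nat and k l :: int
  assumes "d \<in> {1..9}" "real d * 10 powi k \<le> x" "x < (real d + 1) * 10 powi k"
    and "e \<in> {1..9}" "real e * 10 powi l \<le> x" "x < (real e + 1) * 10 powi l"
  shows "d = e"
proof -
  have le: "k' \<le> l'"
    if a: "d' \<in> {1..9}" "real d' * 10 powi k' \<le> x"
      and b: "e' \<in> {1..9}" "x < (real e' + 1) * 10 powi l'"
    for d' e' :: nat and k' l' :: int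
  proof (rule ccontr)
    assume "\<not> k' \<le> l'"
    hence "(10::real) powi (l' + 1) \<le> 10 powi k'"
      by (intro power_int_increasing) auto
    also have "\<dots> \<le> real d' * 10 powi k'" using a by simp
    also have "\<dots> \<le> x" by fact
    also have "\<dots> < (real e' + 1) * 10 powi l'" by fact
    also have "\<dots> \<le> 10 * 10 powi l'" using b by (intro mult_right_mono) auto
    also have "\<dots> = 10 powi (l' + 1)" by (simp add: power_int_add)
    finally show False by simp
  qed
  have kl: "k = l" using le assms by (meson antisym)
  have p: "(0::real) < 10 powi l" by simp
  have "real d * 10 powi l < (real e + 1) * 10 powi l"
    using assms(2,6) unfolding kl by (rule order.strict_trans1)
  hence de: "real d < real e + 1"
    using p by (simp only: mult_less_cancel_right_pos)
  have "real e * 10 powi l < (real d + 1) * 10 powi l"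
    using assms(5,3) unfolding kl by (rule order.strict_trans1)
  hence "real e < real d + 1"
    using p by (simp only: mult_less_cancel_right_pos)
  with de show ?thesis by linarith
qed

lemma leading_digit_exists:
  fixes x :: real
  assumes "x > 0"
  shows "\<exists>d::nat. d \<in> {1..9} \<and>
    (\<exists>k::int. real d * 10 powi k \<le> x \<and> x < (real d + 1) * 10 powi k)"
proof -
  define k where "k = \<lfloor>log 10 x\<rfloor>"
  define y where "y = x / 10 powi k"
  have p: "(0::real) < 10 powi k" by simp
  have e: "10 powr of_int j = (10::real) powi j" for j
    by (simp add: powr_real_of_int')
  have "10 powr of_int k \<le> 10 powr log 10 x" unfolding k_def by simp
  hence lo: "10 powi k \<le> x" using assms e by simp
  have "10 powr log 10 x < 10 powr of_int (k + 1)"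
    unfolding k_def by (intro powr_less_mono) linarith+
  hence "x < 10 powi (k + 1)" unfolding e using assms by simp
  hence hi: "x < 10 * 10 powi k" by (simp add: power_int_add)
  have y: "1 \<le> y" "y < 10" using lo hi p by (simp_all add: y_def field_simps)
  define d where "d = nat \<lfloor>y\<rfloor>"
  have d: "real d \<le> y" "y < real d + 1" "d \<in> {1..9}"
    using y by (auto simp: d_def) linarith+
  have "real d * 10 powi k \<le> x" "x < (real d + 1) * 10 powi k"
    using d p by (simp_all add: y_def field_simps)
  thus ?thesis using d(3) by blast
qed

lemma leading_digit_eq_iff:
  assumes "x > 0" "d \<in> {1..9}"
  shows "leading_digit x = d \<longleftrightarrow>
    (\<exists>k::int. real d * 10 powi k \<le> x \<and> x < (real d + 1) * 10 powi k)"
proof -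
  have "\<exists>!d::nat. d \<in> {1..9} \<and>
      (\<exists>k::int. real d * 10 powi k \<le> x \<and> x < (real d + 1) * 10 powi k)" (is "\<exists>!d. ?P d")
    using leading_digit_exists[OF assms(1)] leading_digit_unique by blast
  from theI'[OF this] the1_equality[OF this] assms(2) show ?thesis
    unfolding leading_digit_def by blast
qed

text \<open>Sequences are indexed from 1; the value at index 0 is irrelevant.\<close>

definition benford_distributed :: "(nat \<Rightarrow> real) \<Rightarrow> bool" where
  "benford_distributed a \<longleftrightarrow> (\<forall>n\<ge>1. a n > 0) \<and>
     (\<forall>d\<in>{1..9::nat}.
        (\<lambda>N. real (card {n \<in> {1..N}. leading_digit (a n) = d}) / real N)
          \<longlonglongrightarrow> log 10 (1 + 1 / real d))"

text \<open>\<^const>\<open>enumerate\<close> counts from 0, whereas the first prime has index 1 here.\<close>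

definition nth_prime :: "nat \<Rightarrow> nat" where
  "nth_prime n = enumerate {p. prime p} (n - 1)"

definition mersenne :: "nat \<Rightarrow> real" where
  "mersenne n = 2 ^ nth_prime n - 1"

end

theory Submission
  imports Defs "Jordan_Normal_Form.Determinant" "HOL-Analysis.Analysis"
    "HOL-Number_Theory.Number_Theory" "HOL-Computational_Algebra.Squarefree"
    "HOL-Real_Asymp.Real_Asymp"
begin

text \<open>
The leading digit of \<open>2 ^ p - 1\<close> is governed by the fractional part of \<open>p * \<alpha>\<close> with
\<open>\<alpha> = log 10 2\<close>, so by Weyl's criterion it suffices that
\<open>\<Sum>p \<le> N. exp (2 * pi * \<i> * h * p * \<alpha>) = o(N / ln N)\<close> for every \<open>h \<ge> 1\<close>. Vinogradov's method (Vaughan's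
identity with type I and type II estimates) gives this as soon as \<open>h * \<alpha>\<close> has, for each large \<open>N\<close>, an
approximation \<open>a / q\<close> with \<open>q\<close> between a power of \<open>ln N\<close> and \<open>N\<close> divided by such a power. By
Dirichlet's theorem only a too small \<open>q\<close> has to be excluded; since \<open>\<alpha>\<close> is not an arbitrary irrational, this
follows from the bound \<open>\<bar>u * ln 2 - v * ln 5\<bar> \<ge> c * exp (- C * ln (u + 1) ^ 2)\<close>, and no
information on primes in arithmetic progressions is needed. The bound is proved by Thue's method: a
nonzero integer polynomial \<open>P(X, Y)\<close>, small in a suitable sense by the pigeonhole principle, takes at the points
\<open>(r * v + s * u, 2 ^ r * 5 ^ s)\<close> integer values of absolute value below 1 if the linear form is tiny,
whereas an elementary zero estimate shows that it cannot vanish at all these points.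
\<close>

section \<open>Lower bounds for linear forms in log 2 and log 5\<close>

hide_const (open) Finite_Cartesian_Product.mat Finite_Cartesian_Product.vec
unbundle no vec_syntax

text \<open>In the excluded case \<open>q\<close> is below a power of \<open>ln N\<close>, hence so
  are the integers in the linear form, while the form itself is \<open>O((ln N)^8 / N)\<close>. A
  lower bound like \<open>exp (- C * (ln ln N)^2)\<close> contradicts this, so the square of the
  logarithm is harmless; the trivial bound, exponential in \<open>u\<close>, would be far too weak.
  The square counts coefficients: for exponents up to \<open>2 ^ M\<close> both degrees of the
  auxiliary polynomial are proportional to \<open>M\<close>, and a form below
  \<open>exp (- K * L)\<close>, where \<open>K * L\<close> is the number of coefficients, is
  contradictory. The polynomial only has to have small Taylor coefficients, not vanishing ones, so
  the pigeonhole principle works with real data; and since \<open>2 ^ r * 5 ^ s\<close> is an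
  integer, no heights of algebraic numbers occur. The power 8 comes from the type II estimate, which
  loses three logarithms and saves the square root of \<open>q\<close>: with
  \<open>l = 1 + ln N\<close> and \<open>q\<close> between \<open>l ^ 8\<close> and
  \<open>N / l ^ 8\<close> there remains \<open>N / l\<close>, and \<open>o(N)\<close> is all that
  is wanted.\<close>

text \<open>Dirichlet's box argument: \<open>(H + 1) ^ N\<close> vectors with entries in
  \<open>{0..H}\<close>, where \<open>N = card J\<close>, fall into at most
  \<open>(2 * b + 2) ^ T\<close> boxes of side \<open>\<delta>\<close>, and two vectors in one box
  are subtracted. Having twice as many unknowns as forms makes an \<open>H\<close> linear in
  \<open>A / \<delta>\<close> sufficient.\<close>

lemma small_integer_combination:
  fixes c :: "nat \<Rightarrow> 'a \<Rightarrow> real" and A \<delta> :: real and H T :: nat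
  assumes J: "finite J" "J \<noteq> {}" and card: "2 * T \<le> card J" and A: "0 \<le> A" and \<delta>: "0 < \<delta>"
    and c: "\<And>t j. t < T \<Longrightarrow> j \<in> J \<Longrightarrow> \<bar>c t j\<bar> \<le> A"
    and H: "2 * real (card J) * A / \<delta> + 1 \<le> real H"
  obtains p :: "'a \<Rightarrow> int" where "\<exists>j\<in>J. p j \<noteq> 0" "\<And>j. j \<in> J \<Longrightarrow> \<bar>p j\<bar> \<le> int H"
    "\<And>t. t < T \<Longrightarrow> \<bar>\<Sum>j\<in>J. c t j * of_int (p j)\<bar> \<le> \<delta>"
proof -
  define N where "N = card J"
  define Z where "Z = J \<rightarrow>\<^sub>E {0..int H}"
  define b where "b = \<lfloor>real N * A * real H / \<delta>\<rfloor>"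
  define B where "B = {..<T} \<rightarrow>\<^sub>E {-b-1..b}"
  define \<phi> where "\<phi> p = (\<lambda>t\<in>{..<T}. \<lfloor>(\<Sum>j\<in>J. c t j * of_int (p j)) / \<delta>\<rfloor>)" for p :: "'a \<Rightarrow> int"
  have N: "N > 0" using J by (auto simp: N_def card_gt_0_iff)
  have b0: "b \<ge> 0" unfolding b_def using A \<delta> by simp
  have sumle: "\<bar>\<Sum>j\<in>J. c t j * of_int (p j)\<bar> \<le> real N * A * real H" if "p \<in> Z" "t < T" for p t
  proof -
    have "\<bar>\<Sum>j\<in>J. c t j * of_int (p j)\<bar> \<le> (\<Sum>j\<in>J. A * real H)"
    proof (rule order_trans[OF sum_abs sum_mono])
      fix j assume j: "j \<in> J"
      have "p j \<in> {0..int H}" using that j unfolding Z_def by auto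
      hence "\<bar>real_of_int (p j)\<bar> \<le> real H" by auto
      thus "\<bar>c t j * of_int (p j)\<bar> \<le> A * real H"
        unfolding abs_mult using c[OF that(2) j] A by (intro mult_mono) auto
    qed
    thus ?thesis by (simp add: N_def)
  qed
  have maps: "\<phi> \<in> Z \<rightarrow> B"
  proof
    fix p assume p: "p \<in> Z"
    have "\<lfloor>(\<Sum>j\<in>J. c t j * of_int (p j)) / \<delta>\<rfloor> \<in> {-b-1..b}" if t: "t < T" for t
    proof -
      define x where "x = (\<Sum>j\<in>J. c t j * of_int (p j)) / \<delta>"
      define y where "y = real N * A * real H / \<delta>"
      have "\<bar>x\<bar> \<le> y" unfolding x_def y_def abs_divide using \<delta> sumle[OF p t]
        by (simp add: divide_right_mono)
      hence "x \<le> y" "- y \<le> x" by auto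
      hence "\<lfloor>x\<rfloor> \<le> \<lfloor>y\<rfloor>" "\<lfloor>-y\<rfloor> \<le> \<lfloor>x\<rfloor>" by (auto intro: floor_mono)
      moreover have "-\<lfloor>y\<rfloor> - 1 \<le> \<lfloor>-y\<rfloor>" by linarith
      ultimately show ?thesis unfolding b_def x_def y_def by auto
    qed
    thus "\<phi> p \<in> B" unfolding B_def \<phi>_def by auto
  qed
  have cardZ: "card Z = (H+1) ^ N"
    unfolding Z_def using J by (simp add: card_PiE N_def nat_add_distrib)
  have cardB: "card B = nat (2*b+2) ^ T"
    unfolding B_def using b0 by (simp add: card_PiE algebra_simps)
  have H1: "real H \<ge> 1"
    using H A \<delta> by (smt (verit) divide_nonneg_pos mult_nonneg_nonneg of_nat_0_le_iff)
  \<comment> \<open>As \<open>N\<close> is at least \<open>2 * T\<close>, comparing cardinalities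
    reduces to this inequality for a single form. The hypothesis on \<open>H\<close> gives
    \<open>2 * N * A * H / \<delta> <= (H - 1) * H\<close>.\<close>
  have lt1: "2*b+2 < (int H+1)^2"
  proof -
    have "real_of_int b \<le> real N * A * real H / \<delta>" unfolding b_def by linarith
    moreover have "2 * (real N * A * real H / \<delta>) = (2 * real N * A / \<delta>) * real H" by simp
    moreover have "\<dots> \<le> (real H - 1) * real H" using H by (intro mult_right_mono) (auto simp: N_def)
    moreover have "(real H - 1) * real H + 2 < (real H + 1)^2"
      using H1 by (simp add: power2_eq_square algebra_simps)
    ultimately have "real_of_int (2*b+2) < real_of_int ((int H+1)^2)" by simp
    thus ?thesis by (simp only: of_int_less_iff)
  qed
  have "\<not> inj_on \<phi> Z"
  proof
    assume inj: "inj_on \<phi> Z"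
    have "card Z \<le> card B" using maps inj unfolding B_def
      by (intro card_inj_on_le[of \<phi>]) (auto intro!: finite_PiE)
    hence 1: "(H+1)^N \<le> nat (2*b+2) ^ T" using cardZ cardB by simp
    have Hpos: "(1::nat) < H + 1"
      using H1 by simp
    have "nat (2*b+2) < (H+1)^2"
      using lt1 b0 by (simp add: nat_less_iff power2_eq_square algebra_simps)
    show False
    proof (cases "T = 0")
      case True
      thus False using 1 N Hpos one_less_power[OF Hpos N] by simp
    next
      case False
      have "nat (2*b+2) ^ T < ((H+1)^2)^T"
        using False \<open>nat (2*b+2) < (H+1)^2\<close> by (intro power_strict_mono) auto
      also have "\<dots> = (H+1)^(2*T)" by (simp only: power_mult)
      also have "\<dots> \<le> (H+1)^N" using card by (intro power_increasing) (auto simp: N_def)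
      finally show False using 1 by simp
    qed
  qed
  then obtain p q where pq: "p \<in> Z" "q \<in> Z" "p \<noteq> q" "\<phi> p = \<phi> q" unfolding inj_on_def by blast
  show ?thesis
  proof (rule that[of "\<lambda>j. p j - q j"])
    show "\<exists>j\<in>J. p j - q j \<noteq> 0" using pq(1-3) unfolding Z_def by (metis PiE_ext eq_iff_diff_eq_0)
    show "\<bar>p j - q j\<bar> \<le> int H" if "j \<in> J" for j
    proof -
      have "p j \<in> {0..int H}" "q j \<in> {0..int H}" using pq(1,2) that unfolding Z_def by auto
      thus ?thesis by auto
    qed
    show "\<bar>\<Sum>j\<in>J. c t j * of_int (p j - q j)\<bar> \<le> \<delta>" if t: "t < T" for t
    proof -
      define x where "x = (\<Sum>j\<in>J. c t j * of_int (p j))"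
      define y where "y = (\<Sum>j\<in>J. c t j * of_int (q j))"
      have "\<lfloor>x / \<delta>\<rfloor> = \<lfloor>y / \<delta>\<rfloor>" using fun_cong[OF pq(4), of t] t by (simp add: \<phi>_def x_def y_def)
      hence "\<bar>x/\<delta> - y/\<delta>\<bar> \<le> 1" by linarith
      hence "\<bar>x - y\<bar> \<le> \<delta>" using \<delta> by (simp add: diff_divide_distrib[symmetric] field_simps)
      moreover have "(\<Sum>j\<in>J. c t j * of_int (p j - q j)) = x - y"
        by (simp add: x_def y_def algebra_simps sum_subtractf)
      ultimately show ?thesis by simp
    qed
  qed
qed

section \<open>Zero estimate for exponential polynomials\<close>

text \<open>A kernel vector of the transpose is the coefficient list of a nonzero polynomial of
  degree below \<open>n\<close> with \<open>n\<close> distinct roots.\<close>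

lemma vandermonde_det_nonzero:
  fixes x :: "nat \<Rightarrow> real"
  assumes "inj_on x {0..<n}"
  shows "Determinant.det (mat n n (\<lambda>(i, j). x j ^ i)) \<noteq> 0"
proof
  define A where "A = mat n n (\<lambda>(i, j). x j ^ i)"
  assume "Determinant.det (mat n n (\<lambda>(i, j). x j ^ i)) = 0"
  hence "Determinant.det (transpose_mat A) = 0"
    by (subst Determinant.det_transpose[of _ n]) (auto simp: A_def)
  then obtain w where w: "w \<in> carrier_vec n" "w \<noteq> 0\<^sub>v n" "transpose_mat A *\<^sub>v w = 0\<^sub>v n"
    by (subst (asm) det_0_iff_vec_prod_zero[of _ n]) (auto simp: A_def)
  define p where "p = (\<Sum>i<n. Polynomial.monom (w $ i) i)"
  have co: "poly.coeff p i = (if i < n then w $ i else 0)" for i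
    unfolding p_def by (auto simp: coeff_sum coeff_monom sum.delta')
  have roots: "poly p (x j) = 0" if j: "j < n" for j
  proof -
    have "0 = (transpose_mat A *\<^sub>v w) $ j" using w(3) j by simp
    also have "\<dots> = (\<Sum>i<n. x j ^ i * w $ i)"
      using j w(1) by (simp add: A_def scalar_prod_def lessThan_atLeast0)
    also have "\<dots> = poly p (x j)" unfolding p_def by (simp add: poly_sum poly_monom mult.commute)
    finally show ?thesis by simp
  qed
  obtain i where i: "i < n" "w $ i \<noteq> 0"
    using w(1,2) by (metis carrier_vecD eq_vecI index_zero_vec)
  hence p0: "p \<noteq> 0" using co[of i] by auto
  have "degree p < n"
    using i(1) co by (intro degree_lessI) auto
  moreover have "n \<le> card {z. poly p z = 0}"
  proof -
    have "n = card (x ` {0..<n})" using assms by (simp add: card_image)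
    also have "\<dots> \<le> card {z. poly p z = 0}"
      using roots poly_roots_finite[OF p0] by (intro card_mono) auto
    finally show ?thesis .
  qed
  ultimately show False using card_poly_roots_bound[OF p0] by linarith
qed

text \<open>
  Shifting a zero \<open>(x, y)\<close> of \<open>\<Sum>l<L. Q l(X) * Y ^ l\<close> by the first \<open>n\<close> multiples of \<open>(v, 2)\<close> gives
  \<open>n\<close> linear equations for the powers \<open>y ^ l\<close> with \<open>Q l \<noteq> 0\<close>. Their determinant, a polynomial in \<open>X\<close>
  whose top coefficient is a Vandermonde determinant in the nodes \<open>2 ^ l\<close>, therefore vanishes at
  more points than its degree allows.
\<close>

lemma zero_estimate:
  fixes Q :: "nat \<Rightarrow> real poly" and u v K L R S :: nat
  assumes uv: "coprime u v" "R \<le> u" "v > 0"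
    and deg: "\<And>l. l < L \<Longrightarrow> degree (Q l) \<le> K"
    and card: "K * L < R * S"
    and vanish: "\<And>r s. r < R + L \<Longrightarrow> s < S \<Longrightarrow>
      (\<Sum>l<L. poly (Q l) (real (r * v + s * u)) * (2 ^ r * 5 ^ s) ^ l) = 0"
    and l: "l < L"
  shows "Q l = 0"
proof (rule ccontr)
  assume Ql: "Q l \<noteq> 0"
  \<comment> \<open>Vanishing \<open>Q l\<close> are dropped, so that every entry of the determinant
    has a nonzero leading coefficient; the assumption \<open>Ql\<close> guarantees that something
    remains.\<close>
  define I where "I = {l. l < L \<and> Q l \<noteq> 0}"
  define n where "n = card I"
  have finI: "finite I" by (simp add: I_def)
  obtain f where f: "bij_betw f {0..<n} I"
    using finI unfolding n_def by (metis ex_bij_betw_nat_finite)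
  have nL: "n \<le> L" unfolding n_def using card_mono[of "{..<L}" I] by (auto simp: I_def)
  have n0: "n > 0" using Ql l finI by (auto simp: n_def I_def card_gt_0_iff)
  have fI: "f j < L" "Q (f j) \<noteq> 0" if "j < n" for j
    using f that by (auto simp: bij_betw_def I_def)
  \<comment> \<open>\<open>c i\<close> is the polynomial \<open>X + i * v\<close>. Row
    \<open>i\<close> of \<open>A\<close> is the equation at \<open>(r + i, s)\<close>: there
    \<open>X\<close> becomes \<open>X + i * v\<close>, and \<open>Y\<close> is multiplied by
    \<open>2 ^ i\<close>.\<close>
  define c where "c i = [:real (i * v), 1:]" for i
  define a where "a i j = smult ((2^i)^(f j)) (Q (f j) \<circ>\<^sub>p c i)" for i j
  define A where "A = mat n n (\<lambda>(i, j). a i j)"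
  define D where "D = Determinant.det A"
  define d where "d = (\<Sum>j=0..<n. degree (Q (f j)))"
  have degc: "degree (c i) = 1" "lead_coeff (c i) = 1" for i by (auto simp: c_def)
  have dega: "degree (a i j) = degree (Q (f j))" for i j
    by (simp add: a_def degree_pcompose degc)
  have leada: "lead_coeff (a i j) = (2^f j)^i * lead_coeff (Q (f j))" for i j
    using lead_coeff_comp[of "c i" "Q (f j)"] degc[of i]
    by (simp add: a_def degree_pcompose power_mult[symmetric] mult.commute)
  have a0: "a i j \<noteq> 0" if "j < n" for i j
    using leada[of i j] fI[OF that] by auto
  \<comment> \<open>All permutation products have the same degree \<open>d\<close>, so the
    coefficient of \<open>D\<close> at \<open>d\<close> is again a determinant: a Vandermonde
    determinant times the product of the leading coefficients.\<close>
  have perm: "degree (\<Prod>i=0..<n. a i (p i)) = d"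
       "poly.coeff (\<Prod>i=0..<n. a i (p i)) d = (\<Prod>i=0..<n. (2^f (p i))^i) * (\<Prod>j=0..<n. lead_coeff (Q (f j)))"
    if p: "p permutes {0..<n}" for p
  proof -
    have pn: "p i < n" if "i < n" for i using permutes_in_image[OF p, of i] that by simp
    have "degree (\<Prod>i=0..<n. a i (p i)) = (\<Sum>i=0..<n. degree (a i (p i)))"
      by (intro degree_prod_sum_eq) (auto intro!: a0 pn)
    also have "\<dots> = (\<Sum>i=0..<n. degree (Q (f (p i))))" by (simp add: dega)
    also have "\<dots> = d" unfolding d_def
      by (rule sum.reindex_bij_betw[OF permutes_imp_bij[OF p]])
    finally show *: "degree (\<Prod>i=0..<n. a i (p i)) = d" .
    have "poly.coeff (\<Prod>i=0..<n. a i (p i)) d = (\<Prod>i=0..<n. lead_coeff (a i (p i)))"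
      using lead_coeff_prod[of "\<lambda>i. a i (p i)" "{0..<n}"] * by simp
    also have "\<dots> = (\<Prod>i=0..<n. (2^f (p i))^i) * (\<Prod>i=0..<n. lead_coeff (Q (f (p i))))"
      by (simp only: leada prod.distrib)
    also have "(\<Prod>i=0..<n. lead_coeff (Q (f (p i)))) = (\<Prod>j=0..<n. lead_coeff (Q (f j)))"
      by (rule prod.reindex_bij_betw[OF permutes_imp_bij[OF p]])
    finally show "poly.coeff (\<Prod>i=0..<n. a i (p i)) d = (\<Prod>i=0..<n. (2^f (p i))^i) * (\<Prod>j=0..<n. lead_coeff (Q (f j)))" .
  qed
  have Dexp: "D = (\<Sum>p | p permutes {0..<n}. signof p * (\<Prod>i=0..<n. a i (p i)))"
  proof -
    have "D = (\<Sum>p | p permutes {0..<n}. signof p * (\<Prod>i=0..<n. A $$ (i, p i)))"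
      unfolding D_def by (rule det_def') (simp add: A_def)
    also have "\<dots> = (\<Sum>p | p permutes {0..<n}. signof p * (\<Prod>i=0..<n. a i (p i)))"
    proof (intro sum.cong refl, goal_cases)
      case (1 p)
      hence "p i < n" if "i < n" for i using permutes_in_image[of p "{0..<n}" i] that by simp
      thus ?case by (simp add: A_def)
    qed
    finally show ?thesis .
  qed
  have signco: "poly.coeff (signof p * q) k = signof p * poly.coeff q k" for p :: "nat \<Rightarrow> nat" and q :: "real poly" and k
    by (simp add: sign_def)
  have "poly.coeff D d = (\<Sum>p | p permutes {0..<n}. signof p * (\<Prod>i=0..<n. (2^f (p i))^i)) * (\<Prod>j=0..<n. lead_coeff (Q (f j)))"
    unfolding Dexp coeff_sum sum_distrib_right signco using perm by (intro sum.cong) auto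
  also have "(\<Sum>p | p permutes {0..<n}. signof p * (\<Prod>i=0..<n. (2^f (p i))^i)) =
      Determinant.det (mat n n (\<lambda>(i, j). (2^f j)^i :: real))"
    unfolding det_def'[OF mat_carrier]
  proof (intro sum.cong refl, goal_cases)
    case (1 p)
    hence "p i < n" if "i < n" for i using permutes_in_image[of p "{0..<n}" i] that by simp
    thus ?case by simp
  qed
  finally have coD: "poly.coeff D d = Determinant.det (mat n n (\<lambda>(i, j). (2^f j)^i :: real)) * (\<Prod>j=0..<n. lead_coeff (Q (f j)))" .
  have "inj_on (\<lambda>j. 2 ^ f j :: real) {0..<n}"
    using f by (auto simp: bij_betw_def inj_on_def)
  hence "poly.coeff D d \<noteq> 0" using vandermonde_det_nonzero fI(2) unfolding coD by auto
  hence D0: "D \<noteq> 0" by auto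
  have "degree D \<le> d"
    unfolding Dexp
  proof (intro degree_sum_le)
    fix p assume "p \<in> {p. p permutes {0..<n}}"
    thus "degree (signof p * (\<Prod>i=0..<n. a i (p i))) \<le> d"
      using perm(1)[of p] by (auto simp: sign_def)
  qed (simp add: finite_permutations)
  also have "d \<le> (\<Sum>j=0..<n. K)" unfolding d_def using deg fI by (intro sum_mono) auto
  also have "\<dots> \<le> K * L" using nL by simp
  finally have degD: "degree D \<le> K * L" .
  define g where "g = (\<lambda>(r, s). real (r * v + s * u))"
  \<comment> \<open>The residue of \<open>r * v\<close> modulo \<open>u\<close> determines
    \<open>r\<close>, as \<open>r < R \<le> u\<close> and \<open>v\<close> is invertible modulo
    \<open>u\<close>. Thus there are \<open>R * S\<close> distinct points.\<close>
  have inj: "inj_on g ({..<R} \<times> {..<S})"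
  proof (rule inj_onI, clarsimp simp: g_def)
    fix r s r' s' assume *: "r < R" "r' < R" "real r * real v + real s * real u = real r' * real v + real s' * real u"
    have "real (r * v + s * u) = real (r' * v + s' * u)" using * by simp
    hence eq: "r * v + s * u = r' * v + s' * u" by (simp only: of_nat_eq_iff)
    hence "[r * v = r' * v] (mod u)"
      by (metis cong_def mod_mult_self1 add.commute mult.commute)
    hence "[r = r'] (mod u)" using uv(1) by (simp add: cong_mult_rcancel_nat coprime_commute)
    hence "r = r'" using *(1,2) uv(2) by (simp add: cong_def)
    thus "r = r' \<and> s = s'" using eq *(1) uv(2) by auto
  qed
  have root: "poly D (g (r, s)) = 0" if rs: "r < R" "s < S" for r s
  proof -
    define x where "x = real (r * v + s * u)"
    define y where "y = (2::real) ^ r * 5 ^ s"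
    interpret h: comm_ring_hom "\<lambda>p :: real poly. poly p x" by unfold_locales auto
    have "poly D x = Determinant.det (map_mat (\<lambda>p. poly p x) A)" unfolding D_def by simp
    also have "\<dots> = 0"
    proof (subst det_0_iff_vec_prod_zero[of _ n])
      show "map_mat (\<lambda>p. poly p x) A \<in> carrier_mat n n" by (simp add: A_def)
      \<comment> \<open>This vector solves all \<open>n\<close> shifted equations. The shifts reach
        \<open>r + n - 1 < R + L\<close>, which is why vanishing is assumed for
        \<open>r < R + L\<close> although only \<open>r < R\<close> is counted.\<close>
      define w where "w = vec n (\<lambda>j. y ^ f j)"
      have "w \<noteq> 0\<^sub>v n"
      proof
        assume "w = 0\<^sub>v n"
        hence "w $ 0 = 0" using n0 by simp
        thus False using n0 by (simp add: w_def y_def)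
      qed
      moreover have "map_mat (\<lambda>p. poly p x) A *\<^sub>v w = 0\<^sub>v n"
      proof (rule eq_vecI)
        fix i assume i: "i < dim_vec (0\<^sub>v n)"
        have "(map_mat (\<lambda>p. poly p x) A *\<^sub>v w) $ i = (\<Sum>j=0..<n. poly (a i j) x * y ^ f j)"
          using i by (simp add: A_def w_def scalar_prod_def)
        also have "\<dots> = (\<Sum>j=0..<n. poly (Q (f j)) (real ((r + i) * v + s * u)) * (2 ^ (r + i) * 5 ^ s) ^ f j)"
          by (intro sum.cong refl)
             (simp add: a_def c_def poly_pcompose x_def y_def power_add power_mult_distrib algebra_simps)
        also have "\<dots> = (\<Sum>l\<in>I. poly (Q l) (real ((r + i) * v + s * u)) * (2 ^ (r + i) * 5 ^ s) ^ l)"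
          by (rule sum.reindex_bij_betw[OF f])
        also have "\<dots> = (\<Sum>l<L. poly (Q l) (real ((r + i) * v + s * u)) * (2 ^ (r + i) * 5 ^ s) ^ l)"
          by (intro sum.mono_neutral_left) (auto simp: I_def)
        also have "\<dots> = 0" using rs i nL by (intro vanish) auto
        finally show "(map_mat (\<lambda>p. poly p x) A *\<^sub>v w) $ i = 0\<^sub>v n $ i" using i by simp
      qed (simp add: A_def)
      ultimately show "\<exists>w. w \<in> carrier_vec n \<and> w \<noteq> 0\<^sub>v n \<and> map_mat (\<lambda>p. poly p x) A *\<^sub>v w = 0\<^sub>v n"
        by (intro exI[of _ w]) (auto simp: w_def)
    qed
    finally show ?thesis by (simp add: x_def g_def)
  qed
  have "R * S = card (g ` ({..<R} \<times> {..<S}))" using inj by (simp add: card_image card_cartesian_product)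
  also have "\<dots> \<le> card {x. poly D x = 0}"
    using root poly_roots_finite[OF D0] by (intro card_mono) auto
  also have "\<dots> \<le> degree D" by (rule card_poly_roots_bound[OF D0])
  finally show False using degD card by simp
qed

section \<open>Exponential estimates and the interpolation argument\<close>

text \<open>The term \<open>(exp 1 * z) ^ n / fact n\<close> of the series of
  \<open>exp (exp 1 * z)\<close> is at most the whole sum, and \<open>exp 1 \<le> 3\<close>.\<close>

lemma power_div_fact_le_exp:
  fixes z :: real
  assumes "z \<ge> 0"
  shows "z ^ n / fact n \<le> exp (3 * z - n)"
proof -
  have "(exp 1 * z) ^ n / fact n \<le> exp (exp 1 * z)"
  proof -
    have "(exp 1 * z) ^ n / fact n \<le> (\<Sum>m<Suc n. (exp 1 * z) ^ m / fact m)"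
      using assms by (intro member_le_sum) auto
    also have "\<dots> \<le> (\<Sum>m. (exp 1 * z) ^ m / fact m)"
      using assms summable_exp[of "exp 1 * z"]
      by (intro sum_le_suminf) (auto simp: field_simps)
    also have "\<dots> = exp (exp 1 * z)" by (simp add: exp_def field_simps)
    finally show ?thesis .
  qed
  also have "\<dots> \<le> exp (3 * z)" using exp_le assms by (simp add: mult_right_mono)
  finally have "exp n * (z ^ n / fact n) \<le> exp (3 * z)"
    by (simp add: power_mult_distrib exp_of_nat_mult[symmetric])
  thus ?thesis by (simp add: exp_diff field_simps)
qed

lemma exp_Taylor_remainder:
  fixes z :: real
  assumes "z \<ge> 0"
  shows "\<bar>exp z - (\<Sum>m<n. z ^ m / fact m)\<bar> \<le> exp (4 * z - n)"
proof -
  obtain t where t: "\<bar>t\<bar> \<le> \<bar>z\<bar>" "exp z = (\<Sum>m<n. z ^ m / fact m) + exp t / fact n * z ^ n"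
    using Maclaurin_exp_le[of z n] by blast
  have "\<bar>exp z - (\<Sum>m<n. z ^ m / fact m)\<bar> = exp t * (z ^ n / fact n)"
    using t(2) assms by (simp add: abs_mult)
  also have "\<dots> \<le> exp z * exp (3 * z - n)"
    using t(1) assms power_div_fact_le_exp[of z n] by (intro mult_mono) auto
  also have "\<dots> = exp (4 * z - n)" by (simp add: exp_add[symmetric])
  finally show ?thesis .
qed

lemma abs_exp_diff_le:
  fixes a b :: real
  assumes "a \<le> m" "b \<le> m"
  shows "\<bar>exp a - exp b\<bar> \<le> \<bar>a - b\<bar> * exp m"
proof -
  have *: "exp y - exp x \<le> (y - x) * exp m" if "x \<le> y" "y \<le> m" for x y :: real
  proof -
    have "1 - exp (x - y) \<le> y - x" using exp_ge_add_one_self[of "x - y"] by linarith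
    hence "exp y * (1 - exp (x - y)) \<le> exp y * (y - x)" by simp
    also have "\<dots> \<le> exp m * (y - x)" using that by (intro mult_right_mono) auto
    also have "exp y * (1 - exp (x - y)) = exp y - exp x" by (simp add: exp_diff right_diff_distrib)
    finally show ?thesis by (simp add: mult.commute)
  qed
  show ?thesis
    using *[of a b] *[of b a] assms by (cases "a \<le> b") auto
qed

text \<open>Put \<open>F(x) = P(x, exp (c * x))\<close> with \<open>c = ln 2 / v\<close>. At
  \<open>x = r * v + s * u\<close> one has
  \<open>c * x = r * ln 2 + s * ln 5 + s * \<Lambda> / v\<close>, so for tiny
  \<open>\<Lambda>\<close> the value \<open>F(x)\<close> is close to the integer
  \<open>P(x, 2 ^ r * 5 ^ s)\<close>. If the first \<open>T\<close> Taylor coefficients of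
  \<open>F\<close> are small, these integers vanish, against \<open>zero_estimate\<close>. In
  \<open>large\<close>, the bound \<open>A\<close> contributes \<open>4 * G * L\<close> and one
  \<open>K * ln X\<close>, the Taylor remainder \<open>16 * G * L\<close>, and the monomials
  \<open>x ^ k\<close> the other \<open>K * ln X\<close>.\<close>

lemma interpolation_contradiction:
  fixes u v K L G T :: nat
  defines "\<Lambda> \<equiv> real u * ln 2 - real v * ln 5"
  defines "X \<equiv> real (G * (u + v))" and "N \<equiv> K * L"
  assumes uv: "coprime u v" "v > 0"
    and pos: "K > 0" "L > 0" "T > 0" "L \<le> G"
    and T: "2 * T \<le> K * L" "K \<le> T"
    and large: "real T - real K \<ge> 20 * real G * real L + 2 * real K * ln X + ln (40 * real N ^ 2 * real T)"
    and zero: "K * L < (G - L) * G" "G - L \<le> u"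
  shows "\<bar>\<Lambda>\<bar> > exp (- real N)"
proof (rule ccontr)
  assume "\<not> ?thesis"
  hence small: "\<bar>\<Lambda>\<bar> \<le> exp (- real N)" by simp
  define c where "c = ln 2 / real v"
  define A where "A = X ^ K * exp (4 * real G * real L)"
  define H where "H = nat \<lceil>8 * real N * real T * A\<rceil> + 1"
  define J where "J = {..<K} \<times> {..<L}"
  \<comment> \<open>The coefficient of \<open>(x / X) ^ t\<close> in
    \<open>x ^ k * exp (c * l * x)\<close>. Since \<open>X\<close> bounds all \<open>x\<close> that
    occur, the powers of \<open>x / X\<close> are at most 1.\<close>
  define co where "co t = (\<lambda>(k :: nat, l :: nat). if k \<le> t then X ^ k * ((c * l * X) ^ (t - k) / fact (t - k)) else 0)" for t :: nat
  have G0: "G > 0" using pos by auto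
  have N0: "N > 0" using pos by (simp add: N_def)
  have X1: "X \<ge> 1"
  proof -
    have "1 \<le> G * (u + v)" using G0 uv(2) by (simp add: Suc_leI)
    thus ?thesis unfolding X_def by linarith
  qed
  have A1: "A \<ge> 1" unfolding A_def using X1 by (simp add: mult_ge1_I)
  have c0: "c \<ge> 0" unfolding c_def by simp
  have ln2: "ln 2 \<le> (7/10::real)" using ln2_le_25_over_36 by linarith
  have ln5: "ln 5 \<le> (2::real)"
  proof -
    have "(5::real) \<le> exp 2" using exp_lower_Taylor_quadratic[of 2] by simp
    thus ?thesis by (metis ln_exp ln_le_cancel_iff exp_gt_zero zero_less_numeral)
  qed
  have L1: "\<bar>\<Lambda>\<bar> \<le> 1" using small by (rule order_trans) simp
  have uln: "real u * ln 2 = real v * ln 5 + \<Lambda>" by (simp add: \<Lambda>_def)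
  \<comment> \<open>A small form keeps \<open>u / v\<close> bounded; hence the exponents
    \<open>c * l * x\<close> are at most \<open>4 * G * L\<close>, however large \<open>u\<close>
    and \<open>v\<close> are.\<close>
  have uv_le: "real u / real v * ln 2 \<le> 3"
  proof -
    have "real u * ln 2 \<le> real v * 2 + 1" unfolding uln using L1 ln5
      by (intro add_mono mult_left_mono) auto
    also have "\<dots> \<le> real v * 3" using uv(2) by simp
    finally show ?thesis using uv(2) by (simp add: field_simps)
  qed
  have cX: "c * X \<le> 4 * real G"
  proof -
    have "c * X = real G * (real u / real v * ln 2 + ln 2)"
      using uv(2) by (simp add: c_def X_def field_simps)
    also have "\<dots> \<le> real G * 4" using uv_le ln2 by (intro mult_left_mono) auto
    finally show ?thesis by simp
  qed
  have clX: "c * real l * X \<le> 4 * real G * real L" if "l < L" for l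
  proof -
    have "c * real l * X = (c * X) * real l" by simp
    also have "\<dots> \<le> (4 * real G) * real L" using that c0 X1 by (intro mult_mono[OF cX]) auto
    finally show ?thesis .
  qed
  have coA: "\<bar>co t j\<bar> \<le> A" if jJ: "j \<in> J" for t j
  proof -
    obtain k l where j: "j = (k, l)" "k < K" "l < L" using jJ by (cases j) (auto simp: J_def)
    have z: "c * real l * X \<ge> 0" using c0 X1 by simp
    have "(c * real l * X) ^ n / fact n \<le> exp (4 * real G * real L)" for n
    proof -
      have "(c * real l * X) ^ n / fact n \<le> (\<Sum>m<Suc n. (c * real l * X) ^ m / fact m)"
        using z by (intro member_le_sum) auto
      also have "\<dots> \<le> exp (c * real l * X)"
        using Maclaurin_exp_le[of "c * real l * X" "Suc n"] z by auto
      also have "\<dots> \<le> exp (4 * real G * real L)" using clX[OF j(3)] by simp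
      finally show ?thesis .
    qed
    moreover have "X ^ k \<le> X ^ K" using X1 j by (intro power_increasing) auto
    ultimately have "X ^ k * ((c * real l * X) ^ (t - k) / fact (t - k)) \<le> A"
      unfolding A_def using X1 z by (intro mult_mono) auto
    thus ?thesis using z X1 A1 by (auto simp: co_def j(1) abs_mult)
  qed
  have HA: "8 * real N * real T * A + 1 \<le> real H" unfolding H_def by linarith
  have H_le: "real H \<le> 10 * real N * real T * A"
  proof -
    have "1 \<le> real N * real T * A" using N0 pos A1
      by (simp add: Suc_leI mult_ge1_I)
    moreover have "0 \<le> 8 * real N * real T * A" using A1 by simp
    hence "real H \<le> 8 * real N * real T * A + 2" unfolding H_def by linarith
    ultimately show ?thesis by linarith
  qed
  have fJ: "finite J" "J \<noteq> {}" "2 * T \<le> card J" "card J = N"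
    using pos T by (auto simp: J_def N_def card_cartesian_product)
  \<comment> \<open>The bound \<open>1 / (4 * T)\<close> for each of \<open>T\<close> coefficients
    makes the truncated series at most 1/4. For this \<open>\<delta>\<close> the quantity
    \<open>2 * N * A / \<delta>\<close> is the \<open>8 * N * T * A\<close> in
    \<open>H\<close>.\<close>
  obtain p :: "nat \<times> nat \<Rightarrow> int" where p: "\<exists>j\<in>J. p j \<noteq> 0" "\<And>j. j \<in> J \<Longrightarrow> \<bar>p j\<bar> \<le> int H"
    "\<And>t. t < T \<Longrightarrow> \<bar>\<Sum>j\<in>J. co t j * of_int (p j)\<bar> \<le> 1 / (4 * real T)"
  proof (rule small_integer_combination[of J T A "1 / (4 * real T)" co H])
    show "2 * real (card J) * A / (1 / (4 * real T)) + 1 \<le> real H"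
      using HA pos by (simp add: fJ mult_ac)
  qed (use fJ A1 coA pos in auto)
  have pH: "\<bar>real_of_int (p j)\<bar> \<le> real H" if "j \<in> J" for j using p(2)[OF that] by linarith
  have main_le: "real N * real H * X ^ K \<le> 1/4 * exp (real T - real K - 16 * real G * real L)"
  proof -
    have "4 * (real N * real H * X ^ K) \<le> 4 * (real N * (10 * real N * real T * A) * X ^ K)"
      using H_le X1 by (intro mult_left_mono mult_right_mono) auto
    also have "\<dots> = (40 * real N ^ 2 * real T) * X ^ K * X ^ K * exp (4 * real G * real L)"
      by (simp add: A_def power2_eq_square mult_ac)
    also have "\<dots> = exp (ln (40 * real N ^ 2 * real T)) * exp (real K * ln X) * exp (real K * ln X) * exp (4 * real G * real L)"
      using N0 pos X1 by (simp add: exp_of_nat_mult)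
    also have "\<dots> = exp (ln (40 * real N ^ 2 * real T) + 2 * real K * ln X + 4 * real G * real L)"
      by (simp add: exp_add[symmetric])
    also have "\<dots> \<le> exp (real T - real K - 16 * real G * real L)" using large by simp
    finally show ?thesis by simp
  qed
  define Q where "Q l = (\<Sum>k<K. Polynomial.monom (real_of_int (p (k, l))) k)" for l
  have Qco: "poly.coeff (Q l) k = (if k < K then real_of_int (p (k, l)) else 0)" for l k
    unfolding Q_def by (auto simp: coeff_sum coeff_monom sum.delta')
  have degQ: "degree (Q l) \<le> K" for l by (intro degree_le) (auto simp: Qco)
  have vanish: "(\<Sum>l<L. poly (Q l) (real (r * v + s * u)) * (2 ^ r * 5 ^ s) ^ l) = 0"
    if rs: "r < G" "s < G" for r s
  proof -
    define x where "x = real (r * v + s * u)"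
    define y where "y = (2::real) ^ r * 5 ^ s"
    \<comment> \<open>\<open>W\<close> is the integer value of the polynomial, \<open>F\<close> its
      interpolation and \<open>F0\<close> the Taylor polynomial of \<open>F\<close> of degree below
      \<open>T\<close>. Each of \<open>W - F\<close>, \<open>F - F0\<close> and \<open>F0\<close> is
      allotted 1/4.\<close>
    define W where "W = (\<Sum>(k,l)\<in>J. real_of_int (p (k, l)) * (x ^ k * y ^ l))"
    define F where "F = (\<Sum>(k,l)\<in>J. real_of_int (p (k, l)) * (x ^ k * exp (c * l * x)))"
    define F0 where "F0 = (\<Sum>(k,l)\<in>J. real_of_int (p (k, l)) * (x ^ k * (\<Sum>m<T-k. (c * l * x) ^ m / fact m)))"
    have x0: "x \<ge> 0" by (simp add: x_def)
    have xX: "x \<le> X"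
    proof -
      have "r * v + s * u \<le> G * v + G * u" using rs by (intro add_mono mult_mono) auto
      thus ?thesis unfolding x_def X_def by (simp only: of_nat_le_iff) (simp add: algebra_simps)
    qed
    have xK: "x ^ k \<le> X ^ K" if "k < K" for k
    proof -
      have "x ^ k \<le> X ^ k" using x0 xX by (intro power_mono) auto
      also have "\<dots> \<le> X ^ K" using X1 that by (intro power_increasing) auto
      finally show ?thesis .
    qed
    have clx: "c * real l * x \<le> 4 * real G * real L" if "l < L" for l
      using clX[OF that] mult_left_mono[OF xX, of "c * real l"] c0 by simp
    have W_eq: "(\<Sum>l<L. poly (Q l) x * y ^ l) = W"
    proof -
      have "W = (\<Sum>k<K. \<Sum>l<L. real_of_int (p (k, l)) * (x ^ k * y ^ l))"
        unfolding W_def J_def by (rule sum.cartesian_product[symmetric])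
      also have "\<dots> = (\<Sum>l<L. \<Sum>k<K. real_of_int (p (k, l)) * (x ^ k * y ^ l))" by (rule sum.swap)
      finally show ?thesis
        by (simp add: Q_def poly_sum poly_monom sum_distrib_right mult.assoc)
    qed
    have sum_bound: "\<bar>\<Sum>(k,l)\<in>J. real_of_int (p (k, l)) * (x ^ k * d k l)\<bar> \<le> real N * real H * X ^ K * E"
      if "\<And>k l. k < K \<Longrightarrow> l < L \<Longrightarrow> \<bar>d k l\<bar> \<le> E" for d E
    proof -
      have "\<bar>\<Sum>(k,l)\<in>J. real_of_int (p (k, l)) * (x ^ k * d k l)\<bar> \<le> (\<Sum>j\<in>J. real H * (X ^ K * E))"
      proof (rule order_trans[OF sum_abs sum_mono], clarify)
        fix k l assume kl: "(k, l) \<in> J"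
        hence "k < K" "l < L" by (auto simp: J_def)
        hence *: "x ^ k * \<bar>d k l\<bar> \<le> X ^ K * E" using that xK x0 X1 by (intro mult_mono) auto
        thus "\<bar>real_of_int (p (k, l)) * (x ^ k * d k l)\<bar> \<le> real H * (X ^ K * E)"
          using mult_mono[OF pH[OF kl] *] x0 by (simp add: abs_mult)
      qed
      thus ?thesis by (simp add: fJ mult_ac)
    qed
    let ?NHX = "real N * real H * X ^ K" and ?e16 = "exp (16 * real G * real L - (real T - real K))"
    have "\<bar>F - F0\<bar> \<le> ?NHX * ?e16"
    proof -
      have "F - F0 = (\<Sum>(k,l)\<in>J. real_of_int (p (k, l)) * (x ^ k * (exp (c * l * x) - (\<Sum>m<T-k. (c * l * x) ^ m / fact m))))"
        unfolding F_def F0_def by (simp add: sum_subtractf[symmetric] algebra_simps split_beta)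
      also have "\<bar>\<dots>\<bar> \<le> ?NHX * ?e16"
      proof (rule sum_bound)
        fix k l assume kl: "k < K" "l < L"
        have "\<bar>exp (c * l * x) - (\<Sum>m<T-k. (c * l * x) ^ m / fact m)\<bar> \<le> exp (4 * (c * l * x) - real (T - k))"
          using c0 x0 by (intro exp_Taylor_remainder) auto
        also have "\<dots> \<le> ?e16"
          using clx[OF kl(2)] kl(1) T(2) by (simp add: of_nat_diff)
        finally show "\<bar>exp (c * l * x) - (\<Sum>m<T-k. (c * l * x) ^ m / fact m)\<bar> \<le> ?e16" .
      qed
      finally show ?thesis .
    qed
    also have "\<dots> \<le> 1/4 * exp (real T - real K - 16 * real G * real L) * ?e16"
      using main_le by (intro mult_right_mono) auto
    also have "\<dots> = 1/4" by (simp add: exp_add[symmetric])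
    finally have b1: "\<bar>F - F0\<bar> \<le> 1/4" .
    have b2: "\<bar>F0\<bar> \<le> 1/4"
    proof -
      have summand: "x ^ k * (\<Sum>m<T-k. (c * l * x) ^ m / fact m) = (\<Sum>t<T. (x/X)^t * co t (k, l))"
        if kl: "k < K" for k l
      proof -
        have "(\<Sum>t<T. (x/X)^t * co t (k, l)) = (\<Sum>t\<in>{k..<T}. (x/X)^t * (X ^ k * ((c * l * X) ^ (t - k) / fact (t - k))))"
          by (intro sum.mono_neutral_cong_right) (auto simp: co_def)
        also have "\<dots> = (\<Sum>m<T-k. (x/X)^(m+k) * (X ^ k * ((c * l * X) ^ m / fact m)))"
          using kl T(2) by (intro sum.reindex_bij_witness[of _ "\<lambda>m. m + k" "\<lambda>t. t - k"]) auto
        also have "\<dots> = (\<Sum>m<T-k. x ^ k * ((c * l * x) ^ m / fact m))"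
          using X1 by (intro sum.cong) (auto simp: power_add power_mult_distrib power_divide)
        finally show ?thesis by (simp add: sum_distrib_left)
      qed
      have "F0 = (\<Sum>(k,l)\<in>J. real_of_int (p (k, l)) * (\<Sum>t<T. (x/X)^t * co t (k, l)))"
        unfolding F0_def by (intro sum.cong) (auto simp: J_def summand)
      also have "\<dots> = (\<Sum>j\<in>J. \<Sum>t<T. (x/X)^t * (co t j * real_of_int (p j)))"
        by (intro sum.cong) (auto simp: sum_distrib_left mult_ac)
      also have "\<dots> = (\<Sum>t<T. (x/X)^t * (\<Sum>j\<in>J. co t j * real_of_int (p j)))"
        by (subst sum.swap) (simp add: sum_distrib_left)
      also have "\<bar>\<dots>\<bar> \<le> (\<Sum>t<T. 1 / (4 * real T))"
      proof (rule order_trans[OF sum_abs sum_mono])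
        fix t assume t: "t \<in> {..<T}"
        have "\<bar>(x/X)^t\<bar> \<le> 1" using x0 xX X1 by (simp add: power_le_one)
        hence "\<bar>(x/X)^t\<bar> * \<bar>\<Sum>j\<in>J. co t j * real_of_int (p j)\<bar> \<le> 1 * (1 / (4 * real T))"
          using p(3)[of t] t by (intro mult_mono) auto
        thus "\<bar>(x/X)^t * (\<Sum>j\<in>J. co t j * real_of_int (p j))\<bar> \<le> 1 / (4 * real T)"
          by (simp add: abs_mult)
      qed
      also have "\<dots> = 1/4" using pos by simp
      finally show ?thesis .
    qed
    \<comment> \<open>Only here is the full smallness of \<open>\<Lambda>\<close> used: the factor
      \<open>exp (- N)\<close> beats coefficients and monomials together, which
      \<open>main_le\<close> keeps below \<open>exp T\<close>, because
      \<open>T \<le> N\<close>.\<close>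
    have "\<bar>W - F\<bar> \<le> ?NHX * (real L * real G * exp (- real N) * exp (4 * real G * real L))"
    proof -
      have "W - F = (\<Sum>(k,l)\<in>J. real_of_int (p (k, l)) * (x ^ k * (y ^ l - exp (c * l * x))))"
        unfolding W_def F_def by (simp add: sum_subtractf[symmetric] algebra_simps split_beta)
      also have "\<bar>\<dots>\<bar> \<le> ?NHX * (real L * real G * exp (- real N) * exp (4 * real G * real L))"
      proof (rule sum_bound)
        fix k l assume kl: "k < K" "l < L"
        define a where "a = real l * (real r * ln 2 + real s * ln 5)"
        have y: "y ^ l = exp a"
          by (simp add: y_def a_def exp_of_nat_mult exp_add)
        have ca: "c * l * x = a + real l * real s * \<Lambda> / real v"
        proof -
          have "c * l * x = real l * (real r * ln 2 + real s * (real u * ln 2) / real v)"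
            using uv(2) by (simp add: c_def x_def field_simps)
          also have "\<dots> = a + real l * real s * \<Lambda> / real v"
            unfolding uln using uv(2) by (simp add: a_def field_simps)
          finally show ?thesis .
        qed
        have "a \<le> real L * (real G * 1 + real G * 2)"
          unfolding a_def using kl rs ln2 ln5
          by (intro mult_mono add_mono add_nonneg_nonneg mult_nonneg_nonneg) auto
        also have "\<dots> \<le> 4 * real G * real L" by (simp add: mult_ac)
        finally have a4: "a \<le> 4 * real G * real L" .
        have "\<bar>exp a - exp (c * l * x)\<bar> \<le> \<bar>a - c * l * x\<bar> * exp (4 * real G * real L)"
          using a4 clx[OF kl(2)] by (intro abs_exp_diff_le) auto
        also have "\<bar>a - c * l * x\<bar> = real l * real s * \<bar>\<Lambda>\<bar> / real v"
          unfolding ca by (simp add: abs_mult)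
        also have "\<dots> \<le> real l * real s * \<bar>\<Lambda>\<bar> / 1"
          using uv(2) by (intro divide_left_mono) auto
        also have "\<dots> \<le> real L * real G * exp (- real N)"
          using kl rs small unfolding div_by_1 by (intro mult_mono) auto
        finally show "\<bar>y ^ l - exp (c * l * x)\<bar> \<le> real L * real G * exp (- real N) * exp (4 * real G * real L)"
          unfolding y by simp
      qed
      finally show ?thesis .
    qed
    also have "\<dots> \<le> 1/4 * exp (real T - real K - 16 * real G * real L) * (exp (real G * real L) * exp (- real N) * exp (4 * real G * real L))"
    proof (rule mult_mono[OF main_le])
      have "real L * real G \<le> exp (real G * real L)"
        using exp_ge_add_one_self[of "real G * real L"] by (subst mult.commute[of "real L"]) linarith
      thus "real L * real G * exp (- real N) * exp (4 * real G * real L)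
          \<le> exp (real G * real L) * exp (- real N) * exp (4 * real G * real L)"
        by (intro mult_right_mono) auto
    qed auto
    also have "\<dots> = 1/4 * (exp (real T - real K - 16 * (real G * real L)) * exp (real G * real L) * exp (- real N) * exp (4 * (real G * real L)))"
      by (simp add: mult_ac)
    also have "\<dots> = 1/4 * exp (real T - real K - 11 * (real G * real L) - real N)"
      unfolding exp_add[symmetric] by (simp add: algebra_simps)
    also have "\<dots> \<le> 1/4"
    proof -
      have "T \<le> N" using T(1) unfolding N_def by linarith
      hence "real T \<le> real N" by simp
      moreover have "0 \<le> real G * real L" by simp
      ultimately have "real T - real K - 11 * (real G * real L) - real N \<le> 0" by linarith
      thus ?thesis by simp
    qed
    finally have b3: "\<bar>W - F\<bar> \<le> 1/4" .
    have "\<bar>W\<bar> < 1" using b1 b2 b3 by linarith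
    moreover obtain Z where "W = real_of_int Z"
    proof
      show "W = real_of_int (\<Sum>(k,l)\<in>J. p (k, l) * (int (r * v + s * u) ^ k * (2 ^ r * 5 ^ s) ^ l))"
        unfolding W_def x_def y_def by (simp add: split_beta)
    qed
    ultimately have "W = 0" by simp
    thus ?thesis using W_eq unfolding x_def y_def by simp
  qed
  \<comment> \<open>All points with \<open>r < G\<close> and \<open>s < G\<close> are zeros;
    \<open>L\<close> of the values of \<open>r\<close> are given up for the shifts in the zero
    estimate.\<close>
  have "Q l = 0" if "l < L" for l
  proof (rule zero_estimate[of u v "G - L" L Q K G])
    show "(\<Sum>l<L. poly (Q l) (real (r * v + s * u)) * (2 ^ r * 5 ^ s) ^ l) = 0"
      if "r < G - L + L" "s < G" for r s using vanish that pos by simp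
  qed (use uv zero degQ that in auto)
  hence "p (k, l) = 0" if "k < K" "l < L" for k l using Qco[of l k] that by simp
  thus False using p(1) by (auto simp: J_def)
qed

text \<open>The parameters are \<open>L = 16 * M\<close>, \<open>G = 1300 * M\<close>,
  \<open>K = 80 * G\<close> and \<open>T = K * L / 2\<close>. They balance two demands: divided by
  \<open>G * M\<close>, the condition \<open>K * L < (G - L) * G\<close> reads
  \<open>1280 < 1284\<close>, while \<open>T = 832000 * M ^ 2\<close> must exceed
  \<open>416000 * M ^ 2 + 249600 * M ^ 2\<close> plus lower order terms.\<close>

lemma linear_form_lower_bound_aux:
  fixes M u v :: nat
  assumes M: "M \<ge> 100" and uv: "coprime u v" "v > 0" "u \<le> 2 ^ M" "v \<le> 2 ^ M" "u \<ge> 1300 * M"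
  shows "\<bar>real u * ln 2 - real v * ln 5\<bar> > exp (- 1664000 * real M ^ 2)"
proof -
  have m: "real M \<ge> 100" using M by simp
  hence m2: "real M * 100 \<le> real M * real M" by (intro mult_left_mono) auto
  have ln2: "ln 2 \<le> (7/10::real)" using ln2_le_25_over_36 by linarith
  have lnX: "ln (real (1300 * M * (u + v))) \<le> 12/10 * real M"
  proof -
    have "1300 * M * (u + v) \<le> 1300 * M * (2 ^ M + 2 ^ M)" using uv by (intro mult_left_mono) auto
    also have "\<dots> = 2600 * M * 2 ^ M" by simp
    finally have "real (1300 * M * (u + v)) \<le> real (2600 * M * 2 ^ M)" by (simp only: of_nat_le_iff)
    also have "\<dots> \<le> 2 ^ 18 * (real M / 100) * 2 ^ M" by simp
    finally have "ln (real (1300 * M * (u + v))) \<le> ln (2 ^ 18 * (real M / 100) * 2 ^ M)"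
      using uv M by (intro ln_mono) auto
    also have "\<dots> = 18 * ln 2 + ln (real M / 100) + real M * ln 2"
    proof -
      have "ln (a * b * c) = ln a + ln b + ln c" if "a > 0" "b > 0" "c > 0" for a b c :: real
        using that by (simp add: ln_mult)
      from this[of "2 ^ 18" "real M / 100" "2 ^ M"] show ?thesis
        using M ln_realpow[of 2 18] ln_realpow[of 2 M] by simp
    qed
    also have "\<dots> \<le> 18 * (7/10) + (real M / 100 - 1) + real M * (7/10)"
      using M ln2 ln_le_minus_one[of "real M / 100"] by (intro add_mono mult_left_mono) auto
    also have "\<dots> \<le> 12/10 * real M" using m by simp
    finally show ?thesis .
  qed
  \<comment> \<open>The crude \<open>ln x \<le> x\<close> for each factor is enough: for
    \<open>M >= 100\<close> the result is swallowed by the spare multiple of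
    \<open>M ^ 2\<close>.\<close>
  have lnN: "ln (40 * real (104000 * M * (16 * M)) ^ 2 * real (832000 * M ^ 2)) \<le> 40 + 3 * 1664000 + 6 * real M"
  proof -
    have "40 * real (104000 * M * (16 * M)) ^ 2 * real (832000 * M ^ 2) = 20 * 1664000 ^ 3 * real M ^ 6"
      by (simp add: power_mult_distrib power2_eq_square power_numeral_reduce)
    also have "ln \<dots> = ln 20 + 3 * ln 1664000 + 6 * ln (real M)"
      using M by (simp add: ln_mult ln_realpow del: power_numeral)
    also have "\<dots> \<le> 40 + 3 * 1664000 + 6 * real M"
      using M ln_bound[of 20] ln_bound[of 1664000] ln_bound[of "real M"] by linarith
    finally show ?thesis .
  qed
  have "\<bar>real u * ln 2 - real v * ln 5\<bar> > exp (- real (104000 * M * (16 * M)))"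
  proof (rule interpolation_contradiction[where G = "1300 * M" and T = "832000 * M ^ 2"])
    have "2 * real (104000 * M) * ln (real (1300 * M * (u + v))) \<le> 2 * real (104000 * M) * (12/10 * real M)"
      using lnX by (intro mult_left_mono) auto
    also have "\<dots> = 249600 * (real M * real M)" by simp
    moreover have "20 * real (1300 * M) * real (16 * M) = 416000 * (real M * real M)"
      "real (832000 * M\<^sup>2) = 832000 * (real M * real M)" "real (104000 * M) = 104000 * real M"
      by (simp_all add: power2_eq_square)
    ultimately show "20 * real (1300 * M) * real (16 * M) + 2 * real (104000 * M) * ln (real (1300 * M * (u + v)))
        + ln (40 * (real (104000 * M * (16 * M)))\<^sup>2 * real (832000 * M\<^sup>2)) \<le> real (832000 * M\<^sup>2) - real (104000 * M)"
      using lnN m m2 by linarith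
    show "104000 * M \<le> 832000 * M\<^sup>2" using M by (simp add: power2_eq_square)
    show "104000 * M * (16 * M) < (1300 * M - 16 * M) * (1300 * M)" using M by simp
  qed (use uv M in \<open>auto simp: power2_eq_square\<close>)
  thus ?thesis by (simp add: power2_eq_square)
qed

section \<open>Lower bound for arbitrary exponents\<close>

lemma ln_diff_ge_inverse:
  fixes a b :: nat
  assumes "a > b" "b > 0"
  shows "ln (real a) - ln (real b) \<ge> 1 / real a"
proof -
  have "ln (real b / real a) \<le> real b / real a - 1" using assms by (intro ln_le_minus_one) auto
  moreover have "ln (real b / real a) = ln (real b) - ln (real a)" using assms by (simp add: ln_div)
  moreover have "1 / real a \<le> 1 - real b / real a" using assms by (simp add: field_simps)
  ultimately show ?thesis by linarith
qed

text \<open>For \<open>u >= 1\<close> the integer \<open>2 ^ u\<close> is even and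
  \<open>5 ^ v\<close> is odd, so they differ by at least 1. This covers the finitely many
  \<open>u\<close> that are too small for the interpolation argument.\<close>

lemma linear_form_ge_trivial:
  fixes u v :: nat
  assumes "u \<ge> 1"
  shows "\<bar>real u * ln 2 - real v * ln 5\<bar> \<ge> 1 / (2 ^ u * 5 ^ v)"
proof -
  define a b :: nat where "a = 2 ^ u" and "b = 5 ^ v"
  have pos: "a > 0" "b > 0" by (auto simp: a_def b_def)
  have "even a" "odd b" using assms by (auto simp: a_def b_def)
  hence ne: "a \<noteq> b" by auto
  have "ln (real a) = real u * ln 2" "ln (real b) = real v * ln 5"
    by (simp_all add: a_def b_def ln_realpow)
  moreover have "\<bar>ln (real a) - ln (real b)\<bar> \<ge> 1 / real (a * b)"
  proof (cases "a > b")
    case True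
    have "1 / real (a * b) \<le> 1 / real a" using pos by (intro divide_left_mono) auto
    thus ?thesis using ln_diff_ge_inverse[OF True pos(2)] by linarith
  next
    case False
    hence "b > a" using ne by simp
    moreover have "1 / real (a * b) \<le> 1 / real b" using pos by (intro divide_left_mono) auto
    ultimately show ?thesis using ln_diff_ge_inverse[of a b] pos(1) by linarith
  qed
  ultimately show ?thesis by (simp add: a_def b_def)
qed

text \<open>A common factor multiplies the form by \<open>g >= 1\<close>, so coprime exponents
  suffice. For them \<open>exp (- 1664000 * M ^ 2)\<close> is available with \<open>M\<close>
  between \<open>2 * ln (u + 1)\<close> and \<open>4 * ln (u + 1)\<close>; the 16 in
  \<open>C\<close> is the square of this 4, and \<open>c\<close> absorbs the small
  \<open>u\<close>.\<close>

theorem linear_form_lower_bound: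
  "\<exists>c>0. \<exists>C>0. \<forall>u v. u \<ge> 1 \<longrightarrow> \<bar>real u * ln 2 - real v * ln 5\<bar> \<ge> c * exp (- C * ln (real u + 1) ^ 2)"
proof -
  have "eventually (\<lambda>u::nat. real u \<ge> 1300 * (4 * ln (real u + 1)) \<and> 2 * ln (real u + 1) \<ge> 100) at_top"
    by (intro eventually_conj; real_asymp)
  then obtain U where U: "\<And>u. u \<ge> U \<Longrightarrow> real u \<ge> 1300 * (4 * ln (real u + 1)) \<and> 2 * ln (real u + 1) \<ge> 100"
    by (auto simp: eventually_at_top_linorder)
  define c where "c = 1 / (2 * (2 ^ U * 5 ^ (U + 1)) :: real)"
  define C where "C = (1664000 * 16 :: real)"
  have c: "0 < c" "c \<le> 1/2"
  proof -
    have "1 \<le> (2 ^ U * 5 ^ (U + 1) :: real)" by (intro mult_ge1_I one_le_power) auto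
    thus "0 < c" "c \<le> 1/2" unfolding c_def by (auto simp: field_simps)
  qed
  have ln2: "1/2 \<le> ln (2::real)" using ln2_ge_two_thirds by linarith
  have ln2': "ln 2 \<le> (1::real)" using ln2_le_25_over_36 by linarith
  have ln5: "1 \<le> ln (5::real)"
    using exp_le by (subst ln_ge_iff) auto
  have main: "\<bar>real u * ln 2 - real v * ln 5\<bar> \<ge> c * exp (- C * ln (real u + 1) ^ 2)"
    if "u \<ge> 1" "v > 0" "coprime u v" for u v
  proof -
    define \<Lambda> where "\<Lambda> = real u * ln 2 - real v * ln 5"
    have e1: "c * exp (- C * ln (real u + 1) ^ 2) \<le> c * 1"
      using c by (intro mult_left_mono) (auto simp: C_def)
    show ?thesis
    proof (cases "\<bar>\<Lambda>\<bar> \<ge> 1")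
      case True
      thus ?thesis using e1 c unfolding \<Lambda>_def by linarith
    next
      case False
      \<comment> \<open>Unless the form is at least 1, \<open>v\<close> is controlled by
        \<open>u\<close>; so a bound in terms of \<open>u\<close> alone is possible.\<close>
      have vu: "v \<le> u + 1"
      proof -
        have "real v * 1 \<le> real v * ln 5" using ln5 by (intro mult_left_mono) auto
        also have "\<dots> < real u * ln 2 + 1" using False unfolding \<Lambda>_def by linarith
        also have "\<dots> \<le> real u * 1 + 1" using ln2' by (intro add_mono mult_left_mono) auto
        finally show ?thesis by linarith
      qed
      show ?thesis
      proof (cases "u < U")
        case True
        have "c \<le> 1 / (2 ^ U * 5 ^ (U + 1))" by (simp add: c_def field_simps)
        also have "(2::real) ^ u * 5 ^ v \<le> 2 ^ U * 5 ^ (U + 1)"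
          using True vu by (intro mult_mono power_increasing) auto
        hence "1 / (2 ^ U * 5 ^ (U + 1)) \<le> 1 / ((2::real) ^ u * 5 ^ v)"
          by (intro divide_left_mono) auto
        also have "\<dots> \<le> \<bar>\<Lambda>\<bar>" unfolding \<Lambda>_def by (rule linear_form_ge_trivial[OF that(1)])
        finally show ?thesis using e1 unfolding \<Lambda>_def by linarith
      next
        case False
        define M where "M = nat \<lceil>2 * ln (real u + 1)\<rceil>"
        have l: "ln (real u + 1) \<ge> 1/2"

        proof -
          have "ln 2 \<le> ln (real u + 1)" using that(1) by (intro ln_mono) auto
          thus ?thesis using ln2 by linarith
        qed
        have M1: "2 * ln (real u + 1) \<le> real M" "real M \<le> 4 * ln (real u + 1)"
          using l unfolding M_def by linarith+
        have "u + 1 \<le> 2 ^ M"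
        proof -
          have "real u + 1 = exp (ln (real u + 1))" by simp
          also have "\<dots> \<le> exp (real M * ln 2)"
          proof (subst exp_le_cancel_iff)
            have "ln (real u + 1) \<le> real M * (1/2)" using M1 by simp
            also have "\<dots> \<le> real M * ln 2" using ln2 by (intro mult_left_mono) auto
            finally show "ln (real u + 1) \<le> real M * ln 2" .
          qed
          also have "\<dots> = 2 ^ M" by (simp add: exp_of_nat_mult)
          finally have "real (u + 1) \<le> real (2 ^ M)" by simp
          thus ?thesis by (simp only: of_nat_le_iff)
        qed
        hence "\<bar>\<Lambda>\<bar> > exp (- 1664000 * real M ^ 2)"
          unfolding \<Lambda>_def using U[of u] False M1 that vu
          by (intro linear_form_lower_bound_aux) auto
        moreover have "real M ^ 2 \<le> (4 * ln (real u + 1)) ^ 2" using M1 by (intro power_mono) auto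
        hence "- C * ln (real u + 1) ^ 2 \<le> - 1664000 * real M ^ 2"
          by (simp add: C_def power_mult_distrib)
        hence "exp (- C * ln (real u + 1) ^ 2) \<le> exp (- 1664000 * real M ^ 2)" by simp
        moreover have "c * exp (- C * ln (real u + 1) ^ 2) \<le> 1 * exp (- C * ln (real u + 1) ^ 2)"
          using c by (intro mult_right_mono) auto
        ultimately show ?thesis unfolding \<Lambda>_def by linarith
      qed
    qed
  qed
  have "\<bar>real u * ln 2 - real v * ln 5\<bar> \<ge> c * exp (- C * ln (real u + 1) ^ 2)" if u: "u \<ge> 1" for u v
  proof (cases "v = 0")
    case True
    have "c * exp (- C * ln (real u + 1) ^ 2) \<le> 1/2 * 1"
      using c by (intro mult_mono) (auto simp: C_def)
    also have "\<dots> \<le> real u * ln 2" using ln2 u mult_mono[of 1 "real u" "1/2" "ln 2"] by simp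
    finally show ?thesis using True by simp
  next
    case False
    define g where "g = gcd u v"
    obtain u' v' where uv: "u = u' * g" "v = v' * g" "coprime u' v'"
      using gcd_coprime_exists[of u v] False unfolding g_def by auto
    have g: "g \<ge> 1" using False by (simp add: g_def Suc_leI)
    have u': "u' \<ge> 1" "v' > 0" using uv u False by (auto intro: Suc_leI)
    have "u' \<le> u" using uv g by simp
    hence "ln (real u' + 1) \<le> ln (real u + 1)" by (intro ln_mono) auto
    hence "ln (real u' + 1) ^ 2 \<le> ln (real u + 1) ^ 2" by (intro power_mono) auto
    hence "c * exp (- C * ln (real u + 1) ^ 2) \<le> c * exp (- C * ln (real u' + 1) ^ 2)"
      using c by (intro mult_left_mono) (auto simp: C_def)
    also have "\<dots> \<le> 1 * \<bar>real u' * ln 2 - real v' * ln 5\<bar>" using main[OF u' uv(3)] by simp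
    also have "\<dots> \<le> real g * \<bar>real u' * ln 2 - real v' * ln 5\<bar>" using g by (intro mult_right_mono) auto
    also have "\<dots> = \<bar>real g * (real u' * ln 2 - real v' * ln 5)\<bar>" by (simp add: abs_mult)
    also have "real g * (real u' * ln 2 - real v' * ln 5) = real u * ln 2 - real v * ln 5"
      unfolding uv(1,2) by (simp add: algebra_simps)
    finally show ?thesis .
  qed
  moreover have "C > 0" by (simp add: C_def)
  ultimately show ?thesis using c by blast
qed

section \<open>Exponential sums over intervals\<close>

definition nint_dist :: "real \<Rightarrow> real" where
  "nint_dist t = \<bar>t - of_int (round t)\<bar>"

text \<open>
  Equal to \<open>min Z (1 / nint_dist t)\<close> up to a factor 2, but without a division by zero at integers.
\<close>

definition osc_bound :: "real \<Rightarrow> real \<Rightarrow> real" where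
  "osc_bound Z t = 2 * Z / (1 + Z * nint_dist t)"

lemma nint_dist_nonneg [simp]: "nint_dist t \<ge> 0"
  by (simp add: nint_dist_def)

lemma nint_dist_le_half: "nint_dist t \<le> 1/2"
  unfolding nint_dist_def using of_int_round_abs_le[of t] by (simp add: abs_minus_commute)

lemma nint_dist_minus: "nint_dist (-t) = nint_dist t"
proof -
  have *: "nint_dist s \<le> nint_dist (-s)" for s
    unfolding nint_dist_def using round_diff_minimal[of s "- round (- s)"] by simp
  show ?thesis using *[of t] *[of "-t"] by simp
qed

lemma osc_bound_nonneg: "Z \<ge> 0 \<Longrightarrow> osc_bound Z t \<ge> 0"
  by (simp add: osc_bound_def)

lemma osc_bound_mult_le:
  assumes "Z \<ge> 0"
  shows "osc_bound Z t * nint_dist t \<le> 2"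
proof -
  have "0 \<le> Z * nint_dist t" using assms by simp
  thus ?thesis by (simp add: osc_bound_def field_simps)
qed

lemma osc_bound_mono:
  assumes "0 \<le> Y" "Y \<le> Z"
  shows "osc_bound Y t \<le> osc_bound Z t"
proof -
  have "0 \<le> Y * nint_dist t" "0 \<le> Z * nint_dist t" using assms by auto
  thus ?thesis using assms by (simp add: osc_bound_def field_simps add_pos_nonneg divide_le_eq)
qed

lemma le_osc_bound:
  assumes "x \<le> Z" "x * nint_dist t \<le> 1" "Z \<ge> 0"
  shows "x \<le> osc_bound Z t"
proof -
  have "x * (1 + Z * nint_dist t) = x + Z * (x * nint_dist t)" by (simp add: algebra_simps)
  also have "\<dots> \<le> Z + Z * 1" using assms by (intro add_mono mult_left_mono) auto
  finally show ?thesis using assms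
    by (simp add: osc_bound_def pos_le_divide_eq add_pos_nonneg)
qed

text \<open>The left side is \<open>2 * \<bar>sin (pi * x)\<bar>\<close>, where \<open>x\<close> is
  \<open>t\<close> minus its nearest integer, and \<open>sin z >= z - z ^ 3 / 6\<close> gives
  \<open>\<bar>sin (pi * x)\<bar> >= \<bar>x\<bar>\<close>, half of Jordan's inequality.\<close>

lemma norm_one_minus_cis: "norm (1 - cis (2 * pi * t)) \<ge> 2 * nint_dist t"
proof -
  define x where "x = t - of_int (round t)"
  have x: "\<bar>x\<bar> \<le> 1/2" "\<bar>x\<bar> = nint_dist t"
    using nint_dist_le_half[of t] by (auto simp: x_def nint_dist_def)
  have "cis (2 * pi * t) = cis (2 * pi * x) * cis (2 * pi * of_int (round t))"
    by (simp add: x_def cis_mult algebra_simps)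
  also have "cis (2 * pi * of_int (round t)) = 1"
    by (rule cis_multiple_2pi) auto
  finally have c: "cis (2 * pi * t) = cis (2 * pi * x)" by simp
  have "norm (1 - cis (2 * pi * x)) ^ 2 = (1 - cos (2 * pi * x))^2 + sin (2 * pi * x) ^ 2"
    by (simp add: cmod_power2)
  also have "\<dots> = 2 - 2 * cos (2 * pi * x)"
    using sin_cos_squared_add[of "2 * pi * x"] by (simp add: power2_eq_square algebra_simps)
  also have "\<dots> = (2 * sin (pi * x)) ^ 2"
    using cos_double_sin[of "pi * x"] by (simp add: power2_eq_square algebra_simps)
  finally have "norm (1 - cis (2 * pi * x)) = 2 * \<bar>sin (pi * x)\<bar>"
    by (metis abs_mult abs_norm_cancel abs_numeral power2_eq_iff_nonneg real_sqrt_abs)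
  moreover have "\<bar>sin (pi * x)\<bar> \<ge> \<bar>x\<bar>"
  proof -
    have *: "sin (pi * y) \<ge> y" if "0 \<le> y" "y \<le> 1/2" for y
    proof -
      have p: "3 \<le> pi" "pi < 22/7" using pi_approx pi_gt3 by auto
      have "pi * y \<le> 22/7 * (1/2)" using that p by (intro mult_mono) auto
      hence py: "0 \<le> pi * y" "pi * y \<le> 11/7" using that by auto
      have "(pi * y)^2 \<le> (11/7)^2" using py by (intro power_mono) auto
      hence "pi * y * (pi * y)^2 \<le> pi * y * (11/7)^2" using py by (intro mult_left_mono) auto
      hence cube: "(pi * y)^3 \<le> pi * y * (121/49)" by (simp add: power3_eq_cube power2_eq_square mult_ac)
      have "\<bar>sin (pi * y) - (\<Sum>m<3. sin_coeff m * (pi * y) ^ m)\<bar> \<le> inverse (fact 3) * \<bar>pi * y\<bar> ^ 3"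
        by (rule Maclaurin_sin_bound)
      moreover have "(\<Sum>m<3. sin_coeff m * (pi * y) ^ m) = pi * y"
        by (simp add: sin_coeff_def eval_nat_numeral)
      moreover have "inverse (fact 3) * \<bar>pi * y\<bar> ^ 3 = (pi * y) ^ 3 / 6"
        using py by (simp add: fact_numeral)
      ultimately have "sin (pi * y) \<ge> pi * y - (pi * y)^3 / 6" by linarith
      also have "pi * y - (pi * y)^3 / 6 \<ge> (pi * y) * (1/2)" using cube py by linarith
      also have "(pi * y) * (1/2) \<ge> (3 * y) * (1/2)" using p that by (intro mult_right_mono) auto
      ultimately show ?thesis using that by linarith
    qed
    show ?thesis using *[of x] *[of "-x"] x(1) by (cases "x \<ge> 0") auto
  qed
  ultimately show ?thesis using c x(2) by simp
qed

lemma norm_exponential_sum_le: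
  fixes A B :: nat
  assumes "real B - real A \<le> Z" "Z \<ge> 0"
  shows "norm (\<Sum>m\<in>{A<..B}. cis (2 * pi * (real m * t))) \<le> osc_bound Z t"
proof (rule le_osc_bound)
  define S where "S = (\<Sum>m\<in>{A<..B}. cis (2 * pi * (real m * t)))"
  define z where "z = cis (2 * pi * t)"
  have S: "S = (\<Sum>m\<in>{A<..B}. z ^ m)"
  proof -
    have "cis (2 * pi * (real m * t)) = z ^ m" for m
      unfolding z_def Complex.DeMoivre by (simp only: mult_ac)
    thus ?thesis by (simp add: S_def)
  qed
  have "norm S \<le> (\<Sum>m\<in>{A<..B}. 1)" unfolding S_def
    by (intro order_trans[OF norm_sum sum_mono]) auto
  also have "\<dots> \<le> Z" using assms by (cases "A \<le> B") (auto simp: of_nat_diff)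
  finally show "norm S \<le> Z" .
  have "norm ((1 - z) * S) \<le> 2"
  proof (cases "A < B")
    case True
    have "(1 - z) * S = (1 - z) * (\<Sum>m=Suc A..B. z ^ m)"
      unfolding S by (simp add: atLeastSucAtMost_greaterThanAtMost)
    also have "\<dots> = z ^ Suc A - z ^ Suc B" using True by (intro sum_gp_multiplied) auto
    also have "norm \<dots> \<le> norm (z ^ Suc A) + norm (z ^ Suc B)" by (rule norm_triangle_ineq4)
    also have "\<dots> = 2" by (simp add: z_def norm_power norm_mult)
    finally show ?thesis .
  qed (simp add: S)
  moreover have "2 * nint_dist t * norm S \<le> norm (1 - z) * norm S"
    unfolding z_def by (intro mult_right_mono norm_one_minus_cis) auto
  ultimately show "norm S * nint_dist t \<le> 1" by (simp add: norm_mult mult_ac)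
qed (use assms in auto)

section \<open>Summation by parts and elementary sums\<close>

lemma sum_by_parts:
  fixes a :: "nat \<Rightarrow> 'a :: real_normed_vector" and w :: "nat \<Rightarrow> real"
  shows "(\<Sum>m=1..Suc n. w m *\<^sub>R a m) =
    w (Suc n) *\<^sub>R (\<Sum>m=1..Suc n. a m) - (\<Sum>m=1..n. (w (Suc m) - w m) *\<^sub>R (\<Sum>k=1..m. a k))"
  by (induction n) (simp_all add: algebra_simps)

text \<open>For monotone weights the total variation telescopes, and together with the last weight
  it is at most \<open>2 * W\<close>.\<close>

lemma norm_weighted_sum_le:
  fixes a :: "nat \<Rightarrow> 'a :: real_normed_vector" and w :: "nat \<Rightarrow> real"
  assumes G: "\<And>j. j \<le> n \<Longrightarrow> norm (\<Sum>m=1..j. a m) \<le> G"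
    and w: "\<And>m. 1 \<le> m \<Longrightarrow> m \<le> n \<Longrightarrow> 0 \<le> w m \<and> w m \<le> W"
    and mono: "(\<forall>m\<ge>1. Suc m \<le> n \<longrightarrow> w m \<le> w (Suc m)) \<or> (\<forall>m\<ge>1. Suc m \<le> n \<longrightarrow> w (Suc m) \<le> w m)"
    and "W \<ge> 0"
  shows "norm (\<Sum>m=1..n. w m *\<^sub>R a m) \<le> 2 * W * G"
proof (cases n)
  case 0
  thus ?thesis using assms(4) G[of 0] by simp
next
  case (Suc k)
  have G0: "G \<ge> 0" using G[of 0] by simp
  have tele: "(\<Sum>m=1..k. w (Suc m) - w m) = w (Suc k) - w 1"
    by (induction k) auto
  have "norm (\<Sum>m=1..n. w m *\<^sub>R a m) \<le> norm (w n *\<^sub>R (\<Sum>m=1..n. a m)) + norm (\<Sum>m=1..k. (w (Suc m) - w m) *\<^sub>R (\<Sum>j=1..m. a j))"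
    unfolding Suc sum_by_parts by (rule norm_triangle_ineq4)
  also have "\<dots> \<le> \<bar>w n\<bar> * G + (\<Sum>m=1..k. \<bar>w (Suc m) - w m\<bar> * G)"
  proof (intro add_mono order_trans[OF norm_sum sum_mono])
    show "norm (w n *\<^sub>R (\<Sum>m=1..n. a m)) \<le> \<bar>w n\<bar> * G"
      unfolding norm_scaleR by (intro mult_left_mono G) auto
    show "norm ((w (Suc m) - w m) *\<^sub>R (\<Sum>j=1..m. a j)) \<le> \<bar>w (Suc m) - w m\<bar> * G" if "m \<in> {1..k}" for m
      unfolding norm_scaleR using that Suc by (intro mult_left_mono G) auto
  qed
  also have "\<dots> = (\<bar>w n\<bar> + (\<Sum>m=1..k. \<bar>w (Suc m) - w m\<bar>)) * G"
    by (simp only: sum_distrib_right distrib_right)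
  also have "\<dots> \<le> (2 * W) * G"
  proof (rule mult_right_mono)
    from mono have "(\<Sum>m=1..k. \<bar>w (Suc m) - w m\<bar>) = \<bar>w (Suc k) - w 1\<bar>"
    proof
      assume *: "\<forall>m\<ge>1. Suc m \<le> n \<longrightarrow> w m \<le> w (Suc m)"
      hence "(\<Sum>m=1..k. \<bar>w (Suc m) - w m\<bar>) = (\<Sum>m=1..k. w (Suc m) - w m)"
        using Suc by (intro sum.cong) auto
      moreover have "0 \<le> (\<Sum>m=1..k. w (Suc m) - w m)" using * Suc by (intro sum_nonneg) auto
      ultimately show ?thesis unfolding tele by simp
    next
      assume *: "\<forall>m\<ge>1. Suc m \<le> n \<longrightarrow> w (Suc m) \<le> w m"
      hence "(\<Sum>m=1..k. \<bar>w (Suc m) - w m\<bar>) = (\<Sum>m=1..k. - (w (Suc m) - w m))"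
        using Suc by (intro sum.cong) auto
      also have "\<dots> = - (w (Suc k) - w 1)" unfolding sum_negf tele ..
      moreover have "(\<Sum>m=1..k. w (Suc m) - w m) \<le> 0" using * Suc by (intro sum_nonpos) auto
      ultimately show ?thesis unfolding tele by simp
    qed
    thus "\<bar>w n\<bar> + (\<Sum>m=1..k. \<bar>w (Suc m) - w m\<bar>) \<le> 2 * W"
      using w[of "Suc k"] w[of 1] Suc by (simp add: abs_if)
  qed (rule G0)
  finally show ?thesis by simp
qed

lemma sum_inverse_le: "(\<Sum>k=1..n. 1 / real k) \<le> 1 + ln (real (max 1 n))"
proof (induction n)
  case (Suc n)
  show ?case
  proof (cases "n = 0")
    case False
    have "ln (real n / real (Suc n)) \<le> real n / real (Suc n) - 1"
      using False by (intro ln_le_minus_one) auto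
    moreover have "ln (real n / real (Suc n)) = ln (real n) - ln (real (Suc n))"
      using False by (simp add: ln_div)
    moreover have "real n / real (Suc n) - 1 = - (1 / real (Suc n))" by (simp add: field_simps)
    ultimately have "1 / real (Suc n) \<le> ln (real (Suc n)) - ln (real n)" by linarith
    moreover have "max 1 n = n" "max 1 (Suc n) = Suc n" using False by auto
    ultimately show ?thesis using Suc by simp
  qed simp
qed simp

lemma sum_inverse_square_le:
  assumes "V > 0"
  shows "(\<Sum>n\<in>{V<..E}. 1 / real n ^ 2) \<le> 1 / real V"
proof (cases "V \<le> E")
  case True
  have "(\<Sum>n\<in>{V<..E}. 1 / real n ^ 2) \<le> 1 / real V - 1 / real E" if "V \<le> E"
    using that
  proof (induction E rule: dec_induct)
    case (step E)
    have E: "E > 0" using step assms by simp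
    have "{V<..Suc E} = insert (Suc E) {V<..E}" using step by auto
    hence "(\<Sum>n\<in>{V<..Suc E}. 1 / real n ^ 2) = 1 / real (Suc E) ^ 2 + (\<Sum>n\<in>{V<..E}. 1 / real n ^ 2)" by simp
    moreover have "1 / real (Suc E) ^ 2 \<le> 1 / real E - 1 / real (Suc E)"
    proof -
      have "1 / real (Suc E) ^ 2 \<le> 1 / (real E * real (Suc E))"
        using E by (intro divide_left_mono) (auto simp: power2_eq_square)
      also have "\<dots> = 1 / real E - 1 / real (Suc E)" using E by (simp add: field_simps)
      finally show ?thesis .
    qed
    ultimately show ?case using step.IH by linarith
  qed simp
  thus ?thesis using True by (smt (verit) divide_nonneg_nonneg of_nat_0_le_iff)
qed (use assms in simp)

text \<open>Each half-open interval from \<open>i / (2 * q)\<close> to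
  \<open>(i + 1) / (2 * q)\<close> contains at most one \<open>\<sigma> d\<close>. The term for
  \<open>i = 0\<close> is at most \<open>2 * Z\<close>, the one for \<open>i >= 1\<close> at most
  \<open>4 * q / i\<close>, and these add up to a logarithm.\<close>

lemma sum_spaced_le:
  fixes \<sigma> :: "'a \<Rightarrow> real" and q :: nat
  assumes I: "finite I" and q: "q > 0" and Z: "Z \<ge> 0"
    and \<sigma>: "\<And>d. d \<in> I \<Longrightarrow> 0 \<le> \<sigma> d \<and> \<sigma> d \<le> 1/2"
    and sep: "\<And>d e. d \<in> I \<Longrightarrow> e \<in> I \<Longrightarrow> d \<noteq> e \<Longrightarrow> \<bar>\<sigma> d - \<sigma> e\<bar> \<ge> 1 / (2 * real q)"
  shows "(\<Sum>d\<in>I. 2 * Z / (1 + Z * \<sigma> d)) \<le> 2 * Z + 4 * real q * (1 + ln (real q))"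
proof -
  define j where "j d = nat \<lfloor>2 * real q * \<sigma> d\<rfloor>" for d
  define f where "f i = (if i = 0 then 2 * Z else 4 * real q * (1 / real i))" for i :: nat
  have inj: "inj_on j I"
  proof (rule inj_onI, rule ccontr)
    fix d e assume de: "d \<in> I" "e \<in> I" "j d = j e" "d \<noteq> e"
    have nn: "0 \<le> 2 * real q * \<sigma> d" "0 \<le> 2 * real q * \<sigma> e" using \<sigma> de by auto
    hence "\<lfloor>2 * real q * \<sigma> d\<rfloor> = \<lfloor>2 * real q * \<sigma> e\<rfloor>" using de(3) by (simp add: j_def eq_nat_nat_iff)
    hence "\<bar>2 * real q * \<sigma> d - 2 * real q * \<sigma> e\<bar> < 1" by linarith
    moreover have "1 \<le> 2 * real q * \<bar>\<sigma> d - \<sigma> e\<bar>" using sep[OF de(1,2,4)] q by (simp add: field_simps)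
    moreover have "2 * real q * \<bar>\<sigma> d - \<sigma> e\<bar> = \<bar>2 * real q * \<sigma> d - 2 * real q * \<sigma> e\<bar>"
      by (simp add: abs_mult right_diff_distrib[symmetric])
    ultimately show False by linarith
  qed
  have jq: "j d \<le> q" if "d \<in> I" for d
  proof -
    have "2 * real q * \<sigma> d \<le> 2 * real q * (1/2)" using \<sigma>[OF that] by (intro mult_left_mono) auto
    thus ?thesis unfolding j_def by (simp add: nat_le_iff floor_le_iff)
  qed
  have "(\<Sum>d\<in>I. 2 * Z / (1 + Z * \<sigma> d)) \<le> (\<Sum>d\<in>I. f (j d))"
  proof (rule sum_mono)
    fix d assume d: "d \<in> I"
    have Zs: "0 \<le> Z * \<sigma> d" using Z \<sigma>[OF d] by simp
    show "2 * Z / (1 + Z * \<sigma> d) \<le> f (j d)"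
    proof (cases "j d = 0")
      case True
      have "2 * Z / (1 + Z * \<sigma> d) \<le> 2 * Z / 1" using Z Zs by (intro divide_left_mono) auto
      thus ?thesis using True by (simp add: f_def)
    next
      case False
      have "0 \<le> 2 * real q * \<sigma> d" using \<sigma>[OF d] by simp
      hence "real (j d) \<le> 2 * real q * \<sigma> d" unfolding j_def by linarith
      hence "real (j d) * Z \<le> 2 * real q * \<sigma> d * Z" using Z by (intro mult_right_mono) auto
      hence "2 * Z * real (j d) \<le> 4 * real q * (1 + Z * \<sigma> d)" using q by (simp add: algebra_simps)
      thus ?thesis using False Zs by (simp add: f_def pos_divide_le_eq pos_le_divide_eq add_pos_nonneg)
    qed
  qed
  also have "\<dots> = (\<Sum>i\<in>j ` I. f i)" using inj by (simp add: sum.reindex)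
  also have "\<dots> \<le> (\<Sum>i\<in>{0..q}. f i)"
    using jq Z by (intro sum_mono2) (auto simp: f_def)
  also have "\<dots> = 2 * Z + 4 * real q * (\<Sum>i=1..q. 1 / real i)"
    by (subst sum.atLeast_Suc_atMost) (auto simp: f_def sum_distrib_left)
  also have "\<dots> \<le> 2 * Z + 4 * real q * (1 + ln (real q))"
    using sum_inverse_le[of q] q by (intro add_left_mono mult_left_mono) (auto simp: max_def split: if_splits)
  finally show ?thesis .
qed

section \<open>Multiples of a number close to a fraction\<close>

locale rational_approx =
  fixes \<alpha> :: real and a :: int and q :: nat
  assumes q: "q > 0" and coprime: "coprime a (int q)"
    and approx: "\<bar>\<alpha> - of_int a / real q\<bar> \<le> 1 / real q ^ 2"
begin

text \<open>The sign is kept because the mere distances to the nearest integer are not spaced: two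
  multiples on opposite sides of integers may have almost the same distance.\<close>

definition signed_frac :: "nat \<Rightarrow> real" where
  "signed_frac d = real d * \<alpha> - of_int (round (real d * \<alpha>))"

lemma abs_signed_frac: "\<bar>signed_frac d\<bar> = nint_dist (real d * \<alpha>)"
  by (simp add: signed_frac_def nint_dist_def)

text \<open>For \<open>m = d - e\<close> the number \<open>m * \<alpha>\<close> is within
  \<open>1 / (2 * q)\<close> of \<open>m * a / q\<close>. Since \<open>0 < \<bar>m\<bar> < q\<close>
  and \<open>a\<close> is coprime to \<open>q\<close>, the latter is at least \<open>1 / q\<close>
  away from every integer.\<close>

lemma signed_frac_spaced:
  assumes "d \<noteq> e" "2 * \<bar>int d - int e\<bar> \<le> int q"
  shows "\<bar>signed_frac d - signed_frac e\<bar> \<ge> 1 / (2 * real q)"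
proof -
  define m where "m = int d - int e"
  define k where "k = round (real d * \<alpha>) - round (real e * \<alpha>)"
  define \<delta> where "\<delta> = \<alpha> - of_int a / real q"
  have m: "m \<noteq> 0" "2 * \<bar>m\<bar> \<le> int q" using assms by (auto simp: m_def)
  have "m * a - k * int q \<noteq> 0"
  proof
    assume "m * a - k * int q = 0"
    hence "int q dvd m * a" by (metis diff_eq_diff_eq diff_self dvd_triv_right eq_iff_diff_eq_0)
    hence "int q dvd m" using coprime by (simp add: coprime_commute coprime_dvd_mult_left_iff)
    hence "int q \<le> \<bar>m\<bar>" using m(1) by (meson dvd_abs_iff zdvd_imp_le zero_less_abs_iff)
    thus False using m q by auto
  qed
  hence "1 \<le> \<bar>m * a - k * int q\<bar>" by linarith
  hence "1 \<le> \<bar>real_of_int (m * a - k * int q)\<bar>" by linarith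
  hence "1 / real q \<le> \<bar>real_of_int (m * a - k * int q)\<bar> / real q" by (intro divide_right_mono) auto
  also have "\<dots> = \<bar>real_of_int (m * a - k * int q) / real q\<bar>" by simp
  also have "real_of_int (m * a - k * int q) / real q = (signed_frac d - signed_frac e) - of_int m * \<delta>"
    using q by (simp add: signed_frac_def m_def k_def \<delta>_def field_simps)
  finally have 1: "1 / real q \<le> \<bar>(signed_frac d - signed_frac e) - of_int m * \<delta>\<bar>" .
  have "\<bar>of_int m * \<delta>\<bar> \<le> (real q / 2) * (1 / real q ^ 2)"
    unfolding abs_mult using m(2) approx by (intro mult_mono) (auto simp: \<delta>_def)
  also have "\<dots> = 1 / (2 * real q)" using q by (simp add: power2_eq_square)
  finally have "\<bar>of_int m * \<delta>\<bar> \<le> 1 / (2 * real q)" .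
  moreover have "1 / real q = 1 / (2 * real q) + 1 / (2 * real q)" by (simp add: field_simps)
  ultimately show ?thesis using 1 by linarith
qed

text \<open>Among the multiples of one sign the distances to the nearest integer are spaced; the two
  signs give twice the bound of \<open>sum_spaced_le\<close>.\<close>

lemma block_sum_le:
  assumes I: "finite I" "\<And>d e. d \<in> I \<Longrightarrow> e \<in> I \<Longrightarrow> 2 * \<bar>int d - int e\<bar> \<le> int q" and Z: "Z \<ge> 0"
  shows "(\<Sum>d\<in>I. osc_bound Z (real d * \<alpha>)) \<le> 4 * Z + 8 * real q * (1 + ln (real q))"
proof -
  define P where "P = {d \<in> I. signed_frac d \<ge> 0}"
  define M where "M = {d \<in> I. \<not> signed_frac d \<ge> 0}"
  have fin: "finite P" "finite M" using I by (auto simp: P_def M_def)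
  have half: "\<bar>signed_frac d\<bar> \<le> 1/2" for d unfolding abs_signed_frac by (rule nint_dist_le_half)
  have "(\<Sum>d\<in>I. osc_bound Z (real d * \<alpha>)) = (\<Sum>d\<in>P \<union> M. osc_bound Z (real d * \<alpha>))"
    by (intro sum.cong) (auto simp: P_def M_def)
  also have "\<dots> = (\<Sum>d\<in>P. osc_bound Z (real d * \<alpha>)) + (\<Sum>d\<in>M. osc_bound Z (real d * \<alpha>))"
    using fin by (intro sum.union_disjoint) (auto simp: P_def M_def)
  also have "(\<Sum>d\<in>P. osc_bound Z (real d * \<alpha>)) = (\<Sum>d\<in>P. 2 * Z / (1 + Z * signed_frac d))"
    by (intro sum.cong) (auto simp: P_def osc_bound_def abs_signed_frac[symmetric])
  also have "(\<Sum>d\<in>M. osc_bound Z (real d * \<alpha>)) = (\<Sum>d\<in>M. 2 * Z / (1 + Z * (- signed_frac d)))"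
    by (intro sum.cong) (auto simp: M_def osc_bound_def abs_signed_frac[symmetric])
  also have "(\<Sum>d\<in>P. 2 * Z / (1 + Z * signed_frac d)) \<le> 2 * Z + 4 * real q * (1 + ln (real q))"
  proof (rule sum_spaced_le)
    show "1 / (2 * real q) \<le> \<bar>signed_frac d - signed_frac e\<bar>" if "d \<in> P" "e \<in> P" "d \<noteq> e" for d e
      using signed_frac_spaced[OF that(3)] I(2) that by (auto simp: P_def)
    show "0 \<le> signed_frac d \<and> signed_frac d \<le> 1/2" if "d \<in> P" for d
      using half[of d] that by (auto simp: P_def)
  qed (use fin q Z in auto)
  moreover have "(\<Sum>d\<in>M. 2 * Z / (1 + Z * (- signed_frac d))) \<le> 2 * Z + 4 * real q * (1 + ln (real q))"
  proof (rule sum_spaced_le)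
    show "1 / (2 * real q) \<le> \<bar>- signed_frac d - - signed_frac e\<bar>" if "d \<in> M" "e \<in> M" "d \<noteq> e" for d e
      using signed_frac_spaced[OF that(3)] I(2) that by (auto simp: M_def abs_minus_commute)
    show "0 \<le> - signed_frac d \<and> - signed_frac d \<le> 1/2" if "d \<in> M" for d
      using half[of d] that by (auto simp: M_def)
  qed (use fin q Z in auto)
  ultimately show ?thesis by linarith
qed

text \<open>A block length just above \<open>q / 2\<close>: indices in one block differ by at most
  \<open>q / 2\<close>, and still \<open>k\<close> consecutive indices from 0 need at most
  \<open>2 * k / q + 1\<close> blocks. The summand 1 keeps it positive for
  \<open>q = 1\<close>.\<close>

definition h :: nat where "h = q div 2 + 1"

lemma h_pos: "h > 0" and h_ge: "real q \<le> 2 * real h" and h_le: "2 * (int h - 1) \<le> int q"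
  by (auto simp: h_def)

lemma block_props:
  "finite {d. d div h = i}" "\<And>d e. d div h = i \<Longrightarrow> e div h = i \<Longrightarrow> 2 * \<bar>int d - int e\<bar> \<le> int q"
proof -
  have *: "i * h \<le> d \<and> d < i * h + h" if "d div h = i" for d
  proof -
    have "d = i * h + d mod h" using that by (metis div_mult_mod_eq)
    moreover have "d mod h < h" using h_pos by simp
    ultimately show ?thesis by linarith
  qed
  show "finite {d. d div h = i}"
  proof (rule finite_subset)
    show "{d. d div h = i} \<subseteq> {..i * h + h}"
    proof
      fix d assume "d \<in> {d. d div h = i}"
      hence "d < i * h + h" using *[of d] by blast
      thus "d \<in> {..i * h + h}" by (simp only: atMost_iff less_imp_le)
    qed
  qed simp
  fix d e assume "d div h = i" "e div h = i"
  hence "\<bar>int d - int e\<bar> \<le> int h - 1" using *[of d] *[of e] by linarith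
  hence "2 * \<bar>int d - int e\<bar> \<le> 2 * (int h - 1)" by (rule mult_left_mono) simp
  thus "2 * \<bar>int d - int e\<bar> \<le> int q" using h_le by (rule order_trans)
qed

lemma sum_blocks:
  fixes f :: "nat \<Rightarrow> real"
  assumes "finite D"
  shows "(\<Sum>d\<in>D. f d) = (\<Sum>i\<in>(\<lambda>d. d div h) ` D. \<Sum>d\<in>{d\<in>D. d div h = i}. f d)"
  using assms by (rule sum.image_gen)

lemma sum_osc_bound_le:
  assumes "Z \<ge> 0"
  shows "(\<Sum>d<k. osc_bound Z (real d * \<alpha>)) \<le> (2 * real k / real q + 1) * (4 * Z + 8 * real q * (1 + ln (real q)))"
proof (cases "k = 0")
  case True
  thus ?thesis using assms q by simp
next
  case False
  define B where "B = 4 * Z + 8 * real q * (1 + ln (real q))"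
  have B0: "B \<ge> 0" using assms q by (simp add: B_def)
  define im where "im = (\<lambda>d. d div h) ` {..<k}"
  have im: "im \<subseteq> {..(k-1) div h}"
    unfolding im_def by (auto intro!: div_le_mono)
  have "(\<Sum>d<k. osc_bound Z (real d * \<alpha>)) = (\<Sum>i\<in>im. \<Sum>d\<in>{d\<in>{..<k}. d div h = i}. osc_bound Z (real d * \<alpha>))"
    unfolding im_def by (rule sum_blocks) auto
  also have "\<dots> \<le> (\<Sum>i\<in>im. B)"
    unfolding B_def using block_props(2) assms by (intro sum_mono block_sum_le) auto
  also have "\<dots> = real (card im) * B" by simp
  also have "\<dots> \<le> (2 * real k / real q + 1) * B"
  proof (rule mult_right_mono[OF _ B0])
    have "real (card im) \<le> real ((k - 1) div h + 1)"
      using card_mono[OF _ im] by simp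
    also have "real ((k - 1) div h + 1) \<le> 2 * real k / real q + 1"
    proof -
    have "real ((k - 1) div h) \<le> real (k - 1) / real h" by (rule of_nat_div_le_of_nat)
    also have "\<dots> \<le> real k / (real q / 2)"
      using h_ge q False by (intro frac_le) auto
    finally show ?thesis by (simp add: mult.commute)
    qed
    finally show "real (card im) \<le> 2 * real k / real q + 1" .
  qed
  finally show ?thesis unfolding B_def .
qed

text \<open>On every block but the first, \<open>X / d\<close> is constant up to a factor 2, and
  these blocks lead to a harmonic sum. On the first block \<open>X / d\<close> may be huge, but the
  spacing against the index 0 gives \<open>nint_dist (d * \<alpha>) >= 1 / (2 * q)\<close>, so that
  the length can be replaced by \<open>2 * q\<close>.\<close>

lemma sum_osc_bound_hyperbola_le:
  assumes X: "X \<ge> 0" and l: "1 + ln (real q) \<le> l" "1 + ln (real (max 1 D)) \<le> l"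
  shows "(\<Sum>d=1..D. osc_bound (X / real d) (real d * \<alpha>)) \<le> 32 * l * (real q + X / real q + real D)"
proof -
  define B where "B = 8 * real q * (1 + ln (real q))"
  have lq: "ln (real q) \<ge> 0" using q by simp
  have l1: "l \<ge> 1" using l lq by linarith
  define g where "g i = (if i = 0 then 32 * real q * (1 + ln (real q)) else 8 * X / real q * (1 / real i) + B)" for i :: nat
  define E where "E = D div h"
  have "(\<Sum>d=1..D. osc_bound (X / real d) (real d * \<alpha>)) =
      (\<Sum>i\<in>(\<lambda>d. d div h) ` {1..D}. \<Sum>d\<in>{d\<in>{1..D}. d div h = i}. osc_bound (X / real d) (real d * \<alpha>))"
    by (rule sum_blocks) auto
  also have "\<dots> \<le> (\<Sum>i\<in>(\<lambda>d. d div h) ` {1..D}. g i)"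
  proof (rule sum_mono)
    fix i
    show "(\<Sum>d\<in>{d\<in>{1..D}. d div h = i}. osc_bound (X / real d) (real d * \<alpha>)) \<le> g i"
    proof (cases "i = 0")
      case True
      have "(\<Sum>d\<in>{d\<in>{1..D}. d div h = i}. osc_bound (X / real d) (real d * \<alpha>)) \<le>
         (\<Sum>d\<in>{d\<in>{1..D}. d div h = i}. 2 * osc_bound (2 * real q) (real d * \<alpha>))"
      proof (rule sum_mono)
        fix d assume d: "d \<in> {d\<in>{1..D}. d div h = i}"
        define x where "x = nint_dist (real d * \<alpha>)"
        have "2 * \<bar>int d - int 0\<bar> \<le> int q" using d True by (intro block_props(2)[of _ 0]) auto
        hence "x \<ge> 1 / (2 * real q)"
          using signed_frac_spaced[of d 0] d abs_signed_frac[of d] by (simp add: x_def signed_frac_def)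
        hence qx: "2 * real q * x \<ge> 1" using q by (simp add: field_simps)
        have "x \<noteq> 0" using qx by auto
        moreover have "x \<ge> 0" by (simp add: x_def)
        ultimately have x0: "x > 0" by simp
        have "osc_bound (X / real d) (real d * \<alpha>) * x \<le> 2"
          unfolding x_def by (rule osc_bound_mult_le) (use X in auto)
        hence "osc_bound (X / real d) (real d * \<alpha>) \<le> 2 / x" using x0 by (simp add: field_simps)
        also have "2 / x \<le> 2 * osc_bound (2 * real q) (real d * \<alpha>)"
        proof -
          have "0 < 1 + 2 * real q * x" using qx by linarith
          hence "1 / x \<le> 4 * real q / (1 + 2 * real q * x)"
            using qx x0 by (simp add: pos_divide_le_eq pos_le_divide_eq mult_ac)
          thus ?thesis by (simp add: osc_bound_def x_def)
        qed
        finally show "osc_bound (X / real d) (real d * \<alpha>) \<le> 2 * osc_bound (2 * real q) (real d * \<alpha>)" .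
      qed
      also have "\<dots> = 2 * (\<Sum>d\<in>{d\<in>{1..D}. d div h = i}. osc_bound (2 * real q) (real d * \<alpha>))"
        by (simp add: sum_distrib_left)
      also have "\<dots> \<le> 2 * (4 * (2 * real q) + 8 * real q * (1 + ln (real q)))"
        using block_props(2) by (intro mult_left_mono block_sum_le) auto
      also have "\<dots> \<le> 32 * real q * (1 + ln (real q))" using lq q by (simp add: algebra_simps)
      finally show ?thesis using True by (simp add: g_def)
    next
      case False
      have "(\<Sum>d\<in>{d\<in>{1..D}. d div h = i}. osc_bound (X / real d) (real d * \<alpha>)) \<le>
         (\<Sum>d\<in>{d\<in>{1..D}. d div h = i}. osc_bound (X / real (i * h)) (real d * \<alpha>))"
      proof (intro sum_mono osc_bound_mono)
        fix d assume d: "d \<in> {d\<in>{1..D}. d div h = i}"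
        have "i * h \<le> d" using d by auto
        hence "real (i * h) \<le> real d" by (simp only: of_nat_le_iff)
        thus "X / real d \<le> X / real (i * h)" using False h_pos X d
          by (intro divide_left_mono mult_pos_pos) auto
      qed (use X in auto)
      also have "\<dots> \<le> 4 * (X / real (i * h)) + B"
        unfolding B_def using block_props(2) X by (intro block_sum_le) auto
      also have "X / real (i * h) \<le> X / (real i * (real q / 2))"
        using X False q h_ge h_pos by (intro divide_left_mono) auto
      finally show ?thesis using False by (simp add: g_def mult_ac)
    qed
  qed
  also have "\<dots> \<le> (\<Sum>i\<in>{0..E}. g i)"
    using X lq by (intro sum_mono2) (auto simp: g_def B_def E_def intro!: div_le_mono add_nonneg_nonneg)
  also have "\<dots> = 32 * real q * (1 + ln (real q)) + 8 * X / real q * (\<Sum>i=1..E. 1 / real i) + real E * B"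
    by (subst sum.atLeast_Suc_atMost) (auto simp: g_def sum.distrib sum_distrib_left)
  also have "\<dots> \<le> 32 * real q * l + 8 * X / real q * l + 16 * real D * l"
  proof (intro add_mono mult_left_mono)
    have "(\<Sum>i=1..E. 1 / real i) \<le> 1 + ln (real (max 1 E))" by (rule sum_inverse_le)
    also have "ln (real (max 1 E)) \<le> ln (real (max 1 D))"

    proof (intro ln_mono)
      have "E \<le> D" unfolding E_def by simp
      thus "real (max 1 E) \<le> real (max 1 D)" by simp
    qed auto
    finally show "(\<Sum>i=1..E. 1 / real i) \<le> l" using l by simp
    have "real E \<le> real D / real h" unfolding E_def by (rule of_nat_div_le_of_nat)
    also have "\<dots> \<le> real D / (real q / 2)" using h_ge q h_pos by (intro divide_left_mono) auto
    finally have "real E * B \<le> real D / (real q / 2) * B" using lq by (intro mult_right_mono) (auto simp: B_def)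
    also have "\<dots> = 16 * real D * (1 + ln (real q))" using q by (simp add: B_def)
    also have "\<dots> \<le> 16 * real D * l" using l by (intro mult_left_mono) auto
    finally show "real E * B \<le> 16 * real D * l" .
  qed (use l X in auto)
  also have "\<dots> \<le> 32 * l * (real q + X / real q + real D)"
  proof -
    have "0 \<le> X / real q * l" "0 \<le> real D * l" using X l1 by auto
    moreover have "8 * X / real q * l = 8 * (X / real q * l)" by simp
    moreover have "32 * l * (real q + X / real q + real D) = 32 * real q * l + 32 * (X / real q * l) + 32 * (real D * l)"
      by (simp only: distrib_left distrib_right mult_ac)
    ultimately show ?thesis by linarith
  qed
  finally show ?thesis .
qed

end

section \<open>Vaughan's identity\<close>

definition moebius_mu :: "nat \<Rightarrow> real" where
  "moebius_mu n = (if squarefree n then (-1) ^ card (prime_factors n) else 0)"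

lemma abs_moebius_mu_le: "\<bar>moebius_mu n\<bar> \<le> 1"
  by (simp add: moebius_mu_def power_abs)

lemma moebius_mu_prime_mult:
  assumes p: "prime p" and d: "d > 0"
  shows "moebius_mu (p * d) = (if p dvd d then 0 else - moebius_mu d)"
proof (cases "p dvd d")
  case True
  then obtain e where "d = p * e" by blast
  hence "p ^ 2 dvd p * d" by (simp add: power2_eq_square)
  hence "\<not> squarefree (p * d)" using p by (auto simp: squarefree_def)
  thus ?thesis using True by (simp add: moebius_mu_def)
next
  case False
  hence cop: "coprime p d" using p by (simp add: prime_imp_coprime)
  have "squarefree (p * d) \<longleftrightarrow> squarefree d"
    using squarefree_mult_coprime[OF cop] squarefree_prime[OF p] squarefree_multD(2)[of p d] by blast
  moreover have "prime_factors (p * d) = insert p (prime_factors d)"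
    using p d by (simp add: prime_factors_product prime_prime_factors)
  moreover have "p \<notin> prime_factors d" using False by auto
  ultimately show ?thesis using False by (simp add: moebius_mu_def)
qed

text \<open>For a prime \<open>p\<close> dividing \<open>n\<close>, the divisors \<open>d\<close>
  and \<open>p * d\<close> with \<open>d\<close> prime to \<open>p\<close> cancel in pairs; the
  remaining divisors are divisible by \<open>p ^ 2\<close> and contribute 0.\<close>

lemma sum_moebius_mu_divisors:
  assumes n: "n > 0"
  shows "(\<Sum>d | d dvd n. moebius_mu d) = (if n = 1 then 1 else 0)"
proof (cases "n = 1")
  case True
  thus ?thesis by (simp add: moebius_mu_def)
next
  case False
  then obtain p where p: "prime p" "p dvd n" using prime_factor_nat by blast
  define A where "A = {d. d dvd n \<and> \<not> p dvd d}"
  define B where "B = {d. d dvd n \<and> p dvd d}"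
  have fin: "finite A" "finite B" using n by (auto simp: A_def B_def)
  have "(\<Sum>d | d dvd n. moebius_mu d) = (\<Sum>d\<in>A \<union> B. moebius_mu d)"
    by (intro sum.cong) (auto simp: A_def B_def)
  also have "\<dots> = (\<Sum>d\<in>A. moebius_mu d) + (\<Sum>d\<in>B. moebius_mu d)"
    using fin by (intro sum.union_disjoint) (auto simp: A_def B_def)
  also have "(\<Sum>d\<in>B. moebius_mu d) = (\<Sum>d\<in>(*) p ` A. moebius_mu d)"
  proof (rule sum.mono_neutral_right)
    show "(*) p ` A \<subseteq> B"
    proof
      fix x assume "x \<in> (*) p ` A"
      then obtain d where d: "x = p * d" "d dvd n" "\<not> p dvd d" by (auto simp: A_def)
      hence "coprime p d" using p by (simp add: prime_imp_coprime)
      thus "x \<in> B" using d p by (auto simp: B_def divides_mult)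
    qed
    show "\<forall>i\<in>B - (*) p ` A. moebius_mu i = 0"
    proof
      fix i assume i: "i \<in> B - (*) p ` A"
      then obtain d where d: "i = p * d" by (auto simp: B_def)
      hence dn: "d dvd n" using i by (auto simp: B_def dest: dvd_mult_right)
      hence "p dvd d" using i d by (auto simp: A_def)
      moreover have "d > 0" using dn n by (auto intro: Nat.gr0I)
      ultimately show "moebius_mu i = 0" using moebius_mu_prime_mult[OF p(1)] d by simp
    qed
  qed (use fin in auto)
  also have "\<dots> = (\<Sum>d\<in>A. moebius_mu (p * d))"
    using p(1) by (subst sum.reindex) (auto simp: inj_on_def prime_gt_0_nat)
  also have "\<dots> = (\<Sum>d\<in>A. - moebius_mu d)"
  proof (intro sum.cong refl)
    fix d assume "d \<in> A"
    hence "d > 0" "\<not> p dvd d" using n by (auto simp: A_def intro: Nat.gr0I)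
    thus "moebius_mu (p * d) = - moebius_mu d" using moebius_mu_prime_mult[OF p(1)] by simp
  qed
  finally show ?thesis using False by (simp add: sum_negf)
qed

text \<open>Both sides run over the pairs with \<open>d * m \<le> N\<close>, arranged by product or
  by first factor. It is also used backwards, to collect terms with equal product.\<close>

lemma sum_divisors_swap:
  fixes g :: "nat \<Rightarrow> nat \<Rightarrow> 'a :: comm_monoid_add"
  shows "(\<Sum>n=1..N. \<Sum>d | d dvd n. g d (n div d)) = (\<Sum>d=1..N. \<Sum>m=1..N div d. g d m)"
proof -
  have "(\<Sum>n=1..N. \<Sum>d | d dvd n. g d (n div d)) = (\<Sum>(n,d)\<in>(SIGMA n:{1..N}. {d. d dvd n}). g d (n div d))"
    by (intro sum.Sigma) auto
  also have "\<dots> = (\<Sum>(d,m)\<in>(SIGMA d:{1..N}. {1..N div d}). g d m)"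
  proof (rule sum.reindex_bij_witness[of _ "\<lambda>(d, m). (d * m, d)" "\<lambda>(n, d). (d, n div d)"], goal_cases)
    case (2 x)
    then obtain n d where x: "x = (n, d)" "1 \<le> n" "n \<le> N" "d dvd n" by auto
    have "d > 0" "d \<le> n" using x by (auto intro: Nat.gr0I dvd_imp_le)
    moreover have "n div d > 0" using x \<open>d > 0\<close> \<open>d \<le> n\<close> by (simp add: div_greater_zero_iff)
    ultimately show ?case using x by (auto intro: div_le_mono)
  next
    case (4 x)
    then obtain d m where x: "x = (d, m)" "1 \<le> d" "1 \<le> m" "m \<le> N div d" by auto
    have "d * m \<le> N" using x(4) by (metis div_times_less_eq_dividend dual_order.trans mult.commute mult_le_mono1)
    thus ?case using x by auto
  qed auto
  also have "\<dots> = (\<Sum>d=1..N. \<Sum>m=1..N div d. g d m)"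
    by (intro sum.Sigma[symmetric]) auto
  finally show ?thesis .
qed

text \<open>The Dirichlet convolution of 1 with the von Mangoldt function restricted to
  \<open>k > V\<close>. Type I sums use that it is \<open>ln m\<close> minus a sum over short
  divisors, type II sums that it vanishes for \<open>m \<le> V\<close>.\<close>

definition mangoldt_tail :: "nat \<Rightarrow> nat \<Rightarrow> real" where
  "mangoldt_tail V m = (\<Sum>k | k dvd m \<and> V < k. mangoldt k)"

lemma mangoldt_tail_nonneg: "mangoldt_tail V m \<ge> 0"
  unfolding mangoldt_tail_def by (intro sum_nonneg mangoldt_nonneg)

lemma mangoldt_tail_eq:
  assumes "m > 0"
  shows "mangoldt_tail V m = ln (real m) - (\<Sum>k | k dvd m. if k \<le> V then mangoldt k else 0)"
proof -
  have fin: "finite {k. k dvd m}" using assms by simp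
  have "ln (real m) = (\<Sum>k | k dvd m. mangoldt k)" using mangoldt_sum[of m, where ?'a = real] assms by simp
  also have "\<dots> = (\<Sum>k | k dvd m. if V < k then mangoldt k else 0) + (\<Sum>k | k dvd m. if k \<le> V then mangoldt k else 0)"
    unfolding sum.distrib[symmetric] by (intro sum.cong) auto
  also have "(\<Sum>k | k dvd m. if V < k then mangoldt k else 0) = mangoldt_tail V m"
    unfolding mangoldt_tail_def using fin by (simp add: sum.inter_filter[symmetric])
  finally show ?thesis by simp
qed

lemma mangoldt_tail_le:
  assumes "m > 0"
  shows "mangoldt_tail V m \<le> ln (real m)"
  unfolding mangoldt_tail_eq[OF assms] by (simp add: sum_nonneg mangoldt_nonneg)

lemma mangoldt_tail_eq_0: "m > 0 \<Longrightarrow> m \<le> V \<Longrightarrow> mangoldt_tail V m = 0"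
  unfolding mangoldt_tail_def by (intro sum.neutral) (auto dest: dvd_imp_le)

text \<open>Associativity of Dirichlet convolution: the Moebius function cancels the constant 1
  contained in \<open>mangoldt_tail\<close>.\<close>

lemma sum_moebius_mu_mangoldt_tail:
  assumes n: "n > 0"
  shows "(\<Sum>d | d dvd n. moebius_mu d * mangoldt_tail V (n div d)) = (if V < n then mangoldt n else 0)"
proof -
  define \<Lambda> where "\<Lambda> k = (if V < k then mangoldt k else 0 :: real)" for k
  have fin: "finite {d. d dvd m}" if "m dvd n" for m
  proof -
    have "m > 0" using that n by (auto intro: Nat.gr0I)
    thus ?thesis by simp
  qed
  have fin': "finite {k. k dvd n div d}" if "d dvd n" for d
    using fin[of "n div d"] that by auto
  have *: "d dvd n \<and> k dvd n div d \<longleftrightarrow> k * d dvd n" for d k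
  proof (cases "d = 0")
    case False
    thus ?thesis using dvd_div_iff_mult[of d n k] by (auto dest: dvd_mult_right)
  qed (use n in auto)
  \<comment> \<open>Both sides say that \<open>k * d\<close> divides \<open>n\<close>; this is the
    associativity.\<close>
  have key: "d dvd n \<and> k dvd n div d \<longleftrightarrow> k dvd n \<and> d dvd n div k" for d k
    unfolding * by (simp add: mult.commute)
  have "(\<Sum>d | d dvd n. moebius_mu d * mangoldt_tail V (n div d)) =
        (\<Sum>d | d dvd n. \<Sum>k | k dvd n div d. moebius_mu d * \<Lambda> k)"
  proof (intro sum.cong refl)
    fix d assume "d \<in> {d. d dvd n}"
    hence "n div d dvd n" by (auto simp: dvd_def)
    from fin[OF this] show "moebius_mu d * mangoldt_tail V (n div d) = (\<Sum>k | k dvd n div d. moebius_mu d * \<Lambda> k)"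
      by (simp add: mangoldt_tail_def \<Lambda>_def sum_distrib_left[symmetric] sum.inter_filter[symmetric])
  qed
  also have "\<dots> = (\<Sum>(d,k)\<in>(SIGMA d:{d. d dvd n}. {k. k dvd n div d}). moebius_mu d * \<Lambda> k)"
    by (rule sum.Sigma) (use fin fin' in auto)
  also have "\<dots> = (\<Sum>(k,d)\<in>(SIGMA k:{k. k dvd n}. {d. d dvd n div k}). moebius_mu d * \<Lambda> k)"
    by (rule sum.reindex_bij_witness[of _ "\<lambda>(d, m). (m, d)" "\<lambda>(n, d). (d, n)"])
       (use key in auto)
  also have "\<dots> = (\<Sum>k | k dvd n. \<Sum>d | d dvd n div k. moebius_mu d * \<Lambda> k)"
    by (rule sum.Sigma[symmetric]) (use fin fin' in auto)
  also have "\<dots> = (\<Sum>k | k dvd n. if k = n then \<Lambda> n else 0)"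
  proof (intro sum.cong refl)
    fix k assume k: "k \<in> {d. d dvd n}"
    hence "n div k > 0" "n div k = 1 \<longleftrightarrow> k = n" using n by (auto elim!: dvdE)
    thus "(\<Sum>d | d dvd n div k. moebius_mu d * \<Lambda> k) = (if k = n then \<Lambda> n else 0)"
      by (simp add: sum_distrib_right[symmetric] sum_moebius_mu_divisors)
  qed
  also have "\<dots> = \<Lambda> n" using n by simp
  finally show ?thesis by (simp add: \<Lambda>_def)
qed

text \<open>The parameter \<open>U\<close> does not occur yet: cutting the range of \<open>d\<close>
  at \<open>U\<close> later gives the type I part \<open>d \<le> U\<close> and the type II part
  \<open>d > U\<close>.\<close>

lemma vaughan_identity:
  fixes f :: "nat \<Rightarrow> complex"
  shows "(\<Sum>n=1..N. (if V < n then mangoldt n else 0) *\<^sub>R f n) =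
    (\<Sum>d=1..N. \<Sum>m=1..N div d. (moebius_mu d * mangoldt_tail V m) *\<^sub>R f (d * m))"
proof -
  have "(\<Sum>n=1..N. (if V < n then mangoldt n else 0) *\<^sub>R f n) =
      (\<Sum>n=1..N. \<Sum>d | d dvd n. (moebius_mu d * mangoldt_tail V (n div d)) *\<^sub>R f (d * (n div d)))"
  proof (intro sum.cong refl)
    fix n assume "n \<in> {1..N}"
    hence "n > 0" by simp
    have "(if V < n then mangoldt n else 0) *\<^sub>R f n = (\<Sum>d | d dvd n. moebius_mu d * mangoldt_tail V (n div d)) *\<^sub>R f n"
      using sum_moebius_mu_mangoldt_tail[OF \<open>n > 0\<close>] by simp
    also have "\<dots> = (\<Sum>d | d dvd n. (moebius_mu d * mangoldt_tail V (n div d)) *\<^sub>R f (d * (n div d)))"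
      unfolding scaleR_sum_left by (intro sum.cong) auto
    finally show "(if V < n then mangoldt n else 0) *\<^sub>R f n = (\<Sum>d | d dvd n. (moebius_mu d * mangoldt_tail V (n div d)) *\<^sub>R f (d * (n div d)))" .
  qed
  also have "\<dots> = (\<Sum>d=1..N. \<Sum>m=1..N div d. (moebius_mu d * mangoldt_tail V m) *\<^sub>R f (d * m))"
    by (rule sum_divisors_swap)
  finally show ?thesis .
qed

section \<open>Type I and type II sums\<close>

context rational_approx
begin

abbreviation \<phi> :: "nat \<Rightarrow> complex" where
  "\<phi> n \<equiv> cis (2 * pi * (real n * \<alpha>))"

lemma osc_bound_diff:
  assumes "n' \<le> n"
  shows "osc_bound Z ((real n - real n') * \<alpha>) = osc_bound Z (real (n - n') * \<alpha>)"
        "osc_bound Z ((real n' - real n) * \<alpha>) = osc_bound Z (real (n - n') * \<alpha>)"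
proof -
  show "osc_bound Z ((real n - real n') * \<alpha>) = osc_bound Z (real (n - n') * \<alpha>)"
    using assms by (simp add: of_nat_diff)
  have "(real n' - real n) * \<alpha> = - ((real n - real n') * \<alpha>)" by (simp add: algebra_simps)
  thus "osc_bound Z ((real n' - real n) * \<alpha>) = osc_bound Z (real (n - n') * \<alpha>)"
    using assms by (simp add: osc_bound_def nint_dist_minus of_nat_diff)
qed

text \<open>By \<open>mangoldt_tail_eq\<close> the inner sum splits in two. The smooth weight
  \<open>ln m\<close> is removed by partial summation; in the rest, writing \<open>m = k * r\<close>
  with \<open>k \<le> V\<close> leaves a geometric sum over \<open>r\<close>. All frequencies are
  \<open>t * \<alpha>\<close> with \<open>t \<le> U * V\<close>, where \<open>t = d\<close> or
  \<open>t = d * k\<close>.\<close>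

lemma type_I_sum_le:
  assumes UV: "U \<ge> 1" "V \<ge> 1" "U * V \<le> N" and l: "1 + ln (real q) \<le> l" "1 + ln (real N) \<le> l"
  shows "norm (\<Sum>d=1..U. \<Sum>m=1..N div d. (moebius_mu d * mangoldt_tail V m) *\<^sub>R \<phi> (d * m)) \<le>
    96 * l ^ 2 * (real q + real N / real q + real (U * V))"
proof -
  have N1: "N \<ge> 1"
  proof -
    have "0 < U * V" using UV(1,2) by simp
    thus ?thesis using UV(3) by linarith
  qed
  have l1: "l \<ge> 1"
  proof -
    have "0 \<le> ln (real N)" using N1 by simp
    thus ?thesis using l(2) by linarith
  qed
  have lnN: "ln (real N) \<le> l" using l by linarith
  have lD: "1 + ln (real (max 1 D)) \<le> l" if "D \<le> N" for D
  proof -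
    have "ln (real (max 1 D)) \<le> ln (real N)" using that N1 by (intro ln_mono) auto
    thus ?thesis using l by linarith
  qed
  let ?B = "32 * l * (real q + real N / real q + real (U * V))"
  let ?m = "\<lambda>k. if k \<le> V then mangoldt k else 0 :: real"
  let ?o = "\<lambda>d k. osc_bound (real N / real (d * k)) (real (d * k) * \<alpha>)"
  have UN: "U \<le> N" "U \<le> U * V"
  proof -
    show *: "U \<le> U * V" using UV(2) by simp
    show "U \<le> N" using * UV(3) by (rule order_trans)
  qed
  define S1 where "S1 d = (\<Sum>m=1..N div d. ln (real m) *\<^sub>R \<phi> (d * m))" for d
  define S2 where "S2 d = (\<Sum>m=1..N div d. (\<Sum>k | k dvd m. if k \<le> V then mangoldt k else 0) *\<^sub>R \<phi> (d * m))" for d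
  have split: "(\<Sum>m=1..N div d. (moebius_mu d * mangoldt_tail V m) *\<^sub>R \<phi> (d * m)) = moebius_mu d *\<^sub>R (S1 d - S2 d)" for d
  proof -
    have "(\<Sum>m=1..N div d. (moebius_mu d * mangoldt_tail V m) *\<^sub>R \<phi> (d * m)) =
      (\<Sum>m=1..N div d. moebius_mu d *\<^sub>R (ln (real m) *\<^sub>R \<phi> (d * m) - (\<Sum>k | k dvd m. if k \<le> V then mangoldt k else 0) *\<^sub>R \<phi> (d * m)))"
      by (intro sum.cong refl) (simp add: mangoldt_tail_eq scaleR_diff_left scaleR_diff_right right_diff_distrib)
    thus ?thesis by (simp add: S1_def S2_def scaleR_sum_right sum_subtractf scaleR_diff_right)
  qed
  have geo: "norm (\<Sum>m=1..j. \<phi> (d * m)) \<le> osc_bound (real N / real d) (real d * \<alpha>)" if "j \<le> N div d" for d j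
  proof -
    have "real j \<le> real (N div d)" using that by simp
    also have "\<dots> \<le> real N / real d" by (rule of_nat_div_le_of_nat)
    finally have j: "real j - real 0 \<le> real N / real d" by simp
    have "(\<Sum>m=1..j. \<phi> (d * m)) = (\<Sum>m\<in>{0<..j}. cis (2 * pi * (real m * (real d * \<alpha>))))"
      by (intro sum.cong) (auto simp: mult_ac)
    also have "norm \<dots> \<le> osc_bound (real N / real d) (real d * \<alpha>)"
      using j by (intro norm_exponential_sum_le) auto
    finally show ?thesis .
  qed
  have S1: "norm (S1 d) \<le> 2 * l * osc_bound (real N / real d) (real d * \<alpha>)" if "d \<in> {1..U}" for d
    unfolding S1_def
  proof (rule norm_weighted_sum_le)
    fix m assume m: "1 \<le> m" "m \<le> N div d"
    have "m \<le> N" using m(2) by (meson div_le_dividend le_trans)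
    hence "ln (real m) \<le> ln (real N)" using m by (intro ln_mono) auto
    thus "0 \<le> ln (real m) \<and> ln (real m) \<le> l" using m lnN by auto
  next
    show "norm (\<Sum>m=1..j. \<phi> (d * m)) \<le> osc_bound (real N / real d) (real d * \<alpha>)" if "j \<le> N div d" for j
      using that by (rule geo)
    show "(\<forall>m\<ge>1. Suc m \<le> N div d \<longrightarrow> ln (real m) \<le> ln (real (Suc m))) \<or>
        (\<forall>m\<ge>1. Suc m \<le> N div d \<longrightarrow> ln (real (Suc m)) \<le> ln (real m))" by simp
    show "0 \<le> l" using l1 by simp
  qed
  have S2_eq: "S2 d = (\<Sum>k=1..N div d. ?m k *\<^sub>R (\<Sum>r=1..N div (d * k). \<phi> (d * k * r)))" for d
  proof -
    have "S2 d = (\<Sum>m=1..N div d. \<Sum>k | k dvd m. ?m k *\<^sub>R \<phi> (d * (k * (m div k))))"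
      unfolding S2_def scaleR_sum_left by (intro sum.cong) auto
    also have "\<dots> = (\<Sum>k=1..N div d. \<Sum>r=1..N div d div k. ?m k *\<^sub>R \<phi> (d * (k * r)))"
      by (rule sum_divisors_swap)
    finally show ?thesis by (simp add: div_mult2_eq scaleR_sum_right mult.assoc)
  qed
  have S2: "norm (S2 d) \<le> (\<Sum>k=1..V. mangoldt k * ?o d k)"
    if d: "d \<in> {1..U}" for d
  proof -
    have "norm (S2 d) \<le> (\<Sum>k=1..N div d. ?m k * ?o d k)"
      unfolding S2_eq
    proof (rule order_trans[OF norm_sum sum_mono])
      fix k assume "k \<in> {1..N div d}"
      show "norm (?m k *\<^sub>R (\<Sum>r=1..N div (d * k). \<phi> (d * k * r))) \<le>
        ?m k * ?o d k"
      proof -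
        have c0: "0 \<le> (if k \<le> V then mangoldt k else 0 :: real)" by (simp add: mangoldt_nonneg)
        have "norm (?m k *\<^sub>R (\<Sum>r=1..N div (d * k). \<phi> (d * k * r))) =
          ?m k * norm (\<Sum>r=1..N div (d * k). \<phi> (d * k * r))"
          unfolding norm_scaleR abs_of_nonneg[OF c0] ..
        also have "\<dots> \<le> ?m k * ?o d k"
          by (rule mult_left_mono[OF geo c0]) (rule order_refl)
        finally show ?thesis .
      qed
    qed
    also have "\<dots> = (\<Sum>k\<in>{1..N div d} \<inter> {1..V}. mangoldt k * ?o d k)"
    proof (rule sum.mono_neutral_cong_right)
      show "\<forall>k\<in>{1..N div d} - {1..N div d} \<inter> {1..V}. ?m k *
          ?o d k = 0" by (simp del: of_nat_mult)
    qed (simp_all del: of_nat_mult)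
    also have "\<dots> \<le> (\<Sum>k=1..V. mangoldt k * ?o d k)"
      by (rule sum_mono2) (simp_all add: mangoldt_nonneg osc_bound_nonneg del: of_nat_mult)
    finally show ?thesis .
  qed
  define g where "g t = osc_bound (real N / real t) (real t * \<alpha>)" for t :: nat
  have g0: "g t \<ge> 0" for t unfolding g_def by (intro osc_bound_nonneg) auto
  have "(\<Sum>d=1..U. \<Sum>k=1..V. mangoldt k * g (d * k)) = (\<Sum>k=1..V. \<Sum>d=1..U. mangoldt k * g (d * k))"
    by (rule sum.swap)
  also have "\<dots> \<le> (\<Sum>k=1..V. \<Sum>d=1..U * V div k. mangoldt k * g (k * d))"
  proof (rule sum_mono)
    fix k assume k: "k \<in> {1..V}"
    have "U * k \<le> U * V" using k by auto
    hence "U \<le> U * V div k" using k by (simp add: less_eq_div_iff_mult_less_eq)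
    thus "(\<Sum>d=1..U. mangoldt k * g (d * k)) \<le> (\<Sum>d=1..U * V div k. mangoldt k * g (k * d))"
      by (subst mult.commute, intro sum_mono2) (auto intro!: mult_nonneg_nonneg mangoldt_nonneg g0)
  qed
  also have "\<dots> \<le> (\<Sum>k=1..U * V. \<Sum>d=1..U * V div k. mangoldt k * g (k * d))"
    using UV by (intro sum_mono2) (auto intro!: sum_nonneg mult_nonneg_nonneg mangoldt_nonneg g0)
  also have "\<dots> = (\<Sum>t=1..U * V. \<Sum>k | k dvd t. mangoldt k * g (k * (t div k)))"
    by (rule sum_divisors_swap[symmetric])
  also have "\<dots> = (\<Sum>t=1..U * V. ln (real t) * g t)"
  proof (intro sum.cong refl)
    fix t assume t: "t \<in> {1..U * V}"
    have "(\<Sum>k | k dvd t. mangoldt k * g (k * (t div k))) = (\<Sum>k | k dvd t. mangoldt k) * g t"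
      unfolding sum_distrib_right by (intro sum.cong) auto
    also have "(\<Sum>k | k dvd t. mangoldt k) = ln (real t)"
      using mangoldt_sum[of t, where ?'a = real] t by simp
    finally show "(\<Sum>k | k dvd t. mangoldt k * g (k * (t div k))) = ln (real t) * g t" .
  qed
  also have "\<dots> \<le> (\<Sum>t=1..U * V. l * g t)"
  proof (intro sum_mono mult_right_mono g0)
    fix t assume "t \<in> {1..U * V}"
    hence "ln (real t) \<le> ln (real N)" using UV(3) by (intro ln_mono) auto
    thus "ln (real t) \<le> l" using lnN by simp
  qed
  also have "\<dots> = l * (\<Sum>t=1..U * V. g t)" by (simp add: sum_distrib_left)
  also have "\<dots> \<le> l * (?B)"
  proof (rule mult_left_mono)
    show "(\<Sum>t=1..U * V. g t) \<le> ?B"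
      unfolding g_def by (rule sum_osc_bound_hyperbola_le[OF _ l(1) lD[OF UV(3)]]) simp
  qed (use l1 in simp)
  finally have B2: "(\<Sum>d=1..U. \<Sum>k=1..V. mangoldt k * g (d * k)) \<le> l * (?B)" .
  have B1: "2 * l * (\<Sum>d=1..U. g d) \<le> 2 * l * (?B)"
  proof (rule mult_left_mono)
    have "(\<Sum>d=1..U. g d) \<le> 32 * l * (real q + real N / real q + real U)"
      unfolding g_def by (rule sum_osc_bound_hyperbola_le[OF _ l(1) lD[OF UN(1)]]) simp
    moreover have "real U \<le> real (U * V)" unfolding of_nat_le_iff by (rule UN(2))
    hence "32 * l * (real q + real N / real q + real U) \<le> ?B"
      using l1 by (intro mult_left_mono) auto
    ultimately show "(\<Sum>d=1..U. g d) \<le> ?B"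
      by (rule order_trans)
  qed (use l1 in auto)
  have "norm (\<Sum>d=1..U. \<Sum>m=1..N div d. (moebius_mu d * mangoldt_tail V m) *\<^sub>R \<phi> (d * m)) \<le>
      (\<Sum>d=1..U. 2 * l * g d + (\<Sum>k=1..V. mangoldt k * g (d * k)))"
    unfolding split
  proof (rule order_trans[OF norm_sum sum_mono])
    fix d assume d: "d \<in> {1..U}"
    have "norm (moebius_mu d *\<^sub>R (S1 d - S2 d)) \<le> 1 * norm (S1 d - S2 d)"
      unfolding norm_scaleR using abs_moebius_mu_le by (intro mult_right_mono) auto
    also have "\<dots> \<le> norm (S1 d) + norm (S2 d)" by (simp add: norm_triangle_ineq4)
    also have "\<dots> \<le> 2 * l * g d + (\<Sum>k=1..V. mangoldt k * g (d * k))"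
      unfolding g_def by (intro add_mono S1 S2 d)
    finally show "norm (moebius_mu d *\<^sub>R (S1 d - S2 d)) \<le> 2 * l * g d + (\<Sum>k=1..V. mangoldt k * g (d * k))" .
  qed
  also have "\<dots> = 2 * l * (\<Sum>d=1..U. g d) + (\<Sum>d=1..U. \<Sum>k=1..V. mangoldt k * g (d * k))"
    by (simp add: sum.distrib sum_distrib_left)
  also have "\<dots> \<le> 2 * l * (?B) + l * (?B)"
    using B1 B2 by (rule add_mono)
  also have "\<dots> = 96 * l ^ 2 * (real q + real N / real q + real (U * V))"
    by (simp add: power2_eq_square algebra_simps)
  finally show ?thesis .
qed

end

context rational_approx
begin

text \<open>For fixed \<open>n\<close> the differences \<open>n - n'\<close> are distinct and below
  \<open>n\<close>, so \<open>sum_osc_bound_le\<close> applies. Of the four terms of its product,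
  two carry \<open>1 / n\<close> and give a harmonic sum, one is constant and is summed over at most
  \<open>N / U\<close> values of \<open>n\<close>, and the one with \<open>1 / n ^ 2\<close> yields
  \<open>1 / V\<close>.\<close>

lemma type_II_inner_le:
  assumes l: "1 + ln (real q) \<le> l" "1 + ln (real N) \<le> l" and U: "U \<ge> 1" and V: "V \<ge> 1" and N: "N \<ge> 1"
  defines "E \<equiv> N div U"
  shows "(\<Sum>n\<in>{V<..E}. real N / real n * (\<Sum>n'\<in>{V<..n}. osc_bound (real N / real n) (real (n - n') * \<alpha>)))
    \<le> 16 * l ^ 2 * (real N ^ 2 / real q + real N ^ 2 / real U + real N ^ 2 / real V + real N * real q)"
proof -
  have lq: "ln (real q) \<ge> 0" using q by simp
  have l1: "l \<ge> 1" using l lq by linarith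
  have EN: "E \<le> N" by (simp add: E_def)
  have ENU: "real E \<le> real N / real U" unfolding E_def by (rule of_nat_div_le_of_nat)
  have sub: "(\<Sum>n'\<in>{V<..n}. osc_bound Z (real (n - n') * \<alpha>)) \<le> (\<Sum>j<n. osc_bound Z (real j * \<alpha>))"
    if Z: "Z \<ge> 0" for n Z
  proof -
    have "(\<Sum>n'\<in>{V<..n}. osc_bound Z (real (n - n') * \<alpha>)) = (\<Sum>j\<in>(\<lambda>n'. n - n') ` {V<..n}. osc_bound Z (real j * \<alpha>))"
      by (subst sum.reindex) (auto simp: inj_on_def)
    also have "\<dots> \<le> (\<Sum>j<n. osc_bound Z (real j * \<alpha>))"
    proof (rule sum_mono2)
      show "(\<lambda>n'. n - n') ` {V<..n} \<subseteq> {..<n}" by auto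
    qed (simp_all add: osc_bound_nonneg Z)
    finally show ?thesis .
  qed
  have term_le: "real N / real n * (\<Sum>n'\<in>{V<..n}. osc_bound (real N / real n) (real (n - n') * \<alpha>))
     \<le> 8 * real N ^ 2 / real q * (1 / real n) + 16 * real N * l + 4 * real N ^ 2 * (1 / real n ^ 2) + 8 * real N * real q * l * (1 / real n)"
    if n: "n \<in> {V<..E}" for n
  proof -
    have n0: "n > 0" using n by simp
    have "(\<Sum>n'\<in>{V<..n}. osc_bound (real N / real n) (real (n - n') * \<alpha>)) \<le> (\<Sum>j<n. osc_bound (real N / real n) (real j * \<alpha>))"
      by (rule sub) simp
    also have "\<dots> \<le> (2 * real n / real q + 1) * (4 * (real N / real n) + 8 * real q * (1 + ln (real q)))"
      by (rule sum_osc_bound_le) simp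
    also have "\<dots> \<le> (2 * real n / real q + 1) * (4 * (real N / real n) + 8 * real q * l)"
      using l by (intro mult_left_mono add_left_mono) auto
    finally have "real N / real n * (\<Sum>n'\<in>{V<..n}. osc_bound (real N / real n) (real (n - n') * \<alpha>))
       \<le> real N / real n * ((2 * real n / real q + 1) * (4 * (real N / real n) + 8 * real q * l))"
      by (rule mult_left_mono) simp
    moreover have "real N / real n * ((2 * real n / real q + 1) * (4 * (real N / real n) + 8 * real q * l)) =
      8 * real N ^ 2 / real q * (1 / real n) + 16 * real N * l + 4 * real N ^ 2 * (1 / real n ^ 2) + 8 * real N * real q * l * (1 / real n)"
      using n0 q by (simp add: field_simps power2_eq_square)
    ultimately show ?thesis by linarith
  qed
  have S1: "(\<Sum>n\<in>{V<..E}. 1 / real n) \<le> l"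
  proof -
    have "(\<Sum>n\<in>{V<..E}. 1 / real n) \<le> (\<Sum>n=1..N. 1 / real n)"
      using EN by (intro sum_mono2) auto
    also have "\<dots> \<le> 1 + ln (real (max 1 N))" by (rule sum_inverse_le)
    also have "max 1 N = N" using N by simp
    finally show ?thesis using l(2) by linarith
  qed
  have S2: "(\<Sum>n\<in>{V<..E}. 1 / real n ^ 2) \<le> 1 / real V"
    using V by (intro sum_inverse_square_le) auto
  have S0: "real (card {V<..E}) \<le> real N / real U"
    using ENU by simp
  have "(\<Sum>n\<in>{V<..E}. real N / real n * (\<Sum>n'\<in>{V<..n}. osc_bound (real N / real n) (real (n - n') * \<alpha>)))
    \<le> (\<Sum>n\<in>{V<..E}. 8 * real N ^ 2 / real q * (1 / real n) + 16 * real N * l + 4 * real N ^ 2 * (1 / real n ^ 2) + 8 * real N * real q * l * (1 / real n))"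
    by (rule sum_mono) (rule term_le)
  also have "\<dots> = 8 * real N ^ 2 / real q * (\<Sum>n\<in>{V<..E}. 1 / real n) + 16 * real N * l * real (card {V<..E})
     + 4 * real N ^ 2 * (\<Sum>n\<in>{V<..E}. 1 / real n ^ 2) + 8 * real N * real q * l * (\<Sum>n\<in>{V<..E}. 1 / real n)"
    unfolding sum.distrib sum_distrib_left[symmetric] sum_constant by (simp add: mult.commute)
  also have "\<dots> \<le> 8 * real N ^ 2 / real q * l + 16 * real N * l * (real N / real U)
     + 4 * real N ^ 2 * (1 / real V) + 8 * real N * real q * l * l"
    using S1 S2 S0 l1 by (intro add_mono mult_left_mono) auto
  also have "\<dots> \<le> 16 * l ^ 2 * (real N ^ 2 / real q + real N ^ 2 / real U + real N ^ 2 / real V + real N * real q)"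
  proof -
    define A B C D where "A = real N ^ 2 / real q" and "B = real N ^ 2 / real U"
      and "C = real N ^ 2 / real V" and "D = real N * real q"
    have nn: "A \<ge> 0" "B \<ge> 0" "C \<ge> 0" "D \<ge> 0" by (simp_all add: A_def B_def C_def D_def)
    have ll: "l \<le> l ^ 2" "1 \<le> l ^ 2" using l1 one_le_power[OF l1, of 2] mult_left_mono[of 1 l l] by (simp_all add: power2_eq_square)
    have "A * l \<le> A * l ^ 2" "B * l \<le> B * l ^ 2" "C * 1 \<le> C * l ^ 2"
      using nn ll mult_left_mono[OF ll(2) nn(3)] by (auto intro!: mult_left_mono)
    moreover have "0 \<le> A * l ^ 2" "0 \<le> C * l ^ 2" "0 \<le> D * l ^ 2" using nn by auto
    moreover have "8 * real N ^ 2 / real q * l = 8 * (A * l)" by (simp add: A_def)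
    moreover have "16 * real N * l * (real N / real U) = 16 * (B * l)" by (simp add: B_def power2_eq_square)
    moreover have "4 * real N ^ 2 * (1 / real V) = 4 * (C * 1)" by (simp add: C_def)
    moreover have "8 * real N * real q * l * l = 8 * (D * l ^ 2)" by (simp add: D_def power2_eq_square)
    moreover have "16 * l ^ 2 * (A + B + C + D) = 16 * (A * l ^ 2) + 16 * (B * l ^ 2) + 16 * (C * l ^ 2) + 16 * (D * l ^ 2)"
      by (simp add: algebra_simps)
    ultimately show ?thesis unfolding A_def[symmetric] B_def[symmetric] C_def[symmetric] D_def[symmetric]
      by linarith
  qed
  finally show ?thesis .
qed

text \<open>
  Cauchy-Schwarz with the weights \<open>1 / d\<close> and \<open>d\<close> makes a dyadic decomposition of the range of \<open>d\<close> unnecessary.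
\<close>

lemma type_II_sum_le:
  assumes l: "1 + ln (real q) \<le> l" "1 + ln (real N) \<le> l" and U: "U \<ge> 1" and V: "V \<ge> 1" and N: "N \<ge> 1"
  shows "norm (\<Sum>d\<in>{U<..N}. \<Sum>m=1..N div d. (moebius_mu d * mangoldt_tail V m) *\<^sub>R \<phi> (d * m)) ^ 2
    \<le> 64 * l ^ 5 * (real N ^ 2 / real q + real N ^ 2 / real U + real N ^ 2 / real V + real N * real q)"
proof -
  define c where "c m = mangoldt_tail V m" for m
  define E where "E = N div U"
  define A where "A d = (\<Sum>m=1..N div d. c m *\<^sub>R \<phi> (d * m))" for d
  \<comment> \<open>An indicator for \<open>d * n \<le> N\<close> makes the ranges of
    \<open>d\<close> and \<open>n\<close> independent, so that after squaring the sums can be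
    interchanged.\<close>
  define b where "b d n = (if V < n \<and> d * n \<le> N then 1 else 0 :: real)" for d n
  let ?e = "\<lambda>d n n'. cis (2 * pi * (real d * ((real n - real n') * \<alpha>)))"
  let ?S = "\<lambda>n n'. \<Sum>d\<in>{U<..N}. (real d * (b d n * b d n')) *\<^sub>R ?e d n n'"
  have l1: "l \<ge> 1"
  proof -
    have "0 \<le> ln (real N)" using N by simp
    thus ?thesis using l(2) by linarith
  qed
  have c0: "c m \<ge> 0" for m by (simp add: c_def mangoldt_tail_nonneg)
  have cl: "c m \<le> l" if "m \<in> {V<..E}" for m
  proof -
    have m: "m > 0" "m \<le> N" using that by (auto simp: E_def intro: order_trans)
    have "c m \<le> ln (real m)" unfolding c_def using m by (intro mangoldt_tail_le)
    also have "\<dots> \<le> ln (real N)" using m by (intro ln_mono) auto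
    finally show ?thesis using l(2) by linarith
  qed
  have A_eq: "A d = (\<Sum>n\<in>{V<..E}. (b d n * c n) *\<^sub>R \<phi> (d * n))" if d: "d \<in> {U<..N}" for d
  proof -
    have dE: "N div d \<le> E" unfolding E_def using d U by (intro div_le_mono2) auto
    have iff: "n \<le> N div d \<longleftrightarrow> d * n \<le> N" for n
      using d by (simp add: less_eq_div_iff_mult_less_eq mult.commute)
    have "A d = (\<Sum>n\<in>{V<..N div d}. c n *\<^sub>R \<phi> (d * n))"
      unfolding A_def
    proof (rule sum.mono_neutral_right)
      show "\<forall>i\<in>{1..N div d} - {V<..N div d}. c i *\<^sub>R \<phi> (d * i) = 0"
      proof
        fix i assume "i \<in> {1..N div d} - {V<..N div d}"
        hence "i > 0" "i \<le> V" by auto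
        thus "c i *\<^sub>R \<phi> (d * i) = 0" by (simp add: c_def mangoldt_tail_eq_0)
      qed
    qed auto
    also have "\<dots> = (\<Sum>n\<in>{V<..E}. (b d n * c n) *\<^sub>R \<phi> (d * n))"
    proof (rule sum.mono_neutral_cong_left)
      show "{V<..N div d} \<subseteq> {V<..E}" using dE by auto
      show "\<forall>i\<in>{V<..E} - {V<..N div d}. (b d i * c i) *\<^sub>R \<phi> (d * i) = 0"
        by (auto simp: b_def iff)
      show "c x *\<^sub>R \<phi> (d * x) = (b d x * c x) *\<^sub>R \<phi> (d * x)" if "x \<in> {V<..N div d}" for x
        using that by (simp add: b_def iff)
    qed simp
    finally show ?thesis .
  qed
  have sq: "complex_of_real (norm (A d) ^ 2) =
      (\<Sum>n\<in>{V<..E}. \<Sum>n'\<in>{V<..E}. (c n * c n' * (b d n * b d n')) *\<^sub>R ?e d n n')"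
    if d: "d \<in> {U<..N}" for d
  proof -
    have "complex_of_real (norm (A d) ^ 2) = A d * cnj (A d)" by (rule complex_norm_square)
    also have "\<dots> = (\<Sum>n\<in>{V<..E}. \<Sum>n'\<in>{V<..E}. ((b d n * c n) *\<^sub>R \<phi> (d * n)) * ((b d n' * c n') *\<^sub>R cnj (\<phi> (d * n'))))"
      unfolding A_eq[OF d] by (simp add: sum_product)
    also have "\<dots> = (\<Sum>n\<in>{V<..E}. \<Sum>n'\<in>{V<..E}. (c n * c n' * (b d n * b d n')) *\<^sub>R ?e d n n')"
    proof (intro sum.cong refl)
      fix n n'
      have "\<phi> (d * n) * cnj (\<phi> (d * n')) = ?e d n n'"
        by (simp add: cis_cnj cis_mult algebra_simps)
      thus "((b d n * c n) *\<^sub>R \<phi> (d * n)) * ((b d n' * c n') *\<^sub>R cnj (\<phi> (d * n'))) =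
         (c n * c n' * (b d n * b d n')) *\<^sub>R ?e d n n'"
        by (simp only: mult_scaleR_left mult_scaleR_right scaleR_scaleR) (simp add: mult_ac)
    qed
    finally show ?thesis .
  qed
  define F where "F n n' = real N / real n * osc_bound (real N / real n) (real (n - n') * \<alpha>)" for n n' :: nat
  have F0: "F n n' \<ge> 0" for n n' unfolding F_def by (simp add: osc_bound_nonneg)
  \<comment> \<open>As \<open>n' \<le> n\<close>, the two indicators together say
    \<open>d \<le> N div n\<close>. The weight \<open>d\<close> from Cauchy-Schwarz is increasing,
    so partial summation leaves a geometric sum with frequency \<open>(n - n') * \<alpha>\<close> at
    the cost of a factor of order \<open>N / n\<close>.\<close>
  have inner: "norm (?S n n') \<le> 2 * F n n'"
    if n: "n \<in> {V<..E}" "n' \<in> {V<..E}" "n' \<le> n" for n n'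
  proof -
    define \<theta> where "\<theta> = (real n - real n') * \<alpha>"
    define Y where "Y = N div n"
    \<comment> \<open>Replacing the terms up to \<open>U\<close> by 0 lets the sum start at 1, as
      partial summation requires.\<close>
    define e where "e d = (if U < d then cis (2 * pi * (real d * \<theta>)) else 0)" for d
    have n0: "n > 0" using n by simp
    have YN: "real Y \<le> real N / real n" unfolding Y_def by (rule of_nat_div_le_of_nat)
    have Y_iff: "d \<le> Y \<longleftrightarrow> d * n \<le> N" for d
      using n0 by (simp add: Y_def less_eq_div_iff_mult_less_eq)
    have bb: "b d n * b d n' = (if d \<le> Y then 1 else 0)" for d
    proof -
      have "d * n' \<le> d * n" using n by simp
      hence "d * n' \<le> N" if "d * n \<le> N" using that by (rule order_trans)
      thus ?thesis using n unfolding Y_iff b_def by auto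
    qed
    have "Y \<le> N" by (simp add: Y_def)
    have "(\<Sum>d\<in>{U<..N}. (real d * (b d n * b d n')) *\<^sub>R cis (2 * pi * (real d * \<theta>))) = (\<Sum>d=1..Y. real d *\<^sub>R e d)"
    proof (rule sum.mono_neutral_cong)
      show "(real i * (b i n * b i n')) *\<^sub>R cis (2 * pi * (real i * \<theta>)) = 0" if "i \<in> {U<..N} - {1..Y}" for i
        using that by (auto simp: bb)
      show "real i *\<^sub>R e i = 0" if "i \<in> {1..Y} - {U<..N}" for i
        using that \<open>Y \<le> N\<close> by (auto simp: e_def)
      show "(real x * (b x n * b x n')) *\<^sub>R cis (2 * pi * (real x * \<theta>)) = real x *\<^sub>R e x" if "x \<in> {U<..N} \<inter> {1..Y}" for x
        using that by (auto simp: e_def bb)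
    qed auto
    also have "norm \<dots> \<le> 2 * (real N / real n) * osc_bound (real N / real n) \<theta>"
    proof (rule norm_weighted_sum_le)
      fix j assume j: "j \<le> Y"
      have "(\<Sum>m=1..j. e m) = (\<Sum>m\<in>{U<..j}. cis (2 * pi * (real m * \<theta>)))"
        by (rule sum.mono_neutral_cong_right) (auto simp: e_def)
      also have "norm \<dots> \<le> osc_bound (real N / real n) \<theta>"
      proof (rule norm_exponential_sum_le)
        have "real j \<le> real Y" using j by simp
        thus "real j - real U \<le> real N / real n" using YN by linarith
      qed simp
      finally show "norm (\<Sum>m=1..j. e m) \<le> osc_bound (real N / real n) \<theta>" .
    next
      fix m assume "m \<le> Y"
      hence "real m \<le> real Y" by simp
      thus "0 \<le> real m \<and> real m \<le> real N / real n" using YN by simp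
    qed auto
    finally show ?thesis using osc_bound_diff(1)[OF n(3)] by (simp add: F_def \<theta>_def mult.assoc)
  qed
  define I where "I n n' = norm (?S n n')" for n n'
  have I_sym: "I n n' = I n' n" for n n'
  proof -
    have "I n n' = norm (cnj (?S n n'))"
      unfolding I_def complex_mod_cnj ..
    also have "cnj (?S n n') =
       (\<Sum>d\<in>{U<..N}. (real d * (b d n' * b d n)) *\<^sub>R cis (2 * pi * (real d * ((real n' - real n) * \<alpha>))))"
      unfolding cnj_sum
    proof (intro sum.cong refl)
      fix d
      have "- (2 * pi * (real d * ((real n - real n') * \<alpha>))) = 2 * pi * (real d * ((real n' - real n) * \<alpha>))"
        by (simp add: algebra_simps)
      thus "cnj ((real d * (b d n * b d n')) *\<^sub>R ?e d n n') =
        (real d * (b d n' * b d n)) *\<^sub>R cis (2 * pi * (real d * ((real n' - real n) * \<alpha>)))"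
        by (simp only: complex_cnj_scaleR cis_cnj mult.commute[of "b d n'" "b d n"])
    qed
    finally show ?thesis by (simp add: I_def)
  qed
  \<comment> \<open>The diagonal is counted in both summands, which is harmless for an upper bound
    and keeps the two double sums symmetric.\<close>
  have I_le: "I n n' \<le> (if n' \<le> n then 2 * F n n' else 0) + (if n \<le> n' then 2 * F n' n else 0)"
    if "n \<in> {V<..E}" "n' \<in> {V<..E}" for n n'
  proof (cases "n' \<le> n")
    case True
    have "I n n' \<le> 2 * F n n'" unfolding I_def by (rule inner) (use that True in auto)
    moreover have "0 \<le> (if n \<le> n' then 2 * F n' n else 0)" by (simp add: F0)
    ultimately show ?thesis using True by simp
  next
    case False
    hence "n \<le> n'" by simp
    have "I n' n \<le> 2 * F n' n" unfolding I_def by (rule inner) (use that False in auto)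
    thus ?thesis using False I_sym[of n n'] by simp
  qed
  define S where "S = (\<Sum>n\<in>{V<..E}. \<Sum>n'\<in>{V<..n}. F n n')"
  have S_le: "S \<le> 16 * l ^ 2 * (real N ^ 2 / real q + real N ^ 2 / real U + real N ^ 2 / real V + real N * real q)"
    unfolding S_def F_def sum_distrib_left[symmetric] E_def by (rule type_II_inner_le[OF l U V N])
  have half: "(\<Sum>n\<in>{V<..E}. \<Sum>n'\<in>{V<..E}. if n' \<le> n then 2 * F n n' else 0) = 2 * S"
  proof -
    have "(\<Sum>n'\<in>{V<..E}. if n' \<le> n then 2 * F n n' else 0) = 2 * (\<Sum>n'\<in>{V<..n}. F n n')" if "n \<in> {V<..E}" for n
      unfolding sum_distrib_left using that by (intro sum.mono_neutral_cong_right) auto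
    hence "(\<Sum>n\<in>{V<..E}. \<Sum>n'\<in>{V<..E}. if n' \<le> n then 2 * F n n' else 0) = (\<Sum>n\<in>{V<..E}. 2 * (\<Sum>n'\<in>{V<..n}. F n n'))"
      by (rule sum.cong[OF refl])
    thus ?thesis by (simp add: S_def sum_distrib_left)
  qed
  have sumI: "(\<Sum>n\<in>{V<..E}. \<Sum>n'\<in>{V<..E}. I n n') \<le> 4 * S"
  proof -
    have "(\<Sum>n\<in>{V<..E}. \<Sum>n'\<in>{V<..E}. I n n') \<le>
      (\<Sum>n\<in>{V<..E}. \<Sum>n'\<in>{V<..E}. (if n' \<le> n then 2 * F n n' else 0) + (if n \<le> n' then 2 * F n' n else 0))"
      by (intro sum_mono I_le)
    also have "\<dots> = (\<Sum>n\<in>{V<..E}. \<Sum>n'\<in>{V<..E}. if n' \<le> n then 2 * F n n' else 0) +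
        (\<Sum>n\<in>{V<..E}. \<Sum>n'\<in>{V<..E}. if n \<le> n' then 2 * F n' n else 0)"
      by (simp only: sum.distrib)
    also have "(\<Sum>n\<in>{V<..E}. \<Sum>n'\<in>{V<..E}. if n \<le> n' then 2 * F n' n else 0) =
        (\<Sum>n\<in>{V<..E}. \<Sum>n'\<in>{V<..E}. if n' \<le> n then 2 * F n n' else 0)"
      by (rule sum.swap)
    finally show ?thesis unfolding half by simp
  qed
  have second: "(\<Sum>d\<in>{U<..N}. real d * norm (A d) ^ 2) \<le> l ^ 2 * (4 * S)"
  proof -
    have "complex_of_real (\<Sum>d\<in>{U<..N}. real d * norm (A d) ^ 2) = (\<Sum>d\<in>{U<..N}. real d *\<^sub>R complex_of_real (norm (A d) ^ 2))"
      by (simp add: scaleR_conv_of_real)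
    also have "\<dots> = (\<Sum>d\<in>{U<..N}. \<Sum>n\<in>{V<..E}. \<Sum>n'\<in>{V<..E}. (c n * c n') *\<^sub>R ((real d * (b d n * b d n')) *\<^sub>R ?e d n n'))"
      by (intro sum.cong refl, subst sq) (simp_all only: scaleR_sum_right scaleR_scaleR mult_ac)
    also have "\<dots> = (\<Sum>n\<in>{V<..E}. \<Sum>d\<in>{U<..N}. \<Sum>n'\<in>{V<..E}. (c n * c n') *\<^sub>R ((real d * (b d n * b d n')) *\<^sub>R ?e d n n'))"
      by (rule sum.swap)
    also have "\<dots> = (\<Sum>n\<in>{V<..E}. \<Sum>n'\<in>{V<..E}. (c n * c n') *\<^sub>R (?S n n'))"
      unfolding scaleR_sum_right by (intro sum.cong refl sum.swap)
    finally have eq: "complex_of_real (\<Sum>d\<in>{U<..N}. real d * norm (A d) ^ 2) = \<dots>" .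
    have "(\<Sum>d\<in>{U<..N}. real d * norm (A d) ^ 2) \<le> norm (complex_of_real (\<Sum>d\<in>{U<..N}. real d * norm (A d) ^ 2))"
      unfolding norm_of_real by (rule abs_ge_self)
    also have "\<dots> \<le> (\<Sum>n\<in>{V<..E}. \<Sum>n'\<in>{V<..E}. l ^ 2 * I n n')"
      unfolding eq
    proof (rule order_trans[OF norm_sum sum_mono])
      fix n assume n: "n \<in> {V<..E}"
      show "norm (\<Sum>n'\<in>{V<..E}. (c n * c n') *\<^sub>R (?S n n'))
        \<le> (\<Sum>n'\<in>{V<..E}. l ^ 2 * I n n')"
      proof (rule order_trans[OF norm_sum sum_mono])
        fix n' assume n': "n' \<in> {V<..E}"
        have "c n * c n' \<le> l * l" using cl[OF n] cl[OF n'] c0 l1 by (intro mult_mono) auto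
        moreover have "norm ((c n * c n') *\<^sub>R (?S n n')) = c n * c n' * I n n'"
          unfolding norm_scaleR I_def abs_of_nonneg[OF mult_nonneg_nonneg[OF c0 c0]] ..
        moreover have "c n * c n' * I n n' \<le> l ^ 2 * I n n'" if "c n * c n' \<le> l * l"
          using that by (simp add: power2_eq_square mult_right_mono I_def)
        ultimately show "norm ((c n * c n') *\<^sub>R (?S n n')) \<le> l ^ 2 * I n n'"
          by simp
      qed
    qed
    also have "\<dots> = l ^ 2 * (\<Sum>n\<in>{V<..E}. \<Sum>n'\<in>{V<..E}. I n n')" by (simp add: sum_distrib_left)
    also have "\<dots> \<le> l ^ 2 * (4 * S)" by (rule mult_left_mono[OF sumI]) simp
    finally show ?thesis .
  qed
  have first: "(\<Sum>d\<in>{U<..N}. 1 / real d) \<le> l"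
  proof -
    have "(\<Sum>d\<in>{U<..N}. 1 / real d) \<le> (\<Sum>d=1..N. 1 / real d)" by (intro sum_mono2) auto
    also have "\<dots> \<le> 1 + ln (real (max 1 N))" by (rule sum_inverse_le)
    also have "max 1 N = N" using N by simp
    finally show ?thesis using l(2) by linarith
  qed
  have "norm (\<Sum>d\<in>{U<..N}. \<Sum>m=1..N div d. (moebius_mu d * mangoldt_tail V m) *\<^sub>R \<phi> (d * m)) \<le> (\<Sum>d\<in>{U<..N}. norm (A d))"
  proof (rule order_trans[OF norm_sum sum_mono])
    fix d assume "d \<in> {U<..N}"
    have "(\<Sum>m=1..N div d. (moebius_mu d * mangoldt_tail V m) *\<^sub>R \<phi> (d * m)) = moebius_mu d *\<^sub>R A d"
      by (simp add: A_def c_def scaleR_sum_right)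
    hence "norm (\<Sum>m=1..N div d. (moebius_mu d * mangoldt_tail V m) *\<^sub>R \<phi> (d * m)) = \<bar>moebius_mu d\<bar> * norm (A d)" by simp
    also have "\<dots> \<le> 1 * norm (A d)" using abs_moebius_mu_le by (intro mult_right_mono) auto
    finally show "norm (\<Sum>m=1..N div d. (moebius_mu d * mangoldt_tail V m) *\<^sub>R \<phi> (d * m)) \<le> norm (A d)" by simp
  qed
  hence "norm (\<Sum>d\<in>{U<..N}. \<Sum>m=1..N div d. (moebius_mu d * mangoldt_tail V m) *\<^sub>R \<phi> (d * m)) ^ 2 \<le> (\<Sum>d\<in>{U<..N}. norm (A d)) ^ 2"
    by (rule power_mono) simp
  also have "\<dots> = (\<Sum>d\<in>{U<..N}. (1 / sqrt (real d)) * (sqrt (real d) * norm (A d))) ^ 2"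
    by (intro arg_cong[where f = "\<lambda>x. x ^ 2"] sum.cong) auto
  also have "\<dots> \<le> (\<Sum>d\<in>{U<..N}. (1 / sqrt (real d)) ^ 2) * (\<Sum>d\<in>{U<..N}. (sqrt (real d) * norm (A d)) ^ 2)"
    by (rule Cauchy_Schwarz_ineq_sum)
  also have "\<dots> = (\<Sum>d\<in>{U<..N}. 1 / real d) * (\<Sum>d\<in>{U<..N}. real d * norm (A d) ^ 2)"
    by (simp add: power_divide power_mult_distrib)
  also have "\<dots> \<le> l * (l ^ 2 * (4 * S))"
    by (rule mult_mono[OF first second]) (use l1 in \<open>auto intro!: sum_nonneg\<close>)
  also have "\<dots> \<le> l * (l ^ 2 * (4 * (16 * l ^ 2 * (real N ^ 2 / real q + real N ^ 2 / real U + real N ^ 2 / real V + real N * real q))))"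
    using l1 S_le by (intro mult_left_mono) auto
  also have "\<dots> = 64 * l ^ 5 * (real N ^ 2 / real q + real N ^ 2 / real U + real N ^ 2 / real V + real N * real q)"
    by (simp add: eval_nat_numeral)
  finally show ?thesis .
qed

end

section \<open>The exponential sum over the von Mangoldt function\<close>

text \<open>Vaughan's identity with \<open>V = U\<close>; the terms \<open>n \<le> U\<close> are
  estimated trivially. The \<open>l ^ 5\<close> of the type II bound is raised to
  \<open>l ^ 6\<close> so that its square root is a power of \<open>l\<close>.\<close>

lemma (in rational_approx) mangoldt_sum_le:
  assumes l: "1 + ln (real q) \<le> l" "1 + ln (real N) \<le> l" and U: "U \<ge> 1" "U * U \<le> N"
  shows "norm (\<Sum>n=1..N. mangoldt n *\<^sub>R \<phi> n) \<le>
    l * real U + 96 * l ^ 2 * (real q + real N / real q + real U ^ 2)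
     + 8 * l ^ 3 * sqrt (real N ^ 2 / real q + 2 * (real N ^ 2 / real U) + real N * real q)"
proof -
  have N: "N \<ge> 1" "U \<le> N"
  proof -
    have "U \<le> U * U" using U(1) by simp
    thus "U \<le> N" using U(2) by (rule order_trans)
    thus "N \<ge> 1" using U(1) by simp
  qed
  have l1: "l \<ge> 1"
  proof -
    have "0 \<le> ln (real N)" using N by simp
    thus ?thesis using l(2) by linarith
  qed
  define X where "X = real N ^ 2 / real q + 2 * (real N ^ 2 / real U) + real N * real q"
  define S where "S n = mangoldt n *\<^sub>R \<phi> n" for n
  define T where "T d = (\<Sum>m=1..N div d. (moebius_mu d * mangoldt_tail U m) *\<^sub>R \<phi> (d * m))" for d
  have X0: "X \<ge> 0" by (simp add: X_def)
  have dis: "{1..N} = {1..U} \<union> {U<..N}" "{1..U} \<inter> {U<..N} = {}" using N U by auto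
  have split: "(\<Sum>n=1..N. f n) = (\<Sum>n=1..U. f n) + (\<Sum>n\<in>{U<..N}. f n)" for f :: "nat \<Rightarrow> complex"
    unfolding dis(1) by (rule sum.union_disjoint) (use dis(2) in auto)
  have "(\<Sum>n\<in>{U<..N}. S n) = (\<Sum>n=1..N. (if U < n then mangoldt n else 0) *\<^sub>R \<phi> n)"
    unfolding S_def by (rule sum.mono_neutral_cong_left) auto
  also have "\<dots> = (\<Sum>d=1..N. T d)" unfolding T_def by (rule vaughan_identity)
  also have "\<dots> = (\<Sum>d=1..U. T d) + (\<Sum>d\<in>{U<..N}. T d)" by (rule split)
  finally have "(\<Sum>n=1..N. S n) = (\<Sum>n=1..U. S n) + ((\<Sum>d=1..U. T d) + (\<Sum>d\<in>{U<..N}. T d))"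
    unfolding split[of S] by simp
  hence "norm (\<Sum>n=1..N. S n) \<le> norm (\<Sum>n=1..U. S n) + (norm (\<Sum>d=1..U. T d) + norm (\<Sum>d\<in>{U<..N}. T d))"
    by (simp only: order_trans[OF norm_triangle_ineq add_left_mono[OF norm_triangle_ineq]])
  moreover have "norm (\<Sum>n=1..U. S n) \<le> l * real U"
  proof -
    have "norm (\<Sum>n=1..U. S n) \<le> (\<Sum>n=1..U. l)"
    proof (rule order_trans[OF norm_sum sum_mono])
      fix n assume n: "n \<in> {1..U}"
      have "norm (S n) = mangoldt n" by (simp add: S_def mangoldt_nonneg)
      also have "\<dots> \<le> ln (real n)" using n by (intro mangoldt_le) auto
      also have "\<dots> \<le> ln (real N)" using n N by (intro ln_mono) auto
      finally show "norm (S n) \<le> l" using l(2) by linarith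
    qed
    thus ?thesis by (simp add: mult.commute)
  qed
  moreover have "norm (\<Sum>d=1..U. T d) \<le> 96 * l ^ 2 * (real q + real N / real q + real U ^ 2)"
    using type_I_sum_le[OF U(1) U(1) U(2) l] by (simp add: T_def power2_eq_square)
  moreover have "norm (\<Sum>d\<in>{U<..N}. T d) \<le> 8 * l ^ 3 * sqrt X"
  proof (rule power2_le_imp_le)
    have "norm (\<Sum>d\<in>{U<..N}. T d) ^ 2 \<le> 64 * l ^ 5 * X"
    proof -
      have X: "real N ^ 2 / real q + real N ^ 2 / real U + real N ^ 2 / real U + real N * real q = X"
        by (simp add: X_def)
      show ?thesis using type_II_sum_le[OF l U(1) U(1) N(1)] unfolding X T_def .
    qed
    also have "\<dots> \<le> 64 * l ^ 6 * X"
      using l1 X0 by (intro mult_right_mono mult_left_mono power_increasing) auto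
    also have "\<dots> = (8 * l ^ 3 * sqrt X) ^ 2" using X0 by (simp add: power_mult_distrib)
    finally show "norm (\<Sum>d\<in>{U<..N}. T d) ^ 2 \<le> (8 * l ^ 3 * sqrt X) ^ 2" .
    show "0 \<le> 8 * l ^ 3 * sqrt X" using l1 X0 by simp
  qed
  ultimately show ?thesis unfolding S_def X_def by linarith
qed

text \<open>Dirichlet's theorem with bound \<open>N / l\<close>, where
  \<open>l = (1 + ln N) ^ 8\<close>, yields the upper bound for \<open>q\<close>. If
  \<open>q < l\<close>, take \<open>u = q * h - a\<close> and \<open>v = a\<close>: because of
  \<open>ln 10 = ln 2 + ln 5\<close> the form \<open>u * ln 2 - v * ln 5\<close> equals
  \<open>(q * \<theta> - a) * ln 10\<close>, which is \<open>O(l / N)\<close>, while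
  \<open>u \<le> h * l\<close>.\<close>

lemma rational_approx_intermediate_denominator:
  fixes h :: nat
  assumes h: "h \<ge> 1"
  shows "eventually (\<lambda>N. \<exists>a q. rational_approx (real h * log 10 2) a q \<and>
     (1 + ln (real N)) ^ 8 \<le> real q \<and> real q \<le> real N / (1 + ln (real N)) ^ 8) at_top"
proof -
  obtain c C where cC: "c > 0" "C > 0"
    "\<And>u v. u \<ge> 1 \<Longrightarrow> \<bar>real u * ln 2 - real v * ln 5\<bar> \<ge> c * exp (- C * ln (real u + 1) ^ 2)"
    using linear_form_lower_bound by blast
  define H where "H = real h"
  have H: "H > 0" using h by (simp add: H_def)
  \<comment> \<open>The right side decays like \<open>exp\<close> of a multiple of
    \<open>- (ln ln N) ^ 2\<close>, hence more slowly than any negative power of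
    \<open>N\<close>.\<close>
  have "eventually (\<lambda>N. 6 * (1 + ln (real N)) ^ 8 / real N < c * exp (- C * ln (H * (1 + ln (real N)) ^ 8 + 1) ^ 2)) at_top"
    using cC(1,2) H by real_asymp
  moreover have "eventually (\<lambda>N. real N / (1 + ln (real N)) ^ 8 \<ge> 6) at_top" by real_asymp
  moreover have "eventually (\<lambda>N::nat. N \<ge> 1) at_top" by (rule eventually_ge_at_top)
  ultimately show ?thesis
  proof eventually_elim
    case (elim N)
    define l where "l = (1 + ln (real N)) ^ 8"
    define \<theta> where "\<theta> = H * log 10 2"
    have l1: "l \<ge> 1" unfolding l_def using elim(3) by (intro one_le_power) auto
    define Q where "Q = nat \<lfloor>real N / l\<rfloor>"
    have Q: "real Q \<le> real N / l" "real N / l \<le> 2 * real Q" "real Q \<ge> 5"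
      using elim(2) unfolding Q_def l_def[symmetric] by linarith+
    obtain a k where ak: "coprime a k" "0 < k" "k \<le> int Q" "\<bar>of_int k * \<theta> - of_int a\<bar> < 1 / real Q"
    proof (rule Dirichlet_approx_coprime[of Q \<theta>])
      show "0 < Q" using Q(3) by linarith
    qed
    define q where "q = nat k"
    have q: "q > 0" "int q = k" "real q = of_int k" "real q \<le> real Q" using ak by (auto simp: q_def)
    have ra: "rational_approx \<theta> a q"
    proof
      show "q > 0" by (rule q(1))
      show "coprime a (int q)" unfolding q(2) by (rule ak(1))
      have "\<theta> - of_int a / real q = (real q * \<theta> - of_int a) / real q" using q(1) by (simp add: field_simps)
      hence "\<bar>\<theta> - of_int a / real q\<bar> = \<bar>real q * \<theta> - of_int a\<bar> / real q" by simp
      also have "\<dots> \<le> (1 / real Q) / real q" using ak(4) q(3) by (intro divide_right_mono) auto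
      also have "\<dots> \<le> (1 / real q) / real q" using q Q(3) by (intro divide_right_mono divide_left_mono) auto
      finally show "\<bar>\<theta> - of_int a / real q\<bar> \<le> 1 / real q ^ 2" by (simp add: power2_eq_square)
    qed
    have "l \<le> real q"
    proof (rule ccontr)
      assume "\<not> l \<le> real q"
      hence ql: "real q < l" by simp
      have ln10: "ln 10 = ln 2 + ln (5::real)" using ln_mult[of 2 5] by simp
      have ln2: "0 < ln (2::real)" by simp
      have l5: "1 \<le> ln (5::real)" using exp_le by (subst ln_ge_iff) auto
      have l10: "ln 10 \<le> (3::real)"
      proof -
        have "ln (10::real) \<le> ln (2 ^ 4)" by (intro ln_mono) auto
        also have "\<dots> = 4 * ln 2" by (subst ln_realpow) auto
        finally show ?thesis using ln2_le_25_over_36 by linarith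
      qed
      have l10p: "0 < ln (10::real)" by simp
      have "1 / real Q \<le> 1 / 5" using Q(3) by (intro divide_left_mono) auto
      hence d1: "\<bar>real q * \<theta> - of_int a\<bar> < 1/5" using ak(4) q(3) by simp
      have th: "\<theta> * ln 10 = H * ln 2" by (simp add: \<theta>_def log_def)
      have th0: "0 \<le> \<theta>" using H by (simp add: \<theta>_def)
      have th1: "\<theta> \<le> H"
      proof -
        have "\<theta> * ln 10 \<le> H * ln 10" unfolding th using H l5 ln10 by (intro mult_left_mono) auto
        thus ?thesis using l10p by simp
      qed
      have "0 \<le> real q * \<theta>" using th0 by simp
      hence a0: "a \<ge> 0" using d1 by linarith
      have "real q * \<theta> \<le> real q * H" using th1 by (intro mult_left_mono) auto
      hence "of_int a < real (q * h) + 1" using d1 unfolding H_def of_nat_mult by linarith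
      hence au: "a \<le> int (q * h)" by linarith
      define u where "u = nat (int (q * h) - a)"
      define v where "v = nat a"
      have uv: "real u = real q * H - of_int a" "real v = of_int a"
        using a0 au by (auto simp: u_def v_def H_def of_nat_nat)
      have form: "real u * ln 2 - real v * ln 5 = (real q * \<theta> - of_int a) * ln 10"
      proof -
        have "(real q * \<theta> - of_int a) * ln 10 = real q * (\<theta> * ln 10) - of_int a * ln 10"
          by (simp add: algebra_simps)
        also have "\<dots> = real u * ln 2 - real v * ln 5"
          unfolding th unfolding ln10 uv by (simp add: algebra_simps)
        finally show ?thesis by simp
      qed
      have up: "\<bar>real u * ln 2 - real v * ln 5\<bar> \<le> 3 / real Q"
      proof -
        have "\<bar>real u * ln 2 - real v * ln 5\<bar> = \<bar>real q * \<theta> - of_int a\<bar> * ln 10"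
          unfolding form by (simp add: abs_mult)
        also have "\<dots> \<le> 1 / real Q * 3" using ak(4) q(3) l10 by (intro mult_mono) auto
        finally show ?thesis by simp
      qed
      have "3 / real Q \<le> 3 / 5" using Q(3) by (intro divide_left_mono) auto
      hence up1: "\<bar>real u * ln 2 - real v * ln 5\<bar> < 1" using up by linarith
      \<comment> \<open>For \<open>u = 0\<close> the form would be \<open>- v * ln 5\<close> with
        \<open>v = q * h >= 1\<close>, of absolute value at least 1.\<close>
      have u1: "u \<ge> 1"
      proof (rule ccontr)
        assume "\<not> u \<ge> 1"
        hence u0: "u = 0" by simp
        hence "of_int a = real q * H" using uv by simp
        hence "real v = real (q * h)" using uv by (simp add: H_def)
        moreover have "q * h \<ge> 1" using q(1) h by simp
        ultimately have "real v \<ge> 1" by linarith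
        hence "1 * 1 \<le> real v * ln 5" using l5 by (intro mult_mono) auto
        thus False using up1 u0 by simp
      qed
      have "u \<le> q * h" using a0 unfolding u_def by (simp add: nat_le_iff)
      hence "real u \<le> real q * H" unfolding H_def of_nat_mult[symmetric] by (simp only: of_nat_le_iff)
      also have "\<dots> \<le> H * l" using ql H by simp
      finally have "real u + 1 \<le> H * l + 1" by simp
      hence "ln (real u + 1) \<le> ln (H * l + 1)" by (intro ln_mono) auto
      hence "ln (real u + 1) ^ 2 \<le> ln (H * l + 1) ^ 2" by (intro power_mono) auto
      hence "exp (- C * ln (H * l + 1) ^ 2) \<le> exp (- C * ln (real u + 1) ^ 2)" using cC(2) by simp
      hence "c * exp (- C * ln (H * l + 1) ^ 2) \<le> c * exp (- C * ln (real u + 1) ^ 2)"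
        using cC(1) by simp
      also have "\<dots> \<le> 3 / real Q" using cC(3)[OF u1] up by (rule order_trans)
      \<comment> \<open>The 6 in the comparison is composed of \<open>ln 10 \<le> 3\<close> and of a
        factor 2 for rounding \<open>N / l\<close> down to \<open>Q\<close>.\<close>
      also have "\<dots> \<le> 3 / (real N / l / 2)"
        using Q elim(2,3) l1 by (intro divide_left_mono) auto
      also have "\<dots> = 6 * l / real N" by simp
      finally show False using elim(1) unfolding l_def by linarith
    qed
    moreover have "real q \<le> real N / l" using q(4) Q(1) by linarith
    ultimately show ?case using ra unfolding l_def \<theta>_def H_def by blast
  qed
qed

text \<open>With \<open>l = 1 + ln N\<close> and \<open>U\<close> about \<open>l ^ 8\<close>, the
  type II term \<open>8 * l ^ 3 * (2 * N / l ^ 4) = 16 * N / l\<close> dominates. An exponent above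
  6 would do; 8 turns the square root into the power \<open>l ^ 4\<close>.\<close>

theorem mangoldt_exponential_sum_tendsto_0:
  fixes h :: nat
  assumes h: "h \<ge> 1"
  shows "(\<lambda>N. norm (\<Sum>n=1..N. mangoldt n *\<^sub>R cis (2 * pi * (real n * (real h * log 10 2)))) / real N) \<longlonglongrightarrow> 0"
proof (rule tendsto_sandwich[of "\<lambda>_. 0"])
  define B where "B N = (let l = 1 + ln (real N) in
    (2 * l ^ 9 + 96 * l ^ 2 * (2 * (real N / l ^ 8) + 4 * l ^ 16) + 16 * real N / l) / real N)" for N
  show "B \<longlonglongrightarrow> 0" unfolding B_def Let_def by real_asymp
  have ev: "eventually (\<lambda>N. 4 * (1 + ln (real N)) ^ 16 \<le> real N) at_top" by real_asymp
  show "eventually (\<lambda>N. norm (\<Sum>n=1..N. mangoldt n *\<^sub>R cis (2 * pi * (real n * (real h * log 10 2)))) / real N \<le> B N) at_top"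
    using rational_approx_intermediate_denominator[OF h] ev eventually_ge_at_top[of 1]
  proof eventually_elim
    case (elim N)
    define l where "l = 1 + ln (real N)"
    obtain a q where ra: "rational_approx (real h * log 10 2) a q"
      and qb: "l ^ 8 \<le> real q" "real q \<le> real N / l ^ 8"
      using elim(1) unfolding l_def by blast
    interpret rational_approx "real h * log 10 2" a q by (rule ra)
    have l1: "l \<ge> 1" using elim(3) by (simp add: l_def)
    have l8: "l ^ 8 \<ge> 1" using l1 by (rule one_le_power)
    define U where "U = nat \<lceil>l ^ 8\<rceil>"
    have U: "l ^ 8 \<le> real U" "real U \<le> 2 * l ^ 8" "U \<ge> 1"
      using l8 unfolding U_def by linarith+
    have UU: "real U ^ 2 \<le> 4 * l ^ 16"
      using power_mono[OF U(2), of 2] by (simp add: power_mult_distrib)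
    hence "real (U * U) \<le> real N" using elim(2) unfolding l_def by (simp add: power2_eq_square)
    hence UN: "U * U \<le> N" by (simp only: of_nat_le_iff)
    have q0: "real q > 0" using qb l8 by linarith
    have "real N / l ^ 8 \<le> real N / 1" using l8 by (intro divide_left_mono) auto
    hence "real q \<le> real N" using qb(2) by linarith
    hence lq: "1 + ln (real q) \<le> l" using q0 by (simp add: l_def)
    have Nq: "real N / real q \<le> real N / l ^ 8" using qb l8 q0 by (intro divide_left_mono mult_pos_pos) auto
    have sq: "sqrt (real N ^ 2 / real q + 2 * (real N ^ 2 / real U) + real N * real q) \<le> 2 * (real N / l ^ 4)"
    proof (rule real_le_lsqrt)
      have "real N ^ 2 / real q \<le> real N ^ 2 / l ^ 8" using qb l8 q0 by (intro divide_left_mono mult_pos_pos) auto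
      moreover have "real N ^ 2 / real U \<le> real N ^ 2 / l ^ 8" using U l8 by (intro divide_left_mono mult_pos_pos) auto
      moreover have "real N * real q \<le> real N * (real N / l ^ 8)" using qb by (intro mult_left_mono) auto
      moreover have "real N * (real N / l ^ 8) = real N ^ 2 / l ^ 8" by (simp add: power2_eq_square)
      moreover have "(2 * (real N / l ^ 4)) ^ 2 = 4 * (real N ^ 2 / l ^ 8)"
        by (simp add: power_mult_distrib power_divide)
      ultimately show "real N ^ 2 / real q + 2 * (real N ^ 2 / real U) + real N * real q \<le> (2 * (real N / l ^ 4)) ^ 2"
        by linarith
    qed (use l1 in auto)
    have "norm (\<Sum>n=1..N. mangoldt n *\<^sub>R \<phi> n) \<le>
      l * real U + 96 * l ^ 2 * (real q + real N / real q + real U ^ 2)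
     + 8 * l ^ 3 * sqrt (real N ^ 2 / real q + 2 * (real N ^ 2 / real U) + real N * real q)"
      using lq U(3) UN by (intro mangoldt_sum_le) (auto simp: l_def)
    also have "\<dots> \<le> l * (2 * l ^ 8) + 96 * l ^ 2 * (real N / l ^ 8 + real N / l ^ 8 + 4 * l ^ 16)
     + 8 * l ^ 3 * (2 * (real N / l ^ 4))"
      using U(2) UU qb(2) Nq sq l1 by (intro add_mono mult_left_mono) auto
    also have "\<dots> = 2 * l ^ 9 + 96 * l ^ 2 * (2 * (real N / l ^ 8) + 4 * l ^ 16) + 16 * real N / l"
    proof -
      have "8 * l ^ 3 * (2 * (real N / l ^ 4)) = 16 * real N / l"
      proof -
        have "l ^ 4 = l ^ 3 * l" by (simp add: eval_nat_numeral)
        thus ?thesis using l1 by simp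
      qed
      moreover have "l * (2 * l ^ 8) = 2 * l ^ 9" by (simp add: eval_nat_numeral)
      ultimately show ?thesis by simp
    qed
    finally show ?case
      unfolding B_def Let_def l_def[symmetric] by (rule divide_right_mono) simp
  qed
qed auto

section \<open>Weyl's criterion\<close>

text \<open>This expresses the distance to the nearest integer through the cosine, so that a bump
  around \<open>m\<close> is a continuous function of \<open>cos (2 * pi * (t - m))\<close>.\<close>

lemma arccos_cos_round:
  fixes s :: real
  shows "arccos (cos (2 * pi * s)) = 2 * pi * \<bar>s - of_int (round s)\<bar>"
proof -
  define r where "r = s - of_int (round s)"
  have r: "\<bar>r\<bar> \<le> 1/2" unfolding r_def using of_int_round_abs_le[of s] by (simp add: abs_minus_commute)
  have "cos (2 * pi * s) = cos (2 * pi * r + 2 * pi * of_int (round s))"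
    by (simp add: r_def algebra_simps)
  also have "\<dots> = cos (2 * pi * r)"
    by (simp add: cos_add cos_int_2pin sin_int_2pin)
  also have "\<dots> = cos \<bar>2 * pi * r\<bar>" by simp
  finally have "arccos (cos (2 * pi * s)) = arccos (cos \<bar>2 * pi * r\<bar>)" by simp
  also have "\<dots> = \<bar>2 * pi * r\<bar>"
  proof (rule arccos_cos)
    have "2 * pi * \<bar>r\<bar> \<le> 2 * pi * (1/2)" using r by (intro mult_left_mono) auto
    thus "\<bar>2 * pi * r\<bar> \<le> pi" by (simp add: abs_mult)
  qed simp
  finally show ?thesis by (simp add: r_def abs_mult)
qed

lemma continuous_integrable: "continuous_on UNIV f \<Longrightarrow> (f :: real \<Rightarrow> real) integrable_on {0..1}"
  by (intro integrable_continuous_real) (auto intro: continuous_on_subset)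

locale weyl_sequence =
  fixes x :: "nat \<Rightarrow> real"
  assumes weyl: "\<And>h::nat. h \<ge> 1 \<Longrightarrow> (\<lambda>N. norm (\<Sum>n=1..N. cis (2 * pi * (real h * x n))) / real N) \<longlonglongrightarrow> 0"
begin

definition averages_to_integral :: "(real \<Rightarrow> real) \<Rightarrow> bool" where
  "averages_to_integral f \<longleftrightarrow> continuous_on UNIV f \<and>
     (\<lambda>N. (\<Sum>n=1..N. f (x n)) / real N) \<longlonglongrightarrow> integral {0..1} f"

lemma averages_to_integral_linear:
  assumes "averages_to_integral f" "averages_to_integral g"
  shows "averages_to_integral (\<lambda>t. u * f t + v * g t)"
proof -
  have c: "continuous_on UNIV f" "continuous_on UNIV g" using assms by (auto simp: averages_to_integral_def)
  have "(\<lambda>N. u * ((\<Sum>n=1..N. f (x n)) / real N) + v * ((\<Sum>n=1..N. g (x n)) / real N))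
     \<longlonglongrightarrow> u * integral {0..1} f + v * integral {0..1} g"
    using assms by (intro tendsto_intros) (auto simp: averages_to_integral_def)
  moreover have "integral {0..1} (\<lambda>t. u * f t + v * g t) = u * integral {0..1} f + v * integral {0..1} g"
    using c by (subst integral_add) (auto intro!: continuous_integrable continuous_intros)
  moreover have "u * ((\<Sum>n=1..N. f (x n)) / real N) + v * ((\<Sum>n=1..N. g (x n)) / real N) =
      (\<Sum>n=1..N. u * f (x n) + v * g (x n)) / real N" for N
    by (simp add: sum.distrib sum_distrib_left[symmetric] add_divide_distrib)
  ultimately show ?thesis using c by (auto simp: averages_to_integral_def intro!: continuous_intros)
qed

lemma averages_to_integral_cos:
  fixes h :: int
  shows "averages_to_integral (\<lambda>t. cos (2 * pi * (of_int h * t) + \<beta>))"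
proof -
  have *: "averages_to_integral (\<lambda>t. cos (2 * pi * (real k * t) + \<beta>))" for k :: nat and \<beta>
  proof (cases "k = 0")
    case True
    have "(\<lambda>N. (\<Sum>n=1..N. cos \<beta>) / real N) \<longlonglongrightarrow> cos \<beta>"
    proof (rule Lim_transform_eventually)
      show "eventually (\<lambda>N. cos \<beta> = (\<Sum>n=1..N. cos \<beta>) / real N) at_top"
        using eventually_ge_at_top[of 1] by eventually_elim auto
    qed simp
    thus ?thesis using True by (simp add: averages_to_integral_def)
  next
    case False
    hence k: "k \<ge> 1" by simp
    define F where "F t = sin (2 * pi * (real k * t) + \<beta>) / (2 * pi * real k)" for t
    have "((\<lambda>t. cos (2 * pi * (real k * t) + \<beta>)) has_integral (F 1 - F 0)) {0..1}"
    proof (rule fundamental_theorem_of_calculus)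
      fix t :: real
      have "(F has_real_derivative cos (2 * pi * (real k * t) + \<beta>)) (at t within {0..1})"
        unfolding F_def using k by (auto intro!: derivative_eq_intros simp: divide_simps)
      thus "(F has_vector_derivative cos (2 * pi * (real k * t) + \<beta>)) (at t within {0..1})"
        by (simp add: has_real_derivative_iff_has_vector_derivative)
    qed simp
    moreover have "F 1 = F 0"
    proof -
      have "sin (\<beta> + 2 * real k * pi) = sin \<beta>"
        by (simp add: sin_add)
      moreover have "2 * pi * (real k * 1) + \<beta> = \<beta> + 2 * real k * pi" by simp
      ultimately show ?thesis by (simp only: F_def) simp
    qed
    ultimately have int0: "integral {0..1} (\<lambda>t. cos (2 * pi * (real k * t) + \<beta>)) = 0"
      by (simp add: integral_unique)
    have "(\<lambda>N. (\<Sum>n=1..N. cos (2 * pi * (real k * x n) + \<beta>)) / real N) \<longlonglongrightarrow> 0"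
    proof (rule Lim_null_comparison[OF _ weyl[OF k]], intro always_eventually allI)
      fix N
      have "(\<Sum>n=1..N. cos (2 * pi * (real k * x n) + \<beta>)) = Re (cis \<beta> * (\<Sum>n=1..N. cis (2 * pi * (real k * x n))))"
      proof -
        have "cis \<beta> * (\<Sum>n=1..N. cis (2 * pi * (real k * x n))) = (\<Sum>n=1..N. cis (2 * pi * (real k * x n) + \<beta>))"
          unfolding sum_distrib_left cis_mult by (simp only: add.commute)
        thus ?thesis by (simp only: Re_sum cis.sel)
      qed
      also have "\<bar>\<dots>\<bar> \<le> norm (cis \<beta> * (\<Sum>n=1..N. cis (2 * pi * (real k * x n))))" by (rule abs_Re_le_cmod)
      also have "\<dots> = norm (\<Sum>n=1..N. cis (2 * pi * (real k * x n)))" by (simp add: norm_mult)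
      finally show "norm ((\<Sum>n=1..N. cos (2 * pi * (real k * x n) + \<beta>)) / real N) \<le>
          norm (\<Sum>n=1..N. cis (2 * pi * (real k * x n))) / real N"
        by (simp add: divide_right_mono)
    qed
    thus ?thesis using int0 unfolding averages_to_integral_def
      by (intro conjI continuous_intros) simp_all
  qed
  show ?thesis
  proof (cases "h \<ge> 0")
    case True
    thus ?thesis using *[of "nat h" \<beta>] by simp
  next
    case False
    have "cos (2 * pi * (of_int h * t) + \<beta>) = cos (2 * pi * (real (nat (-h)) * t) + (-\<beta>))" for t
    proof -
      have "2 * pi * (real (nat (-h)) * t) + (-\<beta>) = - (2 * pi * (of_int h * t) + \<beta>)" using False by simp
      thus ?thesis by (simp only: cos_minus)
    qed
    thus ?thesis using *[of "nat (-h)" "-\<beta>"] by simp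
  qed
qed

lemma averages_to_integral_uniform_limit:
  assumes f: "continuous_on UNIV f"
    and approx: "\<And>\<epsilon>. \<epsilon> > 0 \<Longrightarrow> \<exists>g. averages_to_integral g \<and> (\<forall>t. \<bar>f t - g t\<bar> \<le> \<epsilon>)"
  shows "averages_to_integral f"
  unfolding averages_to_integral_def
proof (intro conjI f tendstoI)
  fix e :: real assume e: "e > 0"
  define \<epsilon> where "\<epsilon> = e / 4"
  have \<epsilon>: "\<epsilon> > 0" using e by (simp add: \<epsilon>_def)
  obtain g where g: "averages_to_integral g" "\<And>t. \<bar>f t - g t\<bar> \<le> \<epsilon>" using approx[OF \<epsilon>] by blast
  have gc: "continuous_on UNIV g" and gl: "(\<lambda>N. (\<Sum>n=1..N. g (x n)) / real N) \<longlonglongrightarrow> integral {0..1} g"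
    using g(1) by (auto simp: averages_to_integral_def)
  have int: "\<bar>integral {0..1} f - integral {0..1} g\<bar> \<le> \<epsilon>"
  proof -
    have "integral {0..1} f - integral {0..1} g = integral {0..1} (\<lambda>t. f t - g t)"
      using f gc by (intro integral_diff[symmetric] continuous_integrable)
    also have "norm \<dots> \<le> \<epsilon> * (1 - 0)"
    proof (rule integral_bound)
      show "continuous_on {0..1} (\<lambda>t. f t - g t)"
        by (intro continuous_intros continuous_on_subset[OF f] continuous_on_subset[OF gc]) auto
    qed (use g(2) in auto)
    finally show ?thesis by simp
  qed
  from tendstoD[OF gl \<epsilon>] eventually_ge_at_top[of 1]
  show "eventually (\<lambda>N. dist ((\<Sum>n=1..N. f (x n)) / real N) (integral {0..1} f) < e) at_top"
  proof eventually_elim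
    case (elim N)
    have "\<bar>(\<Sum>n=1..N. f (x n)) / real N - (\<Sum>n=1..N. g (x n)) / real N\<bar> = \<bar>\<Sum>n=1..N. f (x n) - g (x n)\<bar> / real N"
      unfolding sum_subtractf diff_divide_distrib[symmetric] abs_divide by simp
    also have "\<dots> \<le> (\<Sum>n=1..N. \<epsilon>) / real N"
      using g(2) by (intro divide_right_mono order_trans[OF sum_abs sum_mono]) auto
    also have "\<dots> = \<epsilon>" using elim(2) by simp
    finally show ?case using elim(1) int e unfolding dist_real_def \<epsilon>_def by linarith
  qed
qed

text \<open>Bernstein polynomials in \<open>(1 + cos (2 * pi * (t - m))) / 2\<close> are
  trigonometric polynomials, so polynomial approximation on the unit interval takes the place of
  Fejer's theorem. It reaches the functions symmetric about \<open>m\<close>, and bumps over an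
  interval with midpoint \<open>m\<close> are of this kind.\<close>

lemma averages_to_integral_even:
  assumes g: "continuous_on {0..1} g"
  shows "averages_to_integral (\<lambda>t. g ((1 + cos (2 * pi * (t - m))) / 2))"
proof (rule averages_to_integral_uniform_limit)
  define y where "y t = (1 + cos (2 * pi * (t - m))) / 2" for t
  define strong where "strong f \<longleftrightarrow> (\<forall>(h::int) \<beta>. averages_to_integral (\<lambda>t. f t * cos (2 * pi * (of_int h * t) + \<beta>)))" for f
  \<comment> \<open>unlike \<open>averages_to_integral\<close> itself, this is preserved under multiplication by a cosine\<close>
  have strongD: "averages_to_integral f" if "strong f" for f
    using that[unfolded strong_def, rule_format, of 0 0] by simp
  have strong_const: "strong (\<lambda>t. 1)"
    unfolding strong_def using averages_to_integral_cos by simp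
  have strong_linear: "strong (\<lambda>t. u * f t + v * f' t)" if "strong f" "strong f'" for u v f f'
    unfolding strong_def
  proof (intro allI)
    fix h :: int and \<beta>
    have "averages_to_integral (\<lambda>t. u * (f t * cos (2 * pi * (of_int h * t) + \<beta>)) + v * (f' t * cos (2 * pi * (of_int h * t) + \<beta>)))"
      using that unfolding strong_def by (intro averages_to_integral_linear) auto
    thus "averages_to_integral (\<lambda>t. (u * f t + v * f' t) * cos (2 * pi * (of_int h * t) + \<beta>))"
      by (simp only: distrib_right mult.assoc)
  qed
  have strong_mult: "strong (\<lambda>t. f t * cos (2 * pi * (t - m)))" if f: "strong f" for f
    unfolding strong_def
  proof (intro allI)
    fix h :: int and \<beta>
    have eq: "f t * cos (2 * pi * (t - m)) * cos (2 * pi * (of_int h * t) + \<beta>) =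
       1/2 * (f t * cos (2 * pi * (of_int (1 - h) * t) + (- 2 * pi * m - \<beta>))) +
       1/2 * (f t * cos (2 * pi * (of_int (1 + h) * t) + (- 2 * pi * m + \<beta>)))" for t
    proof -
      have "2 * pi * (t - m) - (2 * pi * (of_int h * t) + \<beta>) = 2 * pi * (of_int (1 - h) * t) + (- 2 * pi * m - \<beta>)"
        "2 * pi * (t - m) + (2 * pi * (of_int h * t) + \<beta>) = 2 * pi * (of_int (1 + h) * t) + (- 2 * pi * m + \<beta>)"
        by (simp_all add: algebra_simps)
      thus ?thesis using cos_times_cos[of "2 * pi * (t - m)" "2 * pi * (of_int h * t) + \<beta>"]
        by (simp add: algebra_simps add_divide_distrib)
    qed
    have "averages_to_integral (\<lambda>t. 1/2 * (f t * cos (2 * pi * (of_int (1 - h) * t) + (- 2 * pi * m - \<beta>))) +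
       1/2 * (f t * cos (2 * pi * (of_int (1 + h) * t) + (- 2 * pi * m + \<beta>))))"
      by (intro averages_to_integral_linear f[unfolded strong_def, rule_format])
    thus "averages_to_integral (\<lambda>t. f t * cos (2 * pi * (t - m)) * cos (2 * pi * (of_int h * t) + \<beta>))"
      unfolding eq .
  qed
  have step1: "strong (\<lambda>t. f t * y t)" if "strong f" for f
  proof -
    have "strong (\<lambda>t. 1/2 * f t + 1/2 * (f t * cos (2 * pi * (t - m))))"
      by (intro strong_linear strong_mult that)
    moreover have "1/2 * f t + 1/2 * (f t * cos (2 * pi * (t - m))) = f t * y t" for t
      by (simp add: y_def field_simps)
    ultimately show ?thesis by simp
  qed
  have step2: "strong (\<lambda>t. f t * (1 - y t))" if "strong f" for f
  proof -
    have "strong (\<lambda>t. 1 * f t + (-1) * (f t * y t))"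
      by (intro strong_linear step1 that)
    moreover have "1 * f t + (-1) * (f t * y t) = f t * (1 - y t)" for t
      by (simp add: algebra_simps)
    ultimately show ?thesis by simp
  qed
  have pow: "strong (\<lambda>t. y t ^ k * (1 - y t) ^ l)" for k l
  proof (induction l)
    case 0
    show ?case
    proof (induction k)
      case 0
      show ?case using strong_const by simp
    next
      case (Suc k)
      thus ?case using step1[of "\<lambda>t. y t ^ k"] by (simp add: mult.commute)
    qed
  next
    case (Suc l)
    thus ?case using step2[of "\<lambda>t. y t ^ k * (1 - y t) ^ l"] by (simp add: mult_ac)
  qed
  have bern: "strong (\<lambda>t. \<Sum>k\<in>K. a k * Bernstein n k (y t))" if "finite K" for K a n
    using that
  proof (induction K rule: finite_induct)
    case empty
    show ?case using strong_linear[OF strong_const strong_const, of 0 0] by simp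
  next
    case (insert k K)
    have "strong (\<lambda>t. (a k * of_nat (n choose k)) * (y t ^ k * (1 - y t) ^ (n - k)) + 1 * (\<Sum>k\<in>K. a k * Bernstein n k (y t)))"
      by (intro strong_linear pow insert.IH)
    thus ?case using insert.hyps by (simp add: Bernstein_def mult.assoc)
  qed
  have y01: "y t \<in> {0..1}" for t
  proof -
    have *: "(1 + z) / 2 \<in> {0..1}" if "-1 \<le> z" "z \<le> 1" for z :: real
      using that by auto
    show ?thesis unfolding y_def by (rule *[OF cos_ge_minus_one cos_le_one])
  qed
  have yc: "continuous_on UNIV y" unfolding y_def by (intro continuous_intros) auto
  show "continuous_on UNIV (\<lambda>t. g ((1 + cos (2 * pi * (t - m))) / 2))"
    unfolding y_def[symmetric] by (rule continuous_on_compose2[OF g yc]) (use y01 in auto)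
  fix \<epsilon> :: real assume "\<epsilon> > 0"
  then obtain n where n: "\<And>z. z \<in> {0..1} \<Longrightarrow> \<bar>g z - (\<Sum>k\<le>n. g (k/n) * Bernstein n k z)\<bar> < \<epsilon>"
    using Bernstein_Weierstrass[OF g] by blast
  show "\<exists>f. averages_to_integral f \<and> (\<forall>t. \<bar>g ((1 + cos (2 * pi * (t - m))) / 2) - f t\<bar> \<le> \<epsilon>)"
    unfolding y_def[symmetric]
    by (rule exI[of _ "\<lambda>t. \<Sum>k\<le>n. g (k/n) * Bernstein n k (y t)"])
       (use n[OF y01] strongD[OF bern] in \<open>auto intro: less_imp_le\<close>)
qed

text \<open>\<open>f\<close> is a trapezoid below the indicator of \<open>{a..<b}\<close> modulo 1,
  with slopes of width \<open>\<eta>\<close>, so its integral is at least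
  \<open>b - a - 2 * \<eta>\<close>. It depends only on the distance of \<open>t - m\<close> to the
  nearest integer, hence is a continuous function \<open>g\<close> of the cosine.\<close>

lemma frequency_lower_bound:
  assumes ab: "0 \<le> a" "a < b" "b \<le> 1" and e: "e > 0"
  shows "eventually (\<lambda>N. real (card {n\<in>{1..N}. frac (x n) \<in> {a..<b}}) / real N > b - a - e) at_top"
proof -
  define \<eta> where "\<eta> = min (e / 4) ((b - a) / 4)"
  have \<eta>: "\<eta> > 0" "4 * \<eta> \<le> e" "4 * \<eta> \<le> b - a" using ab e unfolding \<eta>_def by (simp_all add: min_def)
  define m where "m = (a + b) / 2"
  define w where "w = (b - a) / 2"
  have w: "w \<le> 1/2" "m - w = a" "m + w = b" using ab by (auto simp: w_def m_def field_simps)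
  define g where "g y = max 0 (min 1 ((w - arccos (2 * y - 1) / (2 * pi)) / \<eta>))" for y
  define f where "f t = max 0 (min 1 ((w - \<bar>(t - m) - of_int (round (t - m))\<bar>) / \<eta>))" for t
  have "continuous_on {0..1} (\<lambda>y. arccos (2 * y - 1))"
    by (rule continuous_on_arccos) (auto intro!: continuous_intros)
  hence gc: "continuous_on {0..1} g" unfolding g_def using \<eta>(1)
    by (intro continuous_intros) auto
  have gf: "g ((1 + cos (2 * pi * (t - m))) / 2) = f t" for t
  proof -
    have "2 * ((1 + cos (2 * pi * (t - m))) / 2) - 1 = cos (2 * pi * (t - m))" by (simp add: field_simps)
    thus ?thesis unfolding g_def f_def using arccos_cos_round[of "t - m"] by simp
  qed
  have good: "averages_to_integral f"
    using averages_to_integral_even[OF gc, of m] unfolding gf by simp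
  have f0: "f t \<ge> 0" "f t \<le> 1" for t by (auto simp: f_def)
  \<comment> \<open>If \<open>t - k\<close> lies strictly between \<open>a\<close> and
    \<open>b\<close>, thus inside the unit interval, the nearest integer \<open>k\<close> of
    \<open>t - m\<close> is the floor of \<open>t\<close>.\<close>
  have fpos: "frac t \<in> {a..<b}" if "f t > 0" for t
  proof -
    define k where "k = round (t - m)"
    have "(w - \<bar>(t - m) - of_int k\<bar>) / \<eta> > 0" using that by (simp add: f_def k_def less_max_iff_disj)
    hence "\<bar>(t - m) - of_int k\<bar> < w" using \<eta>(1) by (simp add: zero_less_divide_iff)
    hence 1: "a < t - of_int k" "t - of_int k < b" using w by linarith+
    hence "\<lfloor>t\<rfloor> = k" using ab by (intro floor_unique) auto
    thus ?thesis using 1 by (auto simp: frac_def)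
  qed
  have "b - a - 2 * \<eta> \<le> integral {0..1} f"
  proof -
    have fc: "continuous_on UNIV f" using good by (simp add: averages_to_integral_def)
    have "f t = 1" if t: "t \<in> {a + \<eta>..b - \<eta>}" for t
    proof -
      have "\<bar>(t - m) - of_int (round (t - m))\<bar> \<le> \<bar>(t - m) - of_int 0\<bar>" by (rule round_diff_minimal)
      also have "\<dots> \<le> w - \<eta>" using t w unfolding atLeastAtMost_iff by linarith
      finally have "1 \<le> (w - \<bar>(t - m) - of_int (round (t - m))\<bar>) / \<eta>" using \<eta>(1) by (simp add: pos_le_divide_eq)
      thus ?thesis by (simp add: f_def)
    qed
    hence "integral {a + \<eta>..b - \<eta>} f = integral {a + \<eta>..b - \<eta>} (\<lambda>t. 1)"
      by (rule integral_cong)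
    also have "\<dots> = b - a - 2 * \<eta>" using \<eta> by simp
    finally have "b - a - 2 * \<eta> = integral {a + \<eta>..b - \<eta>} f" by simp
    also have "\<dots> \<le> integral {0..1} f"
      using ab \<eta>(1) f0(1)
      by (intro integral_subset_le integrable_continuous_real continuous_on_subset[OF fc]) auto
    finally show ?thesis .
  qed
  hence "b - a - e < integral {0..1} f" using \<eta> by linarith
  moreover have "(\<lambda>N. (\<Sum>n=1..N. f (x n)) / real N) \<longlonglongrightarrow> integral {0..1} f"
    using good by (simp add: averages_to_integral_def)
  ultimately have "eventually (\<lambda>N. (\<Sum>n=1..N. f (x n)) / real N > b - a - e) at_top"
    by (rule order_tendstoD(1)[rotated])
  thus ?thesis
  proof eventually_elim
    case (elim N)
    have "(\<Sum>n=1..N. f (x n)) \<le> (\<Sum>n=1..N. if frac (x n) \<in> {a..<b} then 1 else 0)"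
    proof (rule sum_mono)
      fix n
      show "f (x n) \<le> (if frac (x n) \<in> {a..<b} then 1 else 0)"
        using f0[of "x n"] fpos[of "x n"] by (cases "f (x n) > 0") auto
    qed
    also have "\<dots> = real (card {n\<in>{1..N}. frac (x n) \<in> {a..<b}})"
      by (subst sum.inter_filter[symmetric]) auto
    finally have "(\<Sum>n=1..N. f (x n)) / real N \<le> real (card {n\<in>{1..N}. frac (x n) \<in> {a..<b}}) / real N"
      by (rule divide_right_mono) simp
    thus ?case using elim by linarith
  qed
qed

text \<open>
  The frequencies of \<open>[0, a)\<close>, \<open>[a, b)\<close> and \<open>[b, 1)\<close> add up to 1, so the lower bounds also yield the upper bound.
\<close>

theorem weyl_equidistribution:
  assumes ab: "0 \<le> a" "a < b" "b \<le> 1"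
  shows "(\<lambda>N. real (card {n\<in>{1..N}. frac (x n) \<in> {a..<b}}) / real N) \<longlonglongrightarrow> b - a"
proof (rule tendstoI)
  define P where "P c d N = real (card {n\<in>{1..N}. frac (x n) \<in> {c..<d}}) / real N" for c d N
  fix e :: real assume e: "e > 0"
  have low: "eventually (\<lambda>N. P c d N > d - c - e / 2) at_top" if "0 \<le> c" "c \<le> d" "d \<le> 1" for c d
  proof (cases "c = d")
    case True
    thus ?thesis using e by (simp add: P_def)
  next
    case False
    thus ?thesis unfolding P_def using that e by (intro frequency_lower_bound) auto
  qed
  have "eventually (\<lambda>N. P 0 a N > a - 0 - e / 2) at_top" "eventually (\<lambda>N. P a b N > b - a - e / 2) at_top"
    "eventually (\<lambda>N. P b 1 N > 1 - b - e / 2) at_top"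
    using low[of 0 a] low[of a b] low[of b 1] ab by simp_all
  hence "eventually (\<lambda>N. \<bar>P a b N - (b - a)\<bar> < e) at_top"
    using eventually_ge_at_top[of 1]
  proof eventually_elim
    case (elim N)
    let ?A1 = "{n\<in>{1..N}. frac (x n) \<in> {0..<a}}" and ?A2 = "{n\<in>{1..N}. frac (x n) \<in> {a..<b}}"
      and ?A3 = "{n\<in>{1..N}. frac (x n) \<in> {b..<1}}"
    have "{1..N} = ?A1 \<union> ?A2 \<union> ?A3"
      using frac_lt_1 by (auto simp: not_le)
    hence "card {1..N} = card \<dots>" by (rule arg_cong)
    also have "\<dots> = card (?A1 \<union> ?A2) + card ?A3"
      using ab by (intro card_Un_disjoint) auto
    also have "card (?A1 \<union> ?A2) =
       card ?A1 + card ?A2"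
      using ab by (intro card_Un_disjoint) auto
    finally have "real N = real (card ?A1) + real (card ?A2) + real (card ?A3)"
      by simp
    hence "real N / real N = P 0 a N + P a b N + P b 1 N"
      unfolding P_def add_divide_distrib[symmetric] by (rule arg_cong[where f = "\<lambda>z. z / real N"])
    moreover have "real N / real N = 1" using elim by simp
    ultimately show ?case using elim e by (simp add: abs_less_iff)
  qed
  thus "eventually (\<lambda>N. dist (real (card {n\<in>{1..N}. frac (x n) \<in> {a..<b}}) / real N) (b - a) < e) at_top"
    by (simp add: P_def dist_real_def)
qed

end

section \<open>Primes\<close>

text \<open>Only powers \<open>p ^ k\<close> with \<open>k >= 2\<close> contribute; then
  \<open>p \<le> sqrt N\<close> and \<open>k \<le> 2 * ln N\<close>, and a crude count of the pairs
  \<open>(p, k)\<close> is enough.\<close>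

lemma sum_mangoldt_nonprime_le:
  fixes N :: nat
  assumes N: "N \<ge> 1"
  shows "(\<Sum>n\<in>{n\<in>{1..N}. \<not> prime n}. mangoldt n :: real) \<le> (sqrt (real N) + 1) * (2 * ln (real N) + 2) * ln (real N)"
proof -
  define s where "s = nat \<lfloor>sqrt (real N)\<rfloor>"
  define t where "t = nat \<lfloor>2 * ln (real N)\<rfloor>"
  define A where "A = {n\<in>{1..N}. \<not> prime n \<and> primepow n}"
  have lnN: "ln (real N) \<ge> 0" using N by simp
  have "A \<subseteq> (\<lambda>(p, k). p ^ k) ` ({..s} \<times> {..t})"
  proof
    fix n assume "n \<in> A"
    hence n: "n \<le> N" "n \<ge> 1" "\<not> prime n" "primepow n" by (auto simp: A_def)
    then obtain p k where pk: "prime p" "k > 0" "n = p ^ k" by (auto simp: primepow_def)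
    have k2: "k \<ge> 2"
    proof (rule ccontr)
      assume "\<not> k \<ge> 2"
      hence "k = 1" using pk(2) by simp
      thus False using pk n by simp
    qed
    have p2: "p \<ge> 2" using pk(1) by (rule prime_ge_2_nat)
    have "p ^ 2 \<le> p ^ k" using k2 p2 by (intro power_increasing) auto
    hence "p ^ 2 \<le> N" using n pk by simp
    hence "real (p ^ 2) \<le> real N" by (simp only: of_nat_le_iff)
    hence "real p \<le> sqrt (real N)" by (intro real_le_rsqrt) simp
    hence "p \<le> s" unfolding s_def by linarith
    moreover have "k \<le> t"
    proof -
      have "2 ^ k \<le> p ^ k" using p2 by (intro power_mono) auto
      also have "p ^ k \<le> N" using n pk by simp
      finally have "2 ^ k \<le> N" .
      hence "real (2 ^ k) \<le> real N" by (simp only: of_nat_le_iff)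
      hence "ln (real (2 ^ k)) \<le> ln (real N)" by (intro ln_mono) auto
      hence "real k * ln 2 \<le> ln (real N)" by (simp add: ln_realpow)
      moreover have "real k * (1/2) \<le> real k * ln 2"
        using ln2_ge_two_thirds by (intro mult_left_mono) auto
      ultimately have "real k \<le> 2 * ln (real N)" by linarith
      thus ?thesis unfolding t_def by linarith
    qed
    ultimately show "n \<in> (\<lambda>(p, k). p ^ k) ` ({..s} \<times> {..t})" using pk(3) by force
  qed
  hence "card A \<le> card ((\<lambda>(p, k). p ^ k) ` ({..s} \<times> {..t}))" by (intro card_mono) auto
  also have "\<dots> \<le> card ({..s} \<times> {..t})" by (rule card_image_le) simp
  also have "\<dots> = (s + 1) * (t + 1)" by (simp add: card_cartesian_product)
  finally have "real (card A) \<le> real ((s + 1) * (t + 1))" by (simp only: of_nat_le_iff)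
  also have "\<dots> = (real s + 1) * (real t + 1)" by (simp add: algebra_simps)
  also have "\<dots> \<le> (sqrt (real N) + 1) * (2 * ln (real N) + 2)"
  proof (intro mult_mono)
    have "0 \<le> sqrt (real N)" by simp
    thus "real s + 1 \<le> sqrt (real N) + 1" unfolding s_def by linarith
    show "real t + 1 \<le> 2 * ln (real N) + 2" unfolding t_def using lnN by linarith
  qed auto
  finally have cA: "real (card A) \<le> (sqrt (real N) + 1) * (2 * ln (real N) + 2)" .
  have "(\<Sum>n\<in>{n\<in>{1..N}. \<not> prime n}. mangoldt n :: real) = (\<Sum>n\<in>A. mangoldt n)"
    by (rule sum.mono_neutral_right) (auto simp: A_def mangoldt_def)
  also have "\<dots> \<le> (\<Sum>n\<in>A. ln (real N))"
  proof (rule sum_mono)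
    fix n assume n: "n \<in> A"
    have "mangoldt n \<le> ln (real n)" using n by (intro mangoldt_le) (auto simp: A_def)
    also have "\<dots> \<le> ln (real N)" using n by (intro ln_mono) (auto simp: A_def)
    finally show "mangoldt n \<le> ln (real N)" .
  qed
  also have "\<dots> = real (card A) * ln (real N)" by simp
  also have "\<dots> \<le> (sqrt (real N) + 1) * (2 * ln (real N) + 2) * ln (real N)"
    using cA lnN by (rule mult_right_mono)
  finally show ?thesis .
qed

definition prime_count :: "nat \<Rightarrow> nat" where
  "prime_count N = card {p\<in>{1..N}. prime p}"

section \<open>Chebyshev's lower bound\<close>

text \<open>The logarithm of the central binomial coefficient is the sum of
  \<open>mangoldt d\<close> times \<open>2 * M div d - 2 * (M div d)\<close>, and the latter factor
  is at most 1. The coefficient itself is at least \<open>4 ^ M / (2 * M)\<close>.\<close>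

lemma sum_mangoldt_ge:
  fixes M :: nat
  assumes M: "M \<ge> 1"
  shows "(\<Sum>d=1..2*M. mangoldt d :: real) \<ge> ln (4 ^ M / (2 * real M))"
proof -
  have sum_ln: "ln (fact X :: real) = (\<Sum>d=1..X. mangoldt d * real (X div d))" for X
  proof -
    have "ln (fact X :: real) = (\<Sum>n=1..X. ln (real n))"
      by (induction X) (simp_all add: ln_mult add.commute)
    also have "\<dots> = (\<Sum>n=1..X. \<Sum>d | d dvd n. mangoldt d)"
      by (intro sum.cong) (auto simp: mangoldt_sum[where ?'a = real])
    also have "\<dots> = (\<Sum>d=1..X. \<Sum>m=1..X div d. mangoldt d)"
      by (rule sum_divisors_swap)
    finally show ?thesis by (simp add: mult.commute)
  qed
  have "4 ^ M / (2 * real M) \<le> real ((2 * M) choose M)"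
    using central_binomial_lower_bound[of M] M by simp
  hence "ln (4 ^ M / (2 * real M)) \<le> ln (real ((2 * M) choose M))"
    using M by (intro ln_mono) auto
  also have "real ((2 * M) choose M) = fact (2 * M) / (fact M * fact M)"
    by (subst binomial_fact) auto
  also have "ln (fact (2 * M) / (fact M * fact M) :: real) = ln (fact (2 * M)) - (ln (fact M) + ln (fact M))"
    by (simp add: ln_div ln_mult)
  also have "\<dots> = (\<Sum>d=1..2*M. mangoldt d * real (2 * M div d)) - 2 * (\<Sum>d=1..M. mangoldt d * real (M div d))"
    by (simp only: sum_ln)
  also have "(\<Sum>d=1..M. mangoldt d * real (M div d)) = (\<Sum>d=1..2*M. mangoldt d * real (M div d))"
    by (rule sum.mono_neutral_left) auto
  also have "(\<Sum>d=1..2*M. mangoldt d * real (2 * M div d)) - 2 * (\<Sum>d=1..2*M. mangoldt d * real (M div d)) =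
     (\<Sum>d=1..2*M. mangoldt d * (real (2 * M div d) - 2 * real (M div d)))"
    by (simp add: sum_distrib_left sum_subtractf algebra_simps)
  also have "\<dots> \<le> (\<Sum>d=1..2*M. mangoldt d * 1)"
  proof (intro sum_mono mult_left_mono mangoldt_nonneg)
    fix d assume d: "d \<in> {1..2*M}"
    have "2 * M div d \<le> 2 * (M div d) + 1"
    proof -
      have "M < (M div d + 1) * d" using d dividend_less_div_times[of d M] by (simp add: algebra_simps)
      hence "2 * M < (2 * (M div d) + 2) * d" by (simp add: algebra_simps)
      hence "2 * M div d < 2 * (M div d) + 2" using d by (subst div_less_iff_less_mult) auto
      thus ?thesis by simp
    qed
    hence "real (2 * M div d) \<le> real (2 * (M div d) + 1)" by (simp only: of_nat_le_iff)
    thus "real (2 * M div d) - 2 * real (M div d) \<le> 1" by simp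
  qed
  finally show ?thesis by simp
qed

text \<open>It turns an estimate \<open>o(N / ln N)\<close> for a sum over primes into one relative
  to the number of primes. The constant is far from optimal: \<open>ln 2 >= 2/3\<close> would allow
  anything below 2/3 in place of 1/4.\<close>

lemma prime_count_ge:
  "eventually (\<lambda>N. real (prime_count N) \<ge> real N / (4 * ln (real N))) at_top"
proof -
  have "eventually (\<lambda>N. (real N - 2) * (2/3) - ln (real N) - (sqrt (real N) + 1) * (2 * ln (real N) + 2) * ln (real N) \<ge> real N / 4) at_top"
    by real_asymp
  thus ?thesis using eventually_ge_at_top[of 4]
  proof eventually_elim
    case (elim N)
    let ?R = "(sqrt (real N) + 1) * (2 * ln (real N) + 2) * ln (real N)"
    define M where "M = N div 2"
    have M: "M \<ge> 1" "2 * M \<le> N" "N \<le> 2 * M + 1" using elim(2) by (auto simp: M_def)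
    have lnN: "ln (real N) > 0" using elim(2) by simp
    have "(real N - 2) * (2/3) - ln (real N) \<le> ln (4 ^ M / (2 * real M))"
    proof -
      have "ln (4 ^ M / (2 * real M)) = real M * ln 4 - ln (2 * real M)"
        using M(1) by (simp add: ln_div ln_realpow)
      moreover have "ln (4::real) = 2 * ln 2" using ln_realpow[of 2 2] by simp
      ultimately have "ln (4 ^ M / (2 * real M)) = real M * (2 * ln 2) - ln (2 * real M)" by simp
      moreover have "ln (2 * real M) \<le> ln (real N)" using M by (intro ln_mono) auto
      moreover have "(real N - 2) * (2/3) \<le> real M * (2 * ln 2)"
      proof -
        have "real N - 2 \<le> 2 * real M" using M by linarith
        hence "(real N - 2) * (2/3) \<le> (2 * real M) * ln 2"
          using ln2_ge_two_thirds elim(2) by (intro mult_mono) auto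
        thus ?thesis by simp
      qed
      ultimately show ?thesis by linarith
    qed
    also have "\<dots> \<le> (\<Sum>d=1..2*M. mangoldt d)" by (rule sum_mangoldt_ge[OF M(1)])
    also have "\<dots> \<le> (\<Sum>d=1..N. mangoldt d)"
      using M by (intro sum_mono2) (auto intro: mangoldt_nonneg)
    also have "\<dots> = (\<Sum>d\<in>{p\<in>{1..N}. prime p}. mangoldt d) + (\<Sum>n\<in>{n\<in>{1..N}. \<not> prime n}. mangoldt n)"
      by (subst sum.union_disjoint[symmetric]) (auto intro!: sum.cong)
    also have "\<dots> \<le> real (prime_count N) * ln (real N) + ?R"
    proof (rule add_mono)
      have "(\<Sum>d\<in>{p\<in>{1..N}. prime p}. mangoldt d) \<le> (\<Sum>d\<in>{p\<in>{1..N}. prime p}. ln (real N))"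
      proof (rule sum_mono)
        fix p assume p: "p \<in> {p\<in>{1..N}. prime p}"
        have "mangoldt p \<le> ln (real p)" using p by (intro mangoldt_le) auto
        also have "\<dots> \<le> ln (real N)" using p by (intro ln_mono) auto
        finally show "mangoldt p \<le> ln (real N)" .
      qed
      thus "(\<Sum>d\<in>{p\<in>{1..N}. prime p}. mangoldt d) \<le> real (prime_count N) * ln (real N)"
        by (simp add: prime_count_def)
      show "(\<Sum>n\<in>{n\<in>{1..N}. \<not> prime n}. mangoldt n) \<le> ?R"
        using elim(2) by (intro sum_mangoldt_nonprime_le) auto
    qed
    finally have "real N / 4 \<le> real (prime_count N) * ln (real N)" using elim(1) by linarith
    thus ?case using lnN by (simp add: field_simps)
  qed
qed

section \<open>From von Mangoldt weights to primes\<close>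

text \<open>The weight \<open>ln p\<close> is removed by partial summation. Below
  \<open>sqrt N\<close>, where \<open>1 / ln n\<close> need not be of order \<open>1 / ln N\<close>,
  the terms are simply counted.\<close>

lemma prime_exponential_sum_eventually_le:
  fixes h :: nat and \<epsilon> :: real
  assumes h: "h \<ge> 1" and \<epsilon>: "\<epsilon> > 0"
  shows "eventually (\<lambda>N. norm (\<Sum>p\<in>{p\<in>{1..N}. prime p}. cis (2 * pi * (real p * (real h * log 10 2)))) \<le> \<epsilon> * (real N / ln (real N))) at_top"
proof -
  define f where "f n = cis (2 * pi * (real n * (real h * log 10 2)))" for n
  define a where "a n = (if prime n then mangoldt n *\<^sub>R f n else 0)" for n
  define R where "R N = (sqrt (real N) + 1) * (2 * ln (real N) + 2) * ln (real N)" for N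
  \<comment> \<open>The final bound contains \<open>16 * \<delta> * N / ln N\<close>, half of what
    is allowed; the other half absorbs \<open>sqrt N\<close> and the constant
    \<open>C\<close>.\<close>
  define \<delta> where "\<delta> = \<epsilon> / 32"
  have \<delta>: "\<delta> > 0" using \<epsilon> by (simp add: \<delta>_def)
  let ?M = "\<lambda>N. \<Sum>n=1..N. mangoldt n *\<^sub>R f n"
  let ?C = "\<lambda>N. \<Sum>n\<in>{n\<in>{1..N}. \<not> prime n}. mangoldt n *\<^sub>R f n"
  have norm_f: "norm (f n) = 1" for n by (simp add: f_def)
  have "eventually (\<lambda>N. norm (norm (?M N) / real N) < \<delta>) at_top"
    using mangoldt_exponential_sum_tendsto_0[OF h] \<delta> unfolding f_def[symmetric] tendsto_iff dist_real_def diff_0_right real_norm_def by blast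
  moreover have "eventually (\<lambda>N. R N \<le> \<delta> * real N) at_top" unfolding R_def using \<delta> by real_asymp
  moreover have "eventually (\<lambda>N::nat. N \<ge> 1) at_top" by (rule eventually_ge_at_top)
  ultimately have "eventually (\<lambda>N. norm (\<Sum>n=1..N. a n) \<le> 2 * \<delta> * real N) at_top"
  proof eventually_elim
    case (elim N)
    have "(?M N) = (\<Sum>n=1..N. a n) + (?C N)"
    proof -
      have "(?C N) = (\<Sum>n=1..N. if \<not> prime n then mangoldt n *\<^sub>R f n else 0)"
        by (rule sum.inter_filter) simp
      thus ?thesis unfolding a_def by (simp only: sum.distrib[symmetric]) (intro sum.cong refl, simp)
    qed
    hence "(\<Sum>n=1..N. a n) = (?M N) - (?C N)"
      by simp
    hence "norm (\<Sum>n=1..N. a n) \<le> norm (?M N) + norm (?C N)"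
      by (simp only: norm_triangle_ineq4)
    moreover have "norm (?C N) \<le> R N"
    proof -
      have "norm (?C N) \<le> (\<Sum>n\<in>{n\<in>{1..N}. \<not> prime n}. mangoldt n)"
        by (rule order_trans[OF norm_sum]) (simp add: norm_f mangoldt_nonneg)
      also have "\<dots> \<le> R N" unfolding R_def by (rule sum_mangoldt_nonprime_le[OF elim(3)])
      finally show ?thesis .
    qed
    moreover have "norm (?M N) \<le> \<delta> * real N"
      using elim(1,3) by (simp add: pos_divide_less_eq)
    ultimately show ?case using elim(2) by linarith
  qed
  then obtain N0 where N0: "\<And>N. N \<ge> N0 \<Longrightarrow> norm (\<Sum>n=1..N. a n) \<le> 2 * \<delta> * real N"
    by (auto simp: eventually_at_top_linorder)
  \<comment> \<open>Adding all short partial sums gives a bound valid for every \<open>j\<close>, as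
    partial summation needs it also below \<open>N0\<close>.\<close>
  define C where "C = (\<Sum>N\<in>{..N0}. norm (\<Sum>n=1..N. a n))"
  have C0: "C \<ge> 0" unfolding C_def by (intro sum_nonneg) auto
  have partial: "norm (\<Sum>n=1..j. a n) \<le> C + 2 * \<delta> * real j" for j
  proof (cases "j \<ge> N0")
    case True
    thus ?thesis using N0[OF True] C0 by linarith
  next
    case False
    hence "norm (\<Sum>n=1..j. a n) \<le> C" unfolding C_def by (intro member_le_sum) auto
    moreover have "0 \<le> 2 * \<delta> * real j" using \<delta> by simp
    ultimately show ?thesis by linarith
  qed
  have "eventually (\<lambda>N. sqrt (real N) + 4 * (2 * C + 4 * \<delta> * real N) / ln (real N) \<le> \<epsilon> * (real N / ln (real N))) at_top"
    unfolding \<delta>_def using C0 \<epsilon> by real_asymp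
  thus ?thesis using eventually_ge_at_top[of 4]
  proof eventually_elim
    case (elim N)
    define A where "A = nat \<lfloor>sqrt (real N)\<rfloor>"
    have sq0: "0 \<le> sqrt (real N)" by simp
    have A: "real A \<le> sqrt (real N)" "sqrt (real N) < real (Suc A)" unfolding A_def using sq0 by linarith+
    have sqN: "sqrt (real N) \<le> real N" using elim(2) by (intro real_le_lsqrt) (auto simp: power2_eq_square)
    hence AN: "A \<le> N" using A(1) by linarith
    have lnN: "ln (real N) > 0" using elim(2) by simp
    define b where "b n = (if A < n then a n else 0)" for n
    \<comment> \<open>The maximum extends the weight to all \<open>n\<close> as a nonincreasing
      function bounded by \<open>2 / ln N\<close>; its values up to \<open>A\<close> only meet
      \<open>b n = 0\<close>.\<close>
    define w where "w n = 1 / ln (real (max n (Suc A)))" for n :: nat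
    have ln_half: "ln (real n) \<ge> ln (real N) / 2" if "n > A" for n
    proof -
      have "sqrt (real N) \<le> real n" using that A(2) by linarith
      hence "ln (sqrt (real N)) \<le> ln (real n)" using elim(2) by (intro ln_mono) auto
      thus ?thesis using elim(2) by (simp add: ln_sqrt)
    qed
    have A2: "A \<ge> 2"
    proof -
      have "sqrt 4 \<le> sqrt (real N)" using elim(2) by (intro real_sqrt_le_mono) auto
      hence "2 \<le> sqrt (real N)" by simp
      thus ?thesis unfolding A_def by linarith
    qed
    have w_bounds: "0 \<le> w n \<and> w n \<le> 2 / ln (real N)" for n
    proof -
      have "ln (real N) / 2 \<le> ln (real (max n (Suc A)))" by (rule ln_half) simp
      hence "1 / ln (real (max n (Suc A))) \<le> 1 / (ln (real N) / 2)"
        using lnN by (intro frac_le) auto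
      moreover have "0 \<le> ln (real (max n (Suc A)))" by simp
      ultimately show ?thesis by (simp add: w_def)
    qed
    have w_anti: "w (Suc n) \<le> w n" for n
    proof -
      have "ln (real (max n (Suc A))) \<le> ln (real (max (Suc n) (Suc A)))" by (intro ln_mono) auto
      moreover have "0 < ln (real (max n (Suc A)))" using A2 by simp
      ultimately show ?thesis unfolding w_def by (intro divide_left_mono mult_pos_pos) auto
    qed
    define G where "G = 2 * C + 4 * \<delta> * real N"
    have partial_b: "norm (\<Sum>n=1..j. b n) \<le> G" if j: "j \<le> N" for j
    proof -
      have "(\<Sum>n=1..j. a n) = (\<Sum>n=1..j. b n) + (\<Sum>n=1..min j A. a n)"
      proof -
        have "(\<Sum>n=1..min j A. a n) = (\<Sum>n=1..j. if A < n then 0 else a n)"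
          by (rule sum.mono_neutral_cong_left) auto
        thus ?thesis unfolding b_def by (simp only: sum.distrib[symmetric]) (intro sum.cong refl, simp)
      qed
      hence "(\<Sum>n=1..j. b n) = (\<Sum>n=1..j. a n) - (\<Sum>n=1..min j A. a n)" by simp
      hence "norm (\<Sum>n=1..j. b n) \<le> norm (\<Sum>n=1..j. a n) + norm (\<Sum>n=1..min j A. a n)"
        by (simp only: norm_triangle_ineq4)
      also have "\<dots> \<le> (C + 2 * \<delta> * real j) + (C + 2 * \<delta> * real (min j A))"
        by (intro add_mono partial)
      also have "\<dots> \<le> (C + 2 * \<delta> * real N) + (C + 2 * \<delta> * real N)"
        using j \<delta> by (intro add_mono mult_left_mono) auto
      also have "\<dots> = G" by (simp add: G_def)
      finally show ?thesis .
    qed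
    have "(\<Sum>p\<in>{p\<in>{1..N}. prime p}. f p) = (\<Sum>p=1..N. if prime p then f p else 0)"
      by (rule sum.inter_filter) simp
    also have "\<dots> = (\<Sum>n=1..A. if prime n then f n else 0) + (\<Sum>n=1..N. w n *\<^sub>R b n)"
    proof -
      have "(\<Sum>n=1..A. if prime n then f n else 0) = (\<Sum>n=1..N. if A < n then 0 else if prime n then f n else 0)"
        using AN by (intro sum.mono_neutral_cong_left) auto
      moreover have "(if prime n then f n else 0) = (if A < n then 0 else if prime n then f n else 0) + w n *\<^sub>R b n" for n
      proof (cases "A < n \<and> prime n")
        case True
        hence "max n (Suc A) = n" "ln (real n) \<noteq> 0" using ln_half[of n] lnN by auto
        thus ?thesis using True by (simp add: w_def b_def a_def)
      next
        case False
        thus ?thesis by (auto simp: b_def a_def)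
      qed
      ultimately show ?thesis by (simp only: sum.distrib[symmetric])
    qed
    finally have "norm (\<Sum>p\<in>{p\<in>{1..N}. prime p}. f p) \<le>
        norm (\<Sum>n=1..A. if prime n then f n else 0) + norm (\<Sum>n=1..N. w n *\<^sub>R b n)"
      by (simp only: norm_triangle_ineq)
    moreover have "norm (\<Sum>n=1..A. if prime n then f n else 0) \<le> sqrt (real N)"
    proof -
      have "norm (\<Sum>n=1..A. if prime n then f n else 0) \<le> (\<Sum>n=1..A. 1)"
        by (rule order_trans[OF norm_sum sum_mono]) (simp add: norm_f)
      thus ?thesis using A(1) by simp
    qed
    moreover have "norm (\<Sum>n=1..N. w n *\<^sub>R b n) \<le> 2 * (2 / ln (real N)) * G"
      by (rule norm_weighted_sum_le) (use partial_b w_bounds w_anti lnN in auto)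
    moreover have "2 * (2 / ln (real N)) * G = 4 * (2 * C + 4 * \<delta> * real N) / ln (real N)"
      by (simp add: G_def)
    ultimately show ?case using elim(1) unfolding f_def[symmetric] by linarith
  qed
qed

theorem prime_exponential_sum_tendsto_0:
  fixes h :: nat
  assumes h: "h \<ge> 1"
  shows "(\<lambda>N. norm (\<Sum>p\<in>{p\<in>{1..N}. prime p}. cis (2 * pi * (real p * (real h * log 10 2)))) / real (prime_count N)) \<longlonglongrightarrow> 0" (is "(\<lambda>N. norm (?W N) / _) \<longlonglongrightarrow> 0")
proof (rule tendstoI)
  fix e :: real assume e: "e > 0"
  have "e / 5 > 0" using e by simp
  from prime_exponential_sum_eventually_le[OF h this] prime_count_ge eventually_ge_at_top[of 2]
  show "eventually (\<lambda>N. dist (norm (?W N) / real (prime_count N)) 0 < e) at_top"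
  proof eventually_elim
    case (elim N)
    have X: "real N / ln (real N) > 0" using elim(3) by simp
    have le: "real N / ln (real N) \<le> 4 * real (prime_count N)" using elim(2) by simp
    have pc: "real (prime_count N) > 0" using X le by linarith
    have "e / 5 * (real N / ln (real N)) \<le> e / 5 * (4 * real (prime_count N))"
      using le e by (intro mult_left_mono) auto
    hence "norm (?W N) \<le> 4 / 5 * e * real (prime_count N)"
      using elim(1) by simp
    also have "\<dots> < e * real (prime_count N)" using e pc by simp
    finally show ?case using pc by (simp add: pos_divide_less_eq)
  qed
qed

section \<open>Leading digits\<close>

lemma nth_prime_props:
  assumes "n \<ge> 1"
  shows "prime (nth_prime n)" "nth_prime n \<ge> n" "n < m \<Longrightarrow> nth_prime n < nth_prime m"
proof -
  have inf: "infinite {p :: nat. prime p}" by (rule primes_infinite)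
  show "prime (nth_prime n)" unfolding nth_prime_def using enumerate_in_set[OF inf] by simp
  show "nth_prime n < nth_prime m" if "n < m"
    unfolding nth_prime_def using assms that by (intro enumerate_mono inf) auto
  have "nth_prime n > n - 1"
  proof (cases "n = 1")
    case True
    thus ?thesis using \<open>prime (nth_prime n)\<close> by (simp add: prime_gt_0_nat)
  next
    case False
    have "enumerate {p :: nat. prime p} k \<ge> k + 2" for k
    proof (induction k)
      case 0
      have "prime (enumerate {p :: nat. prime p} 0)" using enumerate_in_set[OF inf, of 0] by simp
      thus ?case by (simp only: add_0 prime_ge_2_nat)
    next
      case (Suc k)
      have "enumerate {p :: nat. prime p} k < enumerate {p. prime p} (Suc k)"
        by (rule enumerate_step[OF inf])
      thus ?case using Suc by simp
    qed
    from this[of "n - 1"] show ?thesis by (simp add: nth_prime_def)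
  qed
  thus "nth_prime n \<ge> n" by simp
qed

lemma nth_prime_bij_betw:
  assumes "N \<ge> 1"
  shows "bij_betw nth_prime {1..N} {p \<in> {1..nth_prime N}. prime p}"
proof (rule bij_betwI')
  fix n m assume "n \<in> {1..N}" "m \<in> {1..N}"
  thus "(nth_prime n = nth_prime m) = (n = m)"
    using nth_prime_props(3)[of n m] nth_prime_props(3)[of m n] by (cases n m rule: linorder_cases) auto
next
  fix n assume n: "n \<in> {1..N}"
  hence "nth_prime n \<le> nth_prime N" using nth_prime_props(3)[of n N] by (cases "n = N") auto
  thus "nth_prime n \<in> {p \<in> {1..nth_prime N}. prime p}"
    using nth_prime_props(1)[of n] n by (auto simp: Suc_le_eq prime_gt_0_nat)
next
  fix p assume p: "p \<in> {p \<in> {1..nth_prime N}. prime p}"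
  then obtain k where k: "enumerate {p. prime p} k = p"
    using enumerate_Ex[OF primes_infinite, of p] by auto
  hence pk: "p = nth_prime (Suc k)" by (simp add: nth_prime_def)
  have "Suc k \<le> N"
  proof (rule ccontr)
    assume "\<not> Suc k \<le> N"
    hence "nth_prime N < nth_prime (Suc k)" using assms by (intro nth_prime_props(3)) auto
    thus False using p pk by simp
  qed
  thus "\<exists>n\<in>{1..N}. p = nth_prime n" using pk by (intro bexI[of _ "Suc k"]) auto
qed

text \<open>The sums over all primes up to a limit are evaluated along the primes themselves: up to
  \<open>nth_prime N\<close> there are exactly \<open>N\<close> primes.\<close>

lemma nth_prime_exponential_sum_tendsto_0:
  assumes h: "h \<ge> 1"
  shows "(\<lambda>N. norm (\<Sum>n=1..N. cis (2 * pi * (real h * (real (nth_prime n) * log 10 2)))) / real N) \<longlonglongrightarrow> 0"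
proof (rule Lim_transform_eventually)
  let ?W = "\<lambda>N. \<Sum>p\<in>{p\<in>{1..nth_prime N}. prime p}. cis (2 * pi * (real p * (real h * log 10 2)))"
  have "filterlim nth_prime at_top at_top"
    by (rule filterlim_at_top_mono[OF filterlim_ident])
       (use nth_prime_props(2) in \<open>auto intro!: eventually_sequentiallyI[of 1]\<close>)
  from filterlim_compose[OF prime_exponential_sum_tendsto_0[OF h] this]
  show "(\<lambda>N. norm (?W N) / real (prime_count (nth_prime N))) \<longlonglongrightarrow> 0" .
  show "eventually (\<lambda>N. norm (?W N) / real (prime_count (nth_prime N)) =
     norm (\<Sum>n=1..N. cis (2 * pi * (real h * (real (nth_prime n) * log 10 2)))) / real N) at_top"
    using eventually_ge_at_top[of 1]
  proof eventually_elim
    case (elim N)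
    note bij = nth_prime_bij_betw[OF elim]
    have "prime_count (nth_prime N) = N"
      using bij_betw_same_card[OF bij] by (simp add: prime_count_def)
    moreover have "(?W N) =
       (\<Sum>n=1..N. cis (2 * pi * (real (nth_prime n) * (real h * log 10 2))))"
      by (rule sum.reindex_bij_betw[OF bij, symmetric])
    ultimately show ?case by (simp only: mult.left_commute)
  qed
qed

text \<open>Subtracting 1 could change the digit only if \<open>2 ^ p = c * 10 ^ k\<close>, which is
  impossible for \<open>k >= 1\<close> since 5 does not divide \<open>2 ^ p\<close>; and
  \<open>p >= 4\<close> makes the number at least 15, so that \<open>k >= 1\<close>. What remains is
  a condition on \<open>log 10 (2 ^ p)\<close> modulo 1.\<close>

lemma leading_digit_mersenne_iff:
  fixes p d :: nat
  assumes p: "p \<ge> 4" and d: "d \<in> {1..9}"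
  shows "leading_digit (2 ^ p - 1) = d \<longleftrightarrow> frac (real p * log 10 2) \<in> {log 10 (real d)..<log 10 (real d + 1)}"
proof -
  define y where "y = real p * log 10 2"
  have "(2::real) ^ 4 \<le> 2 ^ p" using p by (intro power_increasing) auto
  hence p16: "(2::real) ^ p \<ge> 16" by simp
  have pos: "(2::real) ^ p - 1 > 0" using p16 by linarith
  have logp: "log 10 (2 ^ p) = y" by (simp add: y_def log_nat_power)
  have y1: "y \<ge> 1"
  proof -
    have "log 10 10 \<le> log 10 (2 ^ p :: real)" using p16 by (subst log_le_cancel_iff) auto
    thus ?thesis using logp by simp
  qed
  have ne: "(2::nat) ^ p \<noteq> c * 10 ^ k" if "k \<ge> 1" for c k
  proof
    assume eq: "(2::nat) ^ p = c * 10 ^ k"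
    have "(5::nat) dvd 10 ^ 1" by simp
    also have "(10::nat) ^ 1 dvd 10 ^ k" using that by (rule le_imp_power_dvd)
    also have "(10::nat) ^ k dvd 2 ^ p" unfolding eq by simp
    finally have "(5::nat) dvd 2 ^ p" .
    moreover have "coprime (5::nat) (2 ^ p)" by (simp add: coprime_right_2_iff_odd)
    ultimately show False using coprime_common_divisor_nat[of 5 "2 ^ p" 5] by simp
  qed
  have d1: "1 \<le> real d" "real d + 1 \<le> 10" using d by auto
  have logd: "0 \<le> log 10 (real d)" "log 10 (real d + 1) \<le> 1"
    using d1 by (auto simp: log_le_one_cancel_iff)
  have bounds: "log 10 (c * 10 ^ k) = log 10 c + real k" if "c > 0" for c :: real and k
    using that by (simp add: log_mult log_nat_power)
  let ?D = "\<exists>k::int. real d * 10 powi k \<le> 2 ^ p - 1 \<and> 2 ^ p - 1 < (real d + 1) * 10 powi k"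
  let ?E = "\<exists>k::nat. k \<ge> 1 \<and> log 10 (real d) + real k \<le> y \<and> y < log 10 (real d + 1) + real k"
  have key: "?D \<longleftrightarrow>
     ?E"
  proof
    assume "?D"
    then obtain k :: int where k: "real d * 10 powi k \<le> 2 ^ p - 1" "2 ^ p - 1 < (real d + 1) * 10 powi k" by blast
    have k1: "k \<ge> 1"
    proof (rule ccontr)
      assume "\<not> k \<ge> 1"
      hence "(10::real) powi k \<le> 10 powi 0" by (intro power_int_increasing) auto
      hence "(real d + 1) * 10 powi k \<le> 10 * 1" using d1 by (intro mult_mono) auto
      thus False using k(2) p16 by linarith
    qed
    define j where "j = nat k"
    have j: "j \<ge> 1" "10 powi k = (10::real) ^ j" using k1 by (auto simp: j_def power_int_def)
    have "real (d * 10 ^ j) \<le> real (2 ^ p)" using k(1) j by simp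
    hence lo: "real d * 10 ^ j \<le> 2 ^ p" by simp
    have "real (2 ^ p) < real ((d + 1) * 10 ^ j + 1)" using k(2) unfolding j(2) by (simp add: algebra_simps)
    hence "2 ^ p < (d + 1) * 10 ^ j + 1" by (simp only: of_nat_less_iff)
    \<comment> \<open>Integrality gives only a weak inequality here; \<open>ne\<close> excludes
      equality.\<close>
    hence "2 ^ p < (d + 1) * 10 ^ j" using ne[OF j(1), of "d + 1"] by simp
    hence "real (2 ^ p) < real ((d + 1) * 10 ^ j)" by (simp only: of_nat_less_iff)
    hence hi: "2 ^ p < (real d + 1) * 10 ^ j" by (simp add: algebra_simps)
    have "log 10 (real d * 10 ^ j) \<le> log 10 (2 ^ p)" using lo d1 by (subst log_le_cancel_iff) auto
    moreover have "log 10 (2 ^ p) < log 10 ((real d + 1) * 10 ^ j)" using hi d1 by (subst log_less_cancel_iff) auto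
    ultimately show "?E"
      using j(1) d1 bounds[of "real d" j] bounds[of "real d + 1" j] logp by (intro exI[of _ j]) auto
  next
    assume "?E"
    then obtain k where k: "k \<ge> 1" "log 10 (real d) + real k \<le> y" "y < log 10 (real d + 1) + real k" by blast
    have "log 10 (real d * 10 ^ k) \<le> log 10 (2 ^ p)" using k d1 bounds[of "real d" k] logp by simp
    hence "real d * 10 ^ k \<le> 2 ^ p" using d1 by (subst (asm) log_le_cancel_iff) auto
    hence "real (d * 10 ^ k) \<le> real (2 ^ p)" by simp
    hence "d * 10 ^ k \<le> 2 ^ p" by (simp only: of_nat_le_iff)
    hence "d * 10 ^ k + 1 \<le> 2 ^ p" using ne[OF k(1), of d] by simp
    hence "real (d * 10 ^ k + 1) \<le> real (2 ^ p)" by (simp only: of_nat_le_iff)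
    hence 1: "real d * 10 powi (int k) \<le> 2 ^ p - 1" by simp
    have "log 10 (2 ^ p) < log 10 ((real d + 1) * 10 ^ k)" using k d1 bounds[of "real d + 1" k] logp by simp
    hence "2 ^ p < (real d + 1) * 10 ^ k" using d1 by (subst (asm) log_less_cancel_iff) auto
    hence 2: "2 ^ p - 1 < (real d + 1) * 10 powi (int k)" by simp
    show "?D"
      using 1 2 by blast
  qed
  have "leading_digit (2 ^ p - 1) = d \<longleftrightarrow> ?E"
    unfolding leading_digit_eq_iff[OF pos d] by (rule key)
  also have "\<dots> \<longleftrightarrow> frac y \<in> {log 10 (real d)..<log 10 (real d + 1)}"
  proof
    assume "?E"
    then obtain k where k: "log 10 (real d) + real k \<le> y" "y < log 10 (real d + 1) + real k" by blast
    moreover have "real_of_int (int k) \<le> y" "y < real_of_int (int k) + 1"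
      using k logd unfolding of_int_of_nat_eq by linarith+
    ultimately have "\<lfloor>y\<rfloor> = int k" by (intro floor_unique)
    thus "frac y \<in> {log 10 (real d)..<log 10 (real d + 1)}" using k by (auto simp: frac_def)
  next
    assume fr: "frac y \<in> {log 10 (real d)..<log 10 (real d + 1)}"
    define k where "k = nat \<lfloor>y\<rfloor>"
    have k: "k \<ge> 1" "real k = of_int \<lfloor>y\<rfloor>" using y1 by (auto simp: k_def le_nat_iff le_floor_iff)
    thus "?E"
      using fr by (intro exI[of _ k]) (auto simp: frac_def)
  qed
  finally show ?thesis by (simp add: y_def)
qed

theorem theorem2p5:
  shows "benford_distributed mersenne"
  unfolding benford_distributed_def
proof (intro conjI allI impI ballI)
  fix n :: nat assume "n \<ge> 1"
  hence "prime (nth_prime n)" by (rule nth_prime_props)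
  hence "nth_prime n > 0" by (rule prime_gt_0_nat)
  thus "mersenne n > 0" by (simp add: mersenne_def)
next
  fix d :: nat assume d: "d \<in> {1..9}"
  define x where "x n = real (nth_prime n) * log 10 2" for n
  define I where "I = {log 10 (real d)..<log 10 (real d + 1)}"
  interpret weyl_sequence x
    by unfold_locales (unfold x_def, rule nth_prime_exponential_sum_tendsto_0)
  define A where "A N = {n \<in> {1..N}. leading_digit (mersenne n) = d}" for N
  define B where "B N = {n \<in> {1..N}. frac (x n) \<in> I}" for N
  have lim: "(\<lambda>N. real (card (B N)) / real N) \<longlonglongrightarrow> log 10 (real d + 1) - log 10 (real d)"
    unfolding B_def I_def using d by (intro weyl_equidistribution) auto
  have fin: "finite (A N)" "finite (B N)" for N by (auto simp: A_def B_def)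
  have same: "leading_digit (mersenne n) = d \<longleftrightarrow> frac (x n) \<in> I" if "n \<ge> 4" for n
    unfolding mersenne_def x_def I_def using that nth_prime_props(2)[of n] d
    by (intro leading_digit_mersenne_iff) auto
  \<comment> \<open>\<open>nth_prime n >= n\<close> makes the digit criterion available from index 4
    on, so the counts differ at most in the first three indices, which the limit does not
    see.\<close>
  have diff: "\<bar>real (card (A N)) - real (card (B N))\<bar> \<le> 3" for N
  proof -
    have "A N \<subseteq> B N \<union> {1..3}" "B N \<subseteq> A N \<union> {1..3}"
    proof -
      have "n \<in> A N \<longleftrightarrow> n \<in> B N" if "n \<notin> {1..3}" for n
        using same[of n] that unfolding A_def B_def by (cases "n \<ge> 4") auto
      thus "A N \<subseteq> B N \<union> {1..3}" "B N \<subseteq> A N \<union> {1..3}" by blast+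
    qed
    hence "card (A N) \<le> card (B N \<union> {1..3})" "card (B N) \<le> card (A N \<union> {1..3})"
      using fin by (auto intro!: card_mono)
    moreover have "card (B N \<union> {1..3}) \<le> card (B N) + 3" "card (A N \<union> {1..3}) \<le> card (A N) + 3"
      using card_Un_le[of "B N" "{1..3}"] card_Un_le[of "A N" "{1..3}"] by simp_all
    ultimately show ?thesis by linarith
  qed
  have "(\<lambda>N. real (card (A N)) / real N - real (card (B N)) / real N) \<longlonglongrightarrow> 0"
  proof (rule Lim_null_comparison)
    show "eventually (\<lambda>N. norm (real (card (A N)) / real N - real (card (B N)) / real N) \<le> 3 / real N) at_top"
      by (intro always_eventually allI)
         (use diff in \<open>simp add: diff_divide_distrib[symmetric] abs_divide divide_right_mono\<close>)
    show "(\<lambda>N. 3 / real N) \<longlonglongrightarrow> 0" by real_asymp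
  qed
  from tendsto_add[OF this lim]
  have "(\<lambda>N. real (card (A N)) / real N) \<longlonglongrightarrow> log 10 (real d + 1) - log 10 (real d)" by simp
  moreover have "log 10 (real d + 1) - log 10 (real d) = log 10 (1 + 1 / real d)"
  proof -
    have "log 10 ((real d + 1) / real d) = log 10 (real d + 1) - log 10 (real d)"
      using d by (simp add: log_def ln_div diff_divide_distrib)
    moreover have "(real d + 1) / real d = 1 + 1 / real d" using d by (simp add: field_simps)
    ultimately show ?thesis by simp
  qed
  ultimately show "(\<lambda>N. real (card {n \<in> {1..N}. leading_digit (mersenne n) = d}) / real N)
      \<longlonglongrightarrow> log 10 (1 + 1 / real d)"
    unfolding A_def by simp
qed

end
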